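(* Let $d\ge 1$, let $C\subset\mathbb{R}^d$ be an open convex cone, and let $K\subset\mathbb{R}^d$ be a bounded open convex set, symmetric with respect to the origin $\theta$, with $\theta\in\operatorname{int}K$. Let $p\in(d,\infty]$ and $p'=p/(p-1)$. (i) If $h>0$ and the charge $\nu\in\mathfrak{N}_{\rceil\cdot\lfloor_h}(C)$ is such that $D_\mu\nu\in W^{1,p}(C)$, then $$\|D_\mu\nu\|_{L_\infty(C)}\le A(d,p)\,\mu^{-\frac1p}(K\cap C)\,h^{1-\frac dp}\,\big\||\nabla D_\mu\nu|_{K^\circ}\big\|_{L_p(C)}+\mu^{-1}(K\cap C)\,h^{-d}\,\rceil\nu\lfloor_h,$$ where $$A(d,p)=d^{-1}B^{\frac1{p'}}\left(1-\frac{(d-1)p'}{d},\,p'+1\right).$$ This inequality is sharp: it becomes an equality for the charge $\nu_{e,h}$ such that $D_\mu\nu_{e,h}=f_{e,h}$, where $$f_{e,h}(y)=\begin{cases}\displaystyle\int_{|y|_K}^{h}g_h^{p'-1}(u)\,du, & y\in hK\cap C,\\ 0, & y\in C\setminus hK.\end{cases}$$ (ii) If the charge $\nu\in\mathfrak{N}_{\rceil\cdot\lfloor}(C)$ is such that $D_\mu\nu\in W^{1,p}(C)$, then the following multiplicative inequality holds: $$\|D_\mu\nu\|_{L_\infty(C)}\le a(d,p)\,\mu^{-\frac{\alpha}{d}}(K\cap C)\,\rceil\nu\lfloor^{1-\alpha}\,\big\||\nabla D_\mu\nu|_{K^\circ}\big\|_{L_p(C)}^{\alpha},$$ where $$\alpha=\frac{pd}{p+(p-1)d},\qquad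 a(d,p)=\left(\frac{(p-d)A(d,p)}{pd}\right)^{\alpha}\left(\frac{pd}{p-d}+1\right).$$ This multiplicative inequality is sharp: it becomes an equality for each charge $\nu$ such that $D_\mu\nu=f_{e,h}$, $h>0$.
   Context: $\mu$ is Lebesgue measure on $C$; $B(\cdot,\cdot)$ is the Euler beta function, and $B^{1/p'}(\cdot,\cdot)$ is its value raised to the power $1/p'$; $\mu^{s}(E)$ means $(\mu(E))^{s}$. For $p=\infty$ one has $p'=1$, $1/p=0$, and the expressions for $\alpha$ and $a(d,p)$ are understood as limits as $p\to\infty$. $(x,y)$ is the dot product in $\mathbb{R}^d$. For $x,z\in\mathbb{R}^d$: $|x|_K=\inf\{\lambda>0: x\in\lambda K\}$ and the dual norm is $|z|_{K^\circ}=\sup\{(x,z): |x|_K\le 1\}$. $\mathfrak{N}(C)$ is the linear space of charges (real-valued countably additive set functions, i.e. signed measures) $\nu$ defined on the Lebesgue measurable subsets of $C$ that are absolutely continuous with respect to $\mu$; $D_\mu\nu$ is the Radon--Nikodym derivative of $\nu$ with respect to $\mu$. For $h>0$ and $\nu\in\mathfrak{N}(C)$, $$\rceil\nu\lfloor_h=\sup_{x\in C}\left|\nu\big(x+(hK\cap C)\big)\right|,\qquad \rceil\nu\lfloor=\sup_{h>0}\rceil\nu\lfloor_h .$$ $\mathfrak{N}_{\rceil\cdot\lfloor_h}(C)$ (respectively $\mathfrak{N}_{\rceil\cdot\lfloor}(C)$) is the set of $\nu\in\mathfrak{N}(C)$ with $\rceil\nu\lfloor_h<\infty$ (respectively $\rceil\nu\lfloor<\infty$).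 $\nabla f$ is the gradient of a locally integrable function $f$, with derivatives in the distributional sense. $W^{1,p}(C)$ is the Sobolev space of (locally integrable) functions $f\colon C\to\mathbb{R}$ all of whose first-order distributional derivatives belong to $L_p(C)$. For $h>0$, $g_h\colon(0,h)\to\mathbb{R}$ is the function $$g_h(u)=\frac{1}{d\,\mu(K\cap C)}\left(\frac{1}{u^{d-1}}-\frac{u}{h^d}\right).$$ *)

theory Defs
  imports "HOL-Analysis.Analysis" "HOL-Probability.Essential_Supremum"
    "HOL-Real_Asymp.Real_Asymp"
begin

text \<open>The library's \<^const>\<open>cone\<close> and \<^const>\<open>conic\<close> also allow the factor 0, so a nonempty cone in
  that sense contains the origin; an open one would have to be the whole space.\<close>

definition positive_cone :: "'a::real_vector set \<Rightarrow> bool" where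
  "positive_cone C \<longleftrightarrow> C \<noteq> {} \<and> (\<forall>x\<in>C. \<forall>t>0. t *\<^sub>R x \<in> C)"

definition gauge_norm :: "'a::real_vector set \<Rightarrow> 'a \<Rightarrow> real" where
  "gauge_norm K x = Inf {t. t > 0 \<and> x \<in> (*\<^sub>R) t ` K}"

definition dual_norm :: "'a::real_inner set \<Rightarrow> 'a \<Rightarrow> real" where
  "dual_norm K z = Sup {x \<bullet> z | x. gauge_norm K x \<le> 1}"

text \<open>Exponents \<open>p\<close> have type \<^typ>\<open>ennreal\<close>, with \<^term>\<open>\<infinity>::ennreal\<close> for infinity. Norms take values in
  \<^typ>\<open>ennreal\<close> too, so that an inequality between them includes the finiteness of its left-hand
  side. The power function below is only used with exponents \<open>a > 0\<close>.\<close>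

definition epowr :: "ennreal \<Rightarrow> real \<Rightarrow> ennreal" where
  "epowr x a = (if x = \<infinity> then \<infinity> else ennreal (enn2real x powr a))"

definition Lp_norm :: "ennreal \<Rightarrow> 'a measure \<Rightarrow> ('a \<Rightarrow> real) \<Rightarrow> ennreal" where
  "Lp_norm p M f =
     (if p = \<infinity> then esssup M (\<lambda>x. ennreal \<bar>f x\<bar>)
      else epowr (\<integral>\<^sup>+x. ennreal (\<bar>f x\<bar> powr enn2real p) \<partial>M) (1 / enn2real p))"

definition Lp_space :: "ennreal \<Rightarrow> 'a measure \<Rightarrow> ('a \<Rightarrow> real) set" where
  "Lp_space p M = {f \<in> borel_measurable M. Lp_norm p M f < \<infinity>}"

fun Ck :: "nat \<Rightarrow> ('a::euclidean_space \<Rightarrow> real) \<Rightarrow> bool" where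
  "Ck 0 f \<longleftrightarrow> continuous_on UNIV f"
| "Ck (Suc k) f \<longleftrightarrow>
     (\<forall>x. f differentiable (at x)) \<and> (\<forall>v. Ck k (\<lambda>x. frechet_derivative f (at x) v))"

definition test_function :: "'a::euclidean_space set \<Rightarrow> ('a \<Rightarrow> real) \<Rightarrow> bool" where
  "test_function \<Omega> \<phi> \<longleftrightarrow>
     (\<forall>k. Ck k \<phi>) \<and> compact (closure {x. \<phi> x \<noteq> 0}) \<and> closure {x. \<phi> x \<noteq> 0} \<subseteq> \<Omega>"

definition locally_integrable ::
    "'a::euclidean_space set \<Rightarrow> ('a \<Rightarrow> 'b::{banach, second_countable_topology}) \<Rightarrow> bool" where
  "locally_integrable \<Omega> f \<longleftrightarrow> (\<forall>S. compact S \<and> S \<subseteq> \<Omega> \<longrightarrow> set_integrable lebesgue S f)"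

definition has_weak_gradient ::
    "'a::euclidean_space set \<Rightarrow> ('a \<Rightarrow> real) \<Rightarrow> ('a \<Rightarrow> 'a) \<Rightarrow> bool" where
  "has_weak_gradient \<Omega> f G \<longleftrightarrow>
     locally_integrable \<Omega> f \<and> locally_integrable \<Omega> G \<and>
     (\<forall>\<phi>. test_function \<Omega> \<phi> \<longrightarrow> (\<forall>b\<in>Basis.
        (LINT x:\<Omega>|lebesgue. f x * frechet_derivative \<phi> (at x) b)
          = - (LINT x:\<Omega>|lebesgue. (G x \<bullet> b) * \<phi> x)))"

text \<open>Only the derivatives are required to be in \<open>L\<^sub>p\<close>, not the function itself.\<close>

definition sobolev_W1 :: "ennreal \<Rightarrow> 'a::euclidean_space set \<Rightarrow> ('a \<Rightarrow> real) set" where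
  "sobolev_W1 p \<Omega> =
     {f. locally_integrable \<Omega> f \<and>
         (\<exists>G. has_weak_gradient \<Omega> f G \<and>
              (\<forall>b\<in>Basis. (\<lambda>x. G x \<bullet> b) \<in> Lp_space p (lebesgue_on \<Omega>)))}"

text \<open>A charge is a function on all sets of which only the values on the measurable subsets
  of \<open>C\<close> matter.\<close>

definition charge :: "'a measure \<Rightarrow> ('a set \<Rightarrow> real) \<Rightarrow> bool" where
  "charge M \<nu> \<longleftrightarrow> \<nu> {} = 0 \<and>
     (\<forall>A::nat \<Rightarrow> 'a set. range A \<subseteq> sets M \<and> disjoint_family A \<longrightarrow> (\<lambda>i. \<nu> (A i)) sums \<nu> (\<Union>i. A i))"

definition ac_charges :: "'a::euclidean_space set \<Rightarrow> ('a set \<Rightarrow> real) set" where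
  "ac_charges C =
     {\<nu>. charge (lebesgue_on C) \<nu> \<and> (\<forall>E \<in> null_sets (lebesgue_on C). \<nu> E = 0)}"

text \<open>The library's \<^const>\<open>RN_deriv\<close> is for nonnegative measures. As the derivative of a charge is
  unique only up to null sets, it is given as a relation: \<open>f\<close> is a version of the derivative.\<close>

definition has_RN_deriv ::
    "'a::euclidean_space set \<Rightarrow> ('a set \<Rightarrow> real) \<Rightarrow> ('a \<Rightarrow> real) \<Rightarrow> bool" where
  "has_RN_deriv C \<nu> f \<longleftrightarrow>
     integrable (lebesgue_on C) f \<and>
     (\<forall>E \<in> sets (lebesgue_on C). \<nu> E = (LINT x:E|lebesgue_on C. f x))"

definition charge_norm_h ::
    "'a::euclidean_space set \<Rightarrow> 'a set \<Rightarrow> real \<Rightarrow> ('a set \<Rightarrow> real) \<Rightarrow> ennreal" where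
  "charge_norm_h C K h \<nu> = (SUP x\<in>C. ennreal \<bar>\<nu> ((+) x ` ((*\<^sub>R) h ` K \<inter> C))\<bar>)"

definition charge_norm ::
    "'a::euclidean_space set \<Rightarrow> 'a set \<Rightarrow> ('a set \<Rightarrow> real) \<Rightarrow> ennreal" where
  "charge_norm C K \<nu> = (SUP h\<in>{0<..}. charge_norm_h C K h \<nu>)"

definition bounded_charges_h ::
    "'a::euclidean_space set \<Rightarrow> 'a set \<Rightarrow> real \<Rightarrow> ('a set \<Rightarrow> real) set" where
  "bounded_charges_h C K h = {\<nu> \<in> ac_charges C. charge_norm_h C K h \<nu> < \<infinity>}"

definition bounded_charges ::
    "'a::euclidean_space set \<Rightarrow> 'a set \<Rightarrow> ('a set \<Rightarrow> real) set" where
  "bounded_charges C K = {\<nu> \<in> ac_charges C. charge_norm C K \<nu> < \<infinity>}"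

definition conj_exp :: "ennreal \<Rightarrow> real" where
  "conj_exp p = (if p = \<infinity> then 1 else enn2real p / (enn2real p - 1))"

text \<open>\<open>1 / p\<close> as a real number, with value 0 at infinity.\<close>

abbreviation recip :: "ennreal \<Rightarrow> real" where
  "recip p \<equiv> enn2real (inverse p)"

text \<open>Expressions in \<open>p\<close> that are understood as limits when \<open>p\<close> is infinite.\<close>

definition extend_top :: "(real \<Rightarrow> real) \<Rightarrow> ennreal \<Rightarrow> real" where
  "extend_top F p = (if p = \<infinity> then Lim at_top F else F (enn2real p))"

definition A_const :: "nat \<Rightarrow> ennreal \<Rightarrow> real" where
  "A_const d p = 1 / real d *
     Beta (1 - (real d - 1) * conj_exp p / real d) (conj_exp p + 1) powr (1 / conj_exp p)"

definition alpha :: "nat \<Rightarrow> ennreal \<Rightarrow> real" where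
  "alpha d = extend_top (\<lambda>p. p * real d / (p + (p - 1) * real d))"

definition a_const :: "nat \<Rightarrow> ennreal \<Rightarrow> real" where
  "a_const d = extend_top (\<lambda>p.
     ((p - real d) * A_const d (ennreal p) / (p * real d)) powr alpha d (ennreal p) *
     (p * real d / (p - real d) + 1))"

text \<open>The limits exist, so \<^const>\<open>Lim\<close> returns the intended values.\<close>

lemma alpha_infinity:
  assumes "d \<ge> 1" shows "alpha d \<infinity> = real d / (real d + 1)"
proof -
  have "((\<lambda>p. p * real d / (p + (p - 1) * real d)) \<longlongrightarrow> real d / (real d + 1)) at_top"
    using assms by (real_asymp simp: field_simps)
  then show ?thesis unfolding alpha_def extend_top_def by (simp add: tendsto_Lim)
qed

lemma A_const_tendsto:
  assumes "d \<ge> 1" shows "((\<lambda>p. A_const d (ennreal p)) \<longlongrightarrow> A_const d \<infinity>) at_top"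
proof -
  let ?q = "\<lambda>p::real. p / (p - 1)"
  have q: "(?q \<longlongrightarrow> 1) at_top" by real_asymp
  have n1: "1 - (real d - 1) * 1 / real d \<notin> \<int>\<^sub>\<le>\<^sub>0" "1 + (1::real) \<notin> \<int>\<^sub>\<le>\<^sub>0"
    "(1 - (real d - 1) * 1 / real d) + (1+1) \<notin> \<int>\<^sub>\<le>\<^sub>0"
    using assms by (auto simp: field_simps dest!: nonpos_Ints_nonpos)
  have n0: "Gamma ((1 - (real d - 1) * 1 / real d) + (1+1)) \<noteq> 0"
    using n1(3) by (simp add: Gamma_eq_zero_iff)
  have n2: "Beta (1 - (real d - 1) * 1 / real d) (1 + 1) \<noteq> 0"
    using n1 by (simp add: Beta_def Gamma_eq_zero_iff)
  have "((\<lambda>p. 1 / real d * Beta (1 - (real d - 1) * ?q p / real d) (?q p + 1) powr (1 / ?q p)) \<longlongrightarrow>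
     1 / real d * Beta (1 - (real d - 1) * 1 / real d) (1 + 1) powr (1 / 1)) at_top"
    using n1 n0 n2 assms unfolding Beta_def
    by (intro tendsto_intros q tendsto_Gamma) auto
  moreover have "\<forall>\<^sub>F p in at_top. A_const d (ennreal p) =
      1 / real d * Beta (1 - (real d - 1) * ?q p / real d) (?q p + 1) powr (1 / ?q p)"
    using eventually_gt_at_top[of 0] by eventually_elim (simp add: A_const_def conj_exp_def)
  moreover have "A_const d \<infinity> = 1 / real d * Beta (1 - (real d - 1) * 1 / real d) (1 + 1) powr (1 / 1)"
    by (simp add: A_const_def conj_exp_def)
  ultimately show ?thesis
    unfolding \<open>A_const d \<infinity> = _\<close> by (subst tendsto_cong) assumption+
qed

lemma a_const_infinity:
  assumes d: "d \<ge> 1"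
  shows "a_const d \<infinity> = (A_const d \<infinity> / real d) powr alpha d \<infinity> * (real d + 1)"
proof -
  have ev: "\<forall>\<^sub>F p in at_top. alpha d (ennreal p) = p * real d / (p + (p - 1) * real d)"
    using eventually_gt_at_top[of 0] by eventually_elim (simp add: alpha_def extend_top_def)
  have "((\<lambda>p. p * real d / (p + (p - 1) * real d)) \<longlongrightarrow> real d / (real d + 1)) at_top"
    using d by (real_asymp simp: field_simps)
  then have al: "((\<lambda>p. alpha d (ennreal p)) \<longlongrightarrow> alpha d \<infinity>) at_top"
    using alpha_infinity[OF d] tendsto_cong[OF ev] by simp
  have A0: "A_const d \<infinity> \<noteq> 0"
  proof -
    have "Beta (1 / real d) 2 \<noteq> 0"
      using d by (auto simp: Beta_def Gamma_eq_zero_iff field_simps dest!: nonpos_Ints_nonpos)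
    moreover have "1 - (real d - 1) / real d = 1 / real d" using d by (simp add: field_simps)
    ultimately show ?thesis using d by (simp add: A_const_def conj_exp_def)
  qed
  have 1: "((\<lambda>p. (p - real d) / (p * real d)) \<longlongrightarrow> 1 / real d) at_top" using d by (real_asymp simp: field_simps)
  have 2: "((\<lambda>p. p * real d / (p - real d) + 1) \<longlongrightarrow> real d + 1) at_top" using d by real_asymp
  have "((\<lambda>p. ((p - real d) / (p * real d) * A_const d (ennreal p)) powr alpha d (ennreal p) *
     (p * real d / (p - real d) + 1)) \<longlongrightarrow> (1 / real d * A_const d \<infinity>) powr alpha d \<infinity> * (real d + 1)) at_top"
    using A0 d by (intro tendsto_mult tendsto_powr 1 2 al A_const_tendsto) auto
  then show ?thesis unfolding a_const_def extend_top_def by (simp add: tendsto_Lim)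
qed

definition g_kernel :: "'a::euclidean_space set \<Rightarrow> 'a set \<Rightarrow> real \<Rightarrow> real \<Rightarrow> real" where
  "g_kernel C K h u =
     1 / (real DIM('a) * measure lebesgue (K \<inter> C)) *
     (1 / u ^ (DIM('a) - 1) - u / h ^ DIM('a))"

definition f_extremal ::
    "'a::euclidean_space set \<Rightarrow> 'a set \<Rightarrow> ennreal \<Rightarrow> real \<Rightarrow> 'a \<Rightarrow> real" where
  "f_extremal C K p h y =
     (if y \<in> (*\<^sub>R) h ` K \<inter> C
      then (LINT u:{gauge_norm K y<..<h}|lborel. g_kernel C K h u powr (conj_exp p - 1))
      else 0)"

end

theory Submission
  imports Defs
begin

text \<open>Tested against a function \<open>\<phi> \<ge> 0\<close>, the difference between \<open>f\<close> and its average over \<open>x + (hK \<inter> C)\<close>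
  is an average of the weak gradient along the segments from \<open>x\<close> into \<open>x + (hK \<inter> C)\<close>: the
  increments of \<open>f\<close> are moved onto \<open>\<phi>\<close>, whose translates by elements of \<open>C\<close> are test functions on \<open>C\<close>
  again. Scaling the segments turns this average into an integral of the dual norm of the gradient
  against \<open>g\<^sub>h\<close>, and Hoelder's inequality and a Beta integral give the additive inequality. The
  multiplicative one follows by minimising over \<open>h\<close>.

  The extremal function is \<open>F(|y|)\<close> with \<open>F' = - g\<^sub>h\<^sup>p\<^sup>'\<^sup>-\<^sup>1\<close>, for which Hoelder's inequality is an equality as
  soon as the gradient of the gauge has dual norm 1 almost everywhere. Rademacher's theorem is avoided here:
  the one-sided directional derivatives of the gauge exist everywhere by convexity and are also its weak
  derivatives, so uniqueness of the latter makes them linear in the direction, for almost every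
  point and all directions of a countable dense set at once.\<close>

subsection \<open>Test functions\<close>

text \<open>Neither \<open>f\<close> nor its gradient has pointwise values, so every estimate is
  made after integration against a test function; this works because C + C is contained in C. The
  kernel is forced: with z = t y, integrating t^(-d-1) over N z / h < t \<le> 1 and dividing by the
  volume m h^d of \<open>E h\<close> leaves N z ((h / N z)^d - 1) / (d m h^d), which is the kernel
  at N z. Sharpness has one numerical cause. For the extremal function the gradient term of the
  additive inequality equals I, the integral of the p'-th power of the kernel over
  \<open>E h\<close>; the charge term equals \<kappa> I with \<kappa> = 1/d - 1/p; and the supremum
  is their sum. As functions of t = h^d the two terms of the additive inequality have the form a
  t^\<kappa> and b / t, and the ratio \<kappa> between them is precisely the condition for t to be
  the minimiser. So each extremal function sits at the optimal value of h, and the multiplicative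
  inequality is an equality for all of them.\<close>

lemma Ck_SucI:
  assumes "\<And>x. (f has_derivative f' x) (at x)" "\<And>v. Ck k (\<lambda>x. f' x v)"
  shows "Ck (Suc k) f"
proof -
  have "frechet_derivative f (at x) = f' x" for x
    using frechet_derivative_at[OF assms(1)] by simp
  then show ?thesis using assms by (auto simp: differentiable_def)
qed

lemma Ck_SucD:
  assumes "Ck (Suc k) f"
  shows "(f has_derivative frechet_derivative f (at x)) (at x)"
    and "Ck k (\<lambda>x. frechet_derivative f (at x) v)"
  using assms by (auto simp: frechet_derivative_works)

lemma Ck_Suc_imp_Ck: "Ck (Suc k) f \<Longrightarrow> Ck k f"
proof (induction k arbitrary: f)
  case 0
  then have "f differentiable_on UNIV" by (simp add: differentiable_on_def)
  then show ?case by (simp add: differentiable_imp_continuous_on)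
next
  case (Suc k)
  then show ?case by (meson Ck.simps(2))
qed

lemma Ck_const: "Ck k (\<lambda>x. c)"
  by (induction k arbitrary: c) (auto simp: frechet_derivative_const)

lemma Ck_add: "Ck k f \<Longrightarrow> Ck k g \<Longrightarrow> Ck k (\<lambda>x. f x + g x)"
proof (induction k arbitrary: f g)
  case 0
  then show ?case by (auto intro: continuous_on_add)
next
  case (Suc k)
  show ?case
    by (rule Ck_SucI[OF has_derivative_add[OF Ck_SucD(1)[OF Suc.prems(1)] Ck_SucD(1)[OF Suc.prems(2)]]])
      (intro Suc.IH Ck_SucD(2) Suc.prems)
qed

lemma Ck_mult: "Ck k f \<Longrightarrow> Ck k g \<Longrightarrow> Ck k (\<lambda>x. f x * g x)"
proof (induction k arbitrary: f g)
  case 0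
  then show ?case by (auto intro: continuous_on_mult)
next
  case (Suc k)
  show ?case
    by (rule Ck_SucI[OF has_derivative_mult[OF Ck_SucD(1)[OF Suc.prems(1)] Ck_SucD(1)[OF Suc.prems(2)]]])
      (intro Suc.IH Ck_add Ck_SucD(2)[OF Suc.prems(1)] Ck_SucD(2)[OF Suc.prems(2)]
        Ck_Suc_imp_Ck[OF Suc.prems(1)] Ck_Suc_imp_Ck[OF Suc.prems(2)])
qed

lemma Ck_prod: "(\<And>i. i \<in> I \<Longrightarrow> Ck k (f i)) \<Longrightarrow> Ck k (\<lambda>x. \<Prod>i\<in>I. f i x)"
  by (induction I rule: infinite_finite_induct) (auto intro: Ck_const Ck_mult)

lemma Ck_diff: "Ck k f \<Longrightarrow> Ck k g \<Longrightarrow> Ck k (\<lambda>x. f x - g x)"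
  using Ck_add[of k f "\<lambda>x. (-1) * g x"] Ck_mult[OF Ck_const, of k g "-1"] by simp

lemma Ck_translate: "Ck k f \<Longrightarrow> Ck k (\<lambda>x. f (x - w))"
proof (induction k arbitrary: f)
  case 0
  then have "continuous_on UNIV f" by simp
  then have "continuous_on UNIV (\<lambda>x. f (x - w))"
    by (rule continuous_on_compose2) (auto intro!: continuous_intros)
  then show ?case by simp
next
  case (Suc k)
  have "((\<lambda>x. f (x - w)) has_derivative frechet_derivative f (at (x - w))) (at x)" for x
    by (rule has_derivative_compose[where g=f, OF _ Ck_SucD(1)[OF Suc.prems], of "\<lambda>x. x - w" "\<lambda>v. v", simplified])
      (auto intro!: derivative_eq_intros)
  then show ?case
    by (rule Ck_SucI) (intro Suc.IH Ck_SucD(2) Suc.prems)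
qed

section \<open>Smooth bump functions\<close>

text \<open>\<open>eta 0\<close> is the classical smooth function that is flat at 0; the larger
  indices only serve to express its derivatives.\<close>

definition eta :: "nat \<Rightarrow> real \<Rightarrow> real" where
  "eta j t = (if t > 0 then (1 / t) ^ j * exp (- 1 / t) else 0)"

text \<open>The family \<^const>\<open>eta\<close> is closed under differentiation up to linear combinations, which makes
  smoothness a one-line induction.\<close>

lemma eta_has_derivative:
  "(eta j has_real_derivative (- real j * eta (Suc j) t + eta (Suc (Suc j)) t)) (at t)"
proof (cases "t = 0")
  case False
  show ?thesis
  proof (cases "t > 0")
    case True
    have "((\<lambda>t. (1 / t) ^ j * exp (- 1 / t)) has_real_derivative
        (- real j * eta (Suc j) t + eta (Suc (Suc j)) t)) (at t)"
      using True
      by (cases j) (auto intro!: derivative_eq_intros simp: eta_def power2_eq_square field_simps power_divide,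
        metis power_minus_mult One_nat_def mult.commute not_gr0)
    then show ?thesis
      by (rule has_field_derivative_transform_within_open[where S="{0<..}"])
        (use True in \<open>auto simp: eta_def\<close>)
  next
    case neg: False
    then have "((\<lambda>_::real. 0) has_real_derivative (- real j * eta (Suc j) t + eta (Suc (Suc j)) t)) (at t)"
      by (auto simp: eta_def)
    then show ?thesis
      by (rule has_field_derivative_transform_within_open[where S="{..<0}"])
        (use neg False in \<open>auto simp: eta_def\<close>)
  qed
next
  case True
  \<comment> \<open>Dividing by h raises the power of 1/h by one, so the difference quotient of
    \<open>eta j\<close> at 0 is \<open>eta (Suc j)\<close>. It tends to 0 because the exponential
    beats every power.\<close>
  have lim: "((\<lambda>h. eta (Suc j) h) \<longlongrightarrow> 0) (at 0)"
    unfolding filterlim_at_split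
  proof
    show "(eta (Suc j) \<longlongrightarrow> 0) (at_left 0)"
      by (rule tendsto_eventually) (auto simp: eventually_at_filter eta_def)
    have "((\<lambda>h. inverse h ^ Suc j / exp (inverse h)) \<longlongrightarrow> (0::real)) (at_right 0)"
      by (rule filterlim_compose[OF tendsto_power_div_exp_0 filterlim_inverse_at_top_right])
    then show "(eta (Suc j) \<longlongrightarrow> 0) (at_right 0)"
      by (rule Lim_transform_eventually)
        (auto simp: eventually_at_filter eta_def exp_minus field_simps)
  qed
  have "((\<lambda>h. (eta j (0 + h) - eta j 0) / h) \<longlongrightarrow> 0) (at 0)"
    by (rule Lim_transform_eventually[OF lim]) (auto simp: eventually_at_filter eta_def field_simps)
  then show ?thesis using True by (simp add: DERIV_def eta_def)
qed

lemma continuous_eta: "continuous_on UNIV (eta j)"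
  using DERIV_isCont[OF eta_has_derivative] by (simp add: continuous_at_imp_continuous_on)

lemma Ck_eta: "Ck k (\<lambda>x::'a::euclidean_space. eta j (s + c * (x \<bullet> b)))"
proof (induction k arbitrary: j)
  case 0
  have "continuous_on UNIV (\<lambda>x::'a. eta j (s + c * (x \<bullet> b)))"
    by (rule continuous_on_compose2[OF continuous_eta]) (auto intro!: continuous_intros)
  then show ?case by simp
next
  case (Suc k)
  have "((\<lambda>x::'a. eta j (s + c * (x \<bullet> b))) has_derivative
      (\<lambda>v. (c * (v \<bullet> b)) * (- real j * eta (Suc j) (s + c * (x \<bullet> b)) + eta (Suc (Suc j)) (s + c * (x \<bullet> b))))) (at x)" for x
  proof -
    have 1: "((\<lambda>x::'a. s + c * (x \<bullet> b)) has_derivative (\<lambda>v. c * (v \<bullet> b))) (at x)"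
      by (auto intro!: derivative_eq_intros)
    show ?thesis
      using has_derivative_compose[OF 1 eta_has_derivative[unfolded has_field_derivative_def], of j]
      by (simp add: mult.commute)
  qed
  then show ?case
    by (rule Ck_SucI) (intro Ck_mult Ck_add Ck_const Suc.IH)
qed

lemma eta_0_bounds: "0 \<le> eta 0 t" "eta 0 t \<le> 1"
  by (auto simp: eta_def)

text \<open>A product of two flat factors per coordinate, positive exactly inside the box when n >
  0. The factor n in the arguments leaves the support alone and pushes the values inside towards
  1.\<close>

definition box_bump :: "nat \<Rightarrow> 'a::euclidean_space \<Rightarrow> 'a \<Rightarrow> 'a \<Rightarrow> real" where
  "box_bump n a c x =
     (\<Prod>b\<in>Basis. eta 0 (real n * (x \<bullet> b - a \<bullet> b)) * eta 0 (real n * (c \<bullet> b - x \<bullet> b)))"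

lemma box_bump_bounds: "0 \<le> box_bump n a c x" "box_bump n a c x \<le> 1"
  unfolding box_bump_def
  by (auto intro!: prod_nonneg prod_le_1 mult_nonneg_nonneg mult_le_one simp: eta_0_bounds)

lemma box_bump_outside: "x \<notin> box a c \<Longrightarrow> box_bump n a c x = 0"
proof -
  assume "x \<notin> box a c"
  then obtain b where "b \<in> Basis" "x \<bullet> b \<le> a \<bullet> b \<or> c \<bullet> b \<le> x \<bullet> b"
    by (auto simp: box_def not_less)
  then have "eta 0 (real n * (x \<bullet> b - a \<bullet> b)) * eta 0 (real n * (c \<bullet> b - x \<bullet> b)) = 0"
    by (auto simp: eta_def zero_less_mult_iff)
  then show ?thesis
    unfolding box_bump_def using \<open>b \<in> Basis\<close> by (intro prod_zero) auto
qed

lemma Ck_box_bump: "Ck k (box_bump n a c)"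
proof -
  have "Ck k (\<lambda>x. eta 0 (real n * (x \<bullet> b - a \<bullet> b)) * eta 0 (real n * (c \<bullet> b - x \<bullet> b)))" for b
    using Ck_mult[OF Ck_eta[of k 0 "- real n * (a \<bullet> b)" "real n" b] Ck_eta[of k 0 "real n * (c \<bullet> b)" "- real n" b]]
    by (simp add: algebra_simps)
  then show ?thesis unfolding box_bump_def[abs_def] by (intro Ck_prod)
qed

lemma eta_0_tendsto: "t > 0 \<Longrightarrow> (\<lambda>n. eta 0 (real n * t)) \<longlonglongrightarrow> 1"
proof -
  assume "t > 0"
  then have "(\<lambda>n. exp (- 1 / (real n * t))) \<longlonglongrightarrow> 1" by real_asymp
  then show ?thesis
    by (rule Lim_transform_eventually)
      (use \<open>t > 0\<close> in \<open>auto simp: eta_def intro!: eventually_mono[OF eventually_gt_at_top[of 0]]\<close>)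
qed

lemma box_bump_tendsto:
  assumes "x \<in> box a c" shows "(\<lambda>n. box_bump n a c x) \<longlonglongrightarrow> 1"
proof -
  have "(\<lambda>n. \<Prod>b\<in>Basis. eta 0 (real n * (x \<bullet> b - a \<bullet> b)) * eta 0 (real n * (c \<bullet> b - x \<bullet> b)))
      \<longlonglongrightarrow> (\<Prod>b::'a\<in>Basis. 1 * 1)"
    by (intro tendsto_prod tendsto_mult eta_0_tendsto) (use assms in \<open>auto simp: box_def\<close>)
  then show ?thesis by (simp add: box_bump_def)
qed

lemma test_functionI:
  assumes "\<And>k. Ck k \<phi>" "closed S" "bounded S" "S \<subseteq> \<Omega>" "\<And>x. x \<notin> S \<Longrightarrow> \<phi> x = 0"
  shows "test_function \<Omega> \<phi>"
proof -
  have "closure {x. \<phi> x \<noteq> 0} \<subseteq> S" using assms by (intro closure_minimal) auto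
  then show ?thesis
    unfolding test_function_def using assms by (auto intro: bounded_subset simp: compact_eq_bounded_closed)
qed

lemma test_function_continuous: "test_function \<Omega> \<phi> \<Longrightarrow> continuous_on UNIV \<phi>"
  unfolding test_function_def by (metis Ck.simps(1))

lemma test_function_measurable: "test_function \<Omega> \<phi> \<Longrightarrow> \<phi> \<in> borel_measurable borel"
  by (intro borel_measurable_continuous_onI test_function_continuous)

section \<open>Almost everywhere inequalities from test functions\<close>

text \<open>The complement of E is a countable union of open boxes. A bump on the large box is
  multiplied by 1 minus a bump for each of the first n of them: on E all these factors are 1, and
  off E one of them tends to 0.\<close>

lemma closed_indicator_limit_of_test_functions:
  fixes E :: "'a::euclidean_space set"
  assumes "closed E" "E \<subseteq> box a c" "cbox a c \<subseteq> \<Omega>"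
  obtains \<theta> :: "nat \<Rightarrow> 'a \<Rightarrow> real"
  where "\<And>n. test_function \<Omega> (\<theta> n)" "\<And>n x. 0 \<le> \<theta> n x" "\<And>n x. \<theta> n x \<le> 1"
    "\<And>n x. x \<notin> cbox a c \<Longrightarrow> \<theta> n x = 0" "\<And>x. (\<lambda>n. \<theta> n x) \<longlonglongrightarrow> indicator E x"
proof -
  obtain \<D> where D: "countable \<D>" "\<And>X. X \<in> \<D> \<Longrightarrow> \<exists>u v. X = box u v" "\<Union>\<D> = - E"
    using open_countable_Union_open_box[of "- E"] assms(1) by (metis open_Compl)
  \<comment> \<open>The empty box is added so that \<open>from_nat_into\<close> enumerates a
    nonempty family.\<close>
  let ?D = "insert (box 0 0) \<D>"
  have "\<forall>i. \<exists>u v. from_nat_into ?D i = box u v"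
    using D(2) from_nat_into[of ?D] by blast
  then obtain u v where uv: "\<And>i. from_nat_into ?D i = box (u i) (v i)" by metis
  have "range (from_nat_into ?D) = ?D"
    using D(1) by (intro range_from_nat_into) auto
  then have "(\<Union>i. from_nat_into ?D i) = \<Union>?D" by simp
  then have un: "(\<Union>i. box (u i) (v i)) = - E" using D(3) uv by simp
  define \<theta> where "\<theta> n x = box_bump n a c x * (\<Prod>i<n. 1 - box_bump n (u i) (v i) x)" for n x
  show ?thesis
  proof (rule that[of \<theta>])
    show z: "x \<notin> cbox a c \<Longrightarrow> \<theta> n x = 0" for n x
    proof -
      assume "x \<notin> cbox a c"
      then have "x \<notin> box a c" using box_subset_cbox[of a c] by blast
      then show ?thesis by (simp add: \<theta>_def box_bump_outside)
    qed
    show "test_function \<Omega> (\<theta> n)" for n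
    proof (rule test_functionI[of _ "cbox a c"])
      show "Ck k (\<theta> n)" for k
        unfolding \<theta>_def[abs_def] by (intro Ck_mult Ck_prod Ck_diff Ck_const Ck_box_bump)
    qed (use z assms in auto)
    show 0: "0 \<le> \<theta> n x" for n x
      by (auto simp: \<theta>_def box_bump_bounds intro!: mult_nonneg_nonneg prod_nonneg)
    have le1: "(\<Prod>i<n. 1 - box_bump n (u i) (v i) x) \<le> 1" for n x
      by (rule prod_le_1) (auto simp: box_bump_bounds)
    show 1: "\<theta> n x \<le> 1" for n x
      unfolding \<theta>_def
      by (intro mult_le_one box_bump_bounds le1 prod_nonneg) (auto simp: box_bump_bounds)
    show "(\<lambda>n. \<theta> n x) \<longlonglongrightarrow> indicator E x" for x
    proof (cases "x \<in> E")
      case True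
      then have "x \<notin> box (u i) (v i)" for i using un by blast
      then have "\<theta> n x = box_bump n a c x" for n by (simp add: \<theta>_def box_bump_outside)
      then show ?thesis using True assms(2) box_bump_tendsto[of x a c] by auto
    next
      case False
      then obtain i where i: "x \<in> box (u i) (v i)" using un by blast
      have "\<theta> n x \<le> 1 - box_bump n (u i) (v i) x" if "n > i" for n
      proof -
        have "(\<Prod>i<n. 1 - box_bump n (u i) (v i) x)
            = (1 - box_bump n (u i) (v i) x) * (\<Prod>j\<in>{..<n} - {i}. 1 - box_bump n (u j) (v j) x)"
          using that by (simp add: prod.remove)
        also have "\<dots> \<le> (1 - box_bump n (u i) (v i) x) * 1"
          by (intro mult_left_mono prod_le_1) (auto simp: box_bump_bounds)
        finally have "(\<Prod>i<n. 1 - box_bump n (u i) (v i) x) \<le> 1 - box_bump n (u i) (v i) x" by simp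
        moreover have "\<theta> n x \<le> 1 * (\<Prod>i<n. 1 - box_bump n (u i) (v i) x)"
          unfolding \<theta>_def by (intro mult_right_mono prod_nonneg) (auto simp: box_bump_bounds)
        ultimately show ?thesis by simp
      qed
      then have "\<forall>\<^sub>F n in sequentially. \<theta> n x \<le> 1 - box_bump n (u i) (v i) x"
        by (rule eventually_mono[OF eventually_gt_at_top[of i]])
      moreover have "(\<lambda>n. 1 - box_bump n (u i) (v i) x) \<longlonglongrightarrow> 1 - 1"
        by (intro tendsto_intros box_bump_tendsto i)
      ultimately have "(\<lambda>n. \<theta> n x) \<longlonglongrightarrow> 0"
        by (intro tendsto_sandwich[of "\<lambda>_. 0" "\<lambda>n. \<theta> n x" _ "\<lambda>n. 1 - box_bump n (u i) (v i) x"])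
          (auto simp: 0)
      then show ?thesis using False by simp
    qed
  qed
qed

lemma locally_integrableD:
  "locally_integrable \<Omega> f \<Longrightarrow> compact S \<Longrightarrow> S \<subseteq> \<Omega> \<Longrightarrow> set_integrable lebesgue S f"
  by (auto simp: locally_integrable_def)

text \<open>A one-sided form of the fundamental lemma of the calculus of variations, which turns
  tested estimates into essential bounds. On a closed part of {g > B} inside a box, test functions
  converge to the indicator, so g - B has nonpositive integral there although it is positive; hence
  that part is null. Inner regularity passes from closed sets to the whole set, and countably many
  boxes cover the domain.\<close>

lemma AE_le_of_test_functions:
  fixes g :: "'a::euclidean_space \<Rightarrow> real"
  assumes "open \<Omega>" "locally_integrable \<Omega> g"
    and test: "\<And>\<phi>. test_function \<Omega> \<phi> \<Longrightarrow> (\<And>x. 0 \<le> \<phi> x) \<Longrightarrow>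
      (LINT x:\<Omega>|lebesgue. g x * \<phi> x) \<le> B * (LINT x|lebesgue. \<phi> x)"
  shows "AE x in lebesgue. x \<in> \<Omega> \<longrightarrow> g x \<le> B"
proof -
  have box: "AE x in lebesgue. x \<in> cbox a c \<longrightarrow> g x \<le> B" if sub: "cbox a c \<subseteq> \<Omega>" for a c
  proof -
    have gi: "integrable lebesgue (\<lambda>x. indicator (cbox a c) x * g x)"
      using locally_integrableD[OF assms(2) compact_cbox sub] by (simp add: set_integrable_def)
    \<comment> \<open>The factor \<open>indicator (cbox a c)\<close> gives measurability:
      \<open>g\<close> is only known to be measurable on compact subsets.\<close>
    define S where "S = {x. indicator (box a c) x * (indicator (cbox a c) x * g x - B) > 0}"
    have "box a c \<in> sets lebesgue" by simp
    then have "(\<lambda>x. indicator (box a c) x * (indicator (cbox a c) x * g x - B)) \<in> borel_measurable lebesgue"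
      by (intro borel_measurable_times borel_measurable_diff borel_measurable_const
        borel_measurable_indicator borel_measurable_integrable[OF gi])
    then have Sm: "S \<in> sets lebesgue"
      unfolding S_def using borel_measurable_less[of "\<lambda>_. 0" lebesgue] by simp
    have S: "x \<in> S \<longleftrightarrow> x \<in> box a c \<and> g x > B" for x
      using box_subset_cbox[of a c] by (auto simp: S_def indicator_def)
    have closed_null: "emeasure lebesgue E = 0" if E: "closed E" "E \<subseteq> S" for E
    proof -
      have Eb: "E \<subseteq> box a c" using E(2) S by blast
      obtain \<theta> where \<theta>: "\<And>n. test_function \<Omega> (\<theta> n)" "\<And>n x. 0 \<le> \<theta> n x" "\<And>n x. \<theta> n x \<le> 1"
        "\<And>n x. x \<notin> cbox a c \<Longrightarrow> \<theta> n x = 0" "\<And>x. (\<lambda>n. \<theta> n x) \<longlonglongrightarrow> indicator E x"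
        by (rule closed_indicator_limit_of_test_functions[OF E(1) Eb sub]) blast
      have \<theta>m[measurable]: "\<theta> n \<in> borel_measurable lebesgue" for n
        using test_function_measurable[OF \<theta>(1)] by (intro measurable_completion) simp
      have Em[measurable]: "E \<in> sets lebesgue" using E by auto
      have ci: "integrable lebesgue (indicator (cbox a c) :: 'a \<Rightarrow> real)"
        using lmeasurable_cbox[of a c] by (intro integrable_real_indicator) (auto simp: fmeasurable_def)
      have "(\<lambda>n. LINT x|lebesgue. \<theta> n x) \<longlonglongrightarrow> (LINT x|lebesgue. indicator E x)"
        by (rule integral_dominated_convergence[where w="indicator (cbox a c)"])
          (use \<theta> ci in \<open>auto simp: indicator_def\<close>)
      then have l1: "(\<lambda>n. B * (LINT x|lebesgue. \<theta> n x)) \<longlonglongrightarrow> B * (LINT x|lebesgue. indicator E x)"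
        by (intro tendsto_intros)
      have gm[measurable]: "(\<lambda>x. indicator (cbox a c) x * g x) \<in> borel_measurable lebesgue" using gi by auto
      have eq: "(LINT x:\<Omega>|lebesgue. g x * \<theta> n x) = (LINT x|lebesgue. (indicator (cbox a c) x * g x) * \<theta> n x)" for n
        unfolding set_lebesgue_integral_def
        by (intro Bochner_Integration.integral_cong) (use \<theta>(4) sub in \<open>auto simp: indicator_def\<close>)
      have "(\<lambda>n. LINT x|lebesgue. (indicator (cbox a c) x * g x) * \<theta> n x)
          \<longlonglongrightarrow> (LINT x|lebesgue. (indicator (cbox a c) x * g x) * indicator E x)"
      proof (rule integral_dominated_convergence[where w="\<lambda>x. \<bar>indicator (cbox a c) x * g x\<bar>"])
        show "AE x in lebesgue. norm (indicator (cbox a c) x * g x * \<theta> n x) \<le> \<bar>indicator (cbox a c) x * g x\<bar>" for n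
          using \<theta>(2,3)[of n] by (auto simp: abs_mult intro!: mult_right_le_one_le)
        show "(\<lambda>x. indicator (cbox a c) x * g x * indicator E x) \<in> borel_measurable lebesgue"
          by (intro borel_measurable_times[OF gm] borel_measurable_indicator Em)
        show "(\<lambda>x. indicator (cbox a c) x * g x * \<theta> n x) \<in> borel_measurable lebesgue" for n
          by (intro borel_measurable_times[OF gm] \<theta>m)
        show "AE x in lebesgue. (\<lambda>n. indicator (cbox a c) x * g x * \<theta> n x)
            \<longlonglongrightarrow> indicator (cbox a c) x * g x * indicator E x"
          by (intro AE_I2 tendsto_mult_left \<theta>(5))
      qed (use gi in auto)
      then have l2: "(\<lambda>n. LINT x:\<Omega>|lebesgue. g x * \<theta> n x)
          \<longlonglongrightarrow> (LINT x|lebesgue. (indicator (cbox a c) x * g x) * indicator E x)" by (simp add: eq)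
      have le: "(LINT x|lebesgue. (indicator (cbox a c) x * g x) * indicator E x) \<le> B * (LINT x|lebesgue. indicator E x)"
        by (rule LIMSEQ_le[OF l2 l1]) (use test[OF \<theta>(1,2)] in auto)
      have ei: "integrable lebesgue (indicator E :: 'a \<Rightarrow> real)"
        by (rule Bochner_Integration.integrable_bound[OF ci]) 
          (use Eb box_subset_cbox[of a c] in \<open>auto simp: indicator_def\<close>)
      have gei: "integrable lebesgue (\<lambda>x. (indicator (cbox a c) x * g x) * indicator E x)"
        by (rule Bochner_Integration.integrable_bound[OF gi borel_measurable_times[OF gm borel_measurable_indicator[OF Em]]])
          (auto simp: indicator_def)
      define q where "q x = (indicator (cbox a c) x * g x) * indicator E x - B * indicator E x" for x
      have qi: "integrable lebesgue q"
        unfolding q_def[abs_def] using gei ei by (intro Bochner_Integration.integrable_diff) auto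
      have q: "q x = indicator E x * (g x - B)" for x
        using Eb box_subset_cbox[of a c] by (auto simp: q_def indicator_def)
      have q0: "q x \<ge> 0" for x unfolding q using E(2) S by (auto simp: indicator_def dest!: subsetD[of E S])
      have "(LINT x|lebesgue. q x) \<le> 0"
        unfolding q_def using le gei ei by (subst Bochner_Integration.integral_diff) auto
      then have "(LINT x|lebesgue. q x) = 0" using q0 by (simp add: integral_nonneg antisym)
      then have "AE x in lebesgue. q x = 0"
        using integral_nonneg_eq_0_iff_AE[OF qi] q0 by simp
      then have "AE x in lebesgue. x \<notin> E"
        by eventually_elim (use E(2) S q in \<open>fastforce simp: indicator_def\<close>)
      then show ?thesis
        using AE_iff_measurable[of E lebesgue "\<lambda>x. x \<notin> E"] Em by simp
    qed
    have "emeasure lebesgue S \<le> 0"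
    proof (rule ennreal_le_epsilon)
      fix e :: real assume "0 < e"
      then obtain T where T: "closed T" "T \<subseteq> S" "S - T \<in> lmeasurable" "emeasure lebesgue (S - T) < ennreal e"
        using sets_lebesgue_inner_closed[OF Sm] by metis
      have "emeasure lebesgue S \<le> emeasure lebesgue (S - T) + emeasure lebesgue T"
        using emeasure_subadditive[of "S - T" lebesgue T] T Sm by (simp add: fmeasurableD Un_absorb2)
      then show "emeasure lebesgue S \<le> 0 + ennreal e"
        using T closed_null[OF T(1,2)] by simp
    qed
    then have "S \<in> null_sets lebesgue" using Sm by auto
    then have "AE x in lebesgue. x \<notin> S" by (rule AE_not_in)
    moreover have "cbox a c - box a c \<in> null_sets lebesgue"
      using negligible_frontier_interval[of a c] by (simp add: negligible_iff_null_sets)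
    then have "AE x in lebesgue. x \<notin> cbox a c - box a c" by (rule AE_not_in)
    ultimately show ?thesis by eventually_elim (auto simp: S)
  qed
  obtain \<D> where D: "countable \<D>" "\<D> \<subseteq> Pow \<Omega>" "\<And>X. X \<in> \<D> \<Longrightarrow> \<exists>u v. X = cbox u v" "\<Union>\<D> = \<Omega>"
    using open_countable_Union_open_cbox[OF assms(1)] by metis
  have "AE x in lebesgue. \<forall>X\<in>\<D>. x \<in> X \<longrightarrow> g x \<le> B"
  proof (subst AE_ball_countable[OF D(1)], intro ballI)
    fix X assume X: "X \<in> \<D>"
    then obtain u v where "X = cbox u v" using D(3) by blast
    then show "AE x in lebesgue. x \<in> X \<longrightarrow> g x \<le> B" using box[of u v] X D(2) by auto
  qed
  then show ?thesis by eventually_elim (use D(4) in auto)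
qed

subsection \<open>The gauge of a symmetric convex body and its dual norm\<close>

text \<open>The gauge is accessible through its strict sublevel sets (\<open>N_less_iff\<close>);
  this rule turns equivalences between them into equations.\<close>

lemma eq_if_same_strict_upper_bounds:
  fixes a b :: real
  assumes "0 \<le> a" "0 \<le> b" "\<And>h. 0 < h \<Longrightarrow> a < h \<longleftrightarrow> b < h"
  shows "a = b"
  using assms(3)[of a] assms(3)[of b] assms(1,2) by (metis less_irrefl linorder_less_linear order_le_less_trans)

locale convex_body =
  fixes K :: "'a::euclidean_space set"
  assumes bounded_K: "bounded K" and open_K: "open K" and convex_K: "convex K"
    and symmetric_K: "x \<in> K \<Longrightarrow> - x \<in> K" and zero_in_K: "0 \<in> K"
begin

abbreviation "N \<equiv> gauge_norm K"
abbreviation "N' \<equiv> dual_norm K"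

lemma mem_scaled_K: "t > 0 \<Longrightarrow> x \<in> (*\<^sub>R) t ` K \<longleftrightarrow> inverse t *\<^sub>R x \<in> K"
  by (auto simp: image_iff intro!: bexI[of _ "inverse t *\<^sub>R x"])

lemma mem_scaled_K_mono:
  assumes "0 < s" "s \<le> t" "x \<in> (*\<^sub>R) s ` K" shows "x \<in> (*\<^sub>R) t ` K"
proof -
  have "(s / t) *\<^sub>R (inverse s *\<^sub>R x) + (1 - s / t) *\<^sub>R 0 \<in> K"
    using assms zero_in_K by (intro convexD[OF convex_K]) (auto simp: mem_scaled_K)
  then show ?thesis using assms by (simp add: mem_scaled_K field_simps)
qed

lemma ball_in_K: obtains r where "r > 0" "ball 0 r \<subseteq> K"
  using open_K zero_in_K open_contains_ball by blast

lemma gauge_set_nonempty: "{t. t > 0 \<and> x \<in> (*\<^sub>R) t ` K} \<noteq> {}"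
proof -
  obtain r where r: "r > 0" "ball 0 r \<subseteq> K" by (rule ball_in_K)
  let ?t = "(norm x + 1) / r"
  have "?t > 0" using r by (simp add: add_nonneg_pos)
  moreover have "norm (inverse ?t *\<^sub>R x) < r"
    using r by (simp add: divide_inverse[symmetric] pos_divide_less_eq add_nonneg_pos)
  then have "inverse ?t *\<^sub>R x \<in> K" using r by (auto simp: subset_iff)
  ultimately have "?t \<in> {t. t > 0 \<and> x \<in> (*\<^sub>R) t ` K}" by (simp add: mem_scaled_K)
  then show ?thesis by blast
qed

lemma gauge_set_bdd: "bdd_below {t. t > 0 \<and> x \<in> (*\<^sub>R) t ` K}"
  by (rule bdd_belowI[of _ 0]) auto

lemma N_nonneg [simp]: "0 \<le> N x"
  unfolding gauge_norm_def using gauge_set_nonempty by (intro cInf_greatest) auto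

text \<open>Since K is open, a point of hK can be pushed outwards by some factor s > 1 without
  leaving hK, so its gauge is at most h / s and the inequality is strict.\<close>

lemma N_less_iff:
  assumes "h > 0" shows "N x < h \<longleftrightarrow> x \<in> (*\<^sub>R) h ` K"
proof
  assume "N x < h"
  then obtain t where "t > 0" "x \<in> (*\<^sub>R) t ` K" "t < h"
    unfolding gauge_norm_def using gauge_set_bdd gauge_set_nonempty by (auto simp: cInf_less_iff)
  then show "x \<in> (*\<^sub>R) h ` K" using mem_scaled_K_mono by auto
next
  assume "x \<in> (*\<^sub>R) h ` K"
  then have xK: "inverse h *\<^sub>R x \<in> K" using assms by (simp add: mem_scaled_K)
  have "((\<lambda>s. s *\<^sub>R (inverse h *\<^sub>R x)) \<longlongrightarrow> 1 *\<^sub>R (inverse h *\<^sub>R x)) (at_right 1)"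
    by (intro tendsto_intros)
  then have "\<forall>\<^sub>F s in at_right 1. s *\<^sub>R (inverse h *\<^sub>R x) \<in> K"
    using topological_tendstoD[OF _ open_K] xK by fastforce
  moreover have "\<forall>\<^sub>F s in at_right (1::real). s > 1" by (simp add: eventually_at_filter)
  ultimately have "\<forall>\<^sub>F s in at_right 1. s > 1 \<and> s *\<^sub>R (inverse h *\<^sub>R x) \<in> K"
    by eventually_elim simp
  then obtain s where s: "s > 1" "s *\<^sub>R (inverse h *\<^sub>R x) \<in> K"
    using eventually_happens[of _ "at_right (1::real)"] by fastforce
  have "h / s > 0" using s assms by simp
  then have "h / s \<in> {t. t > 0 \<and> x \<in> (*\<^sub>R) t ` K}"
    using s assms by (auto simp: mem_scaled_K field_simps)
  then have "N x \<le> h / s" unfolding gauge_norm_def by (intro cInf_lower gauge_set_bdd)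
  also have "\<dots> < h" using s assms by (simp add: field_simps)
  finally show "N x < h" .
qed

lemma N_zero [simp]: "N 0 = 0"
proof -
  have "N 0 < h \<longleftrightarrow> 0 < h" if "0 < h" for h using that zero_in_K by (simp add: N_less_iff mem_scaled_K)
  then show ?thesis by (intro eq_if_same_strict_upper_bounds) auto
qed

lemma N_minus [simp]: "N (- x) = N x"
proof (rule eq_if_same_strict_upper_bounds)
  fix h :: real assume "0 < h"
  then show "N (- x) < h \<longleftrightarrow> N x < h"
    using symmetric_K[of "inverse h *\<^sub>R x"] symmetric_K[of "- (inverse h *\<^sub>R x)"]
    by (auto simp: N_less_iff mem_scaled_K)
qed auto

lemma N_scaleR_pos: "c > 0 \<Longrightarrow> N (c *\<^sub>R x) = c * N x"
proof (rule eq_if_same_strict_upper_bounds)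
  fix h :: real assume c: "c > 0" and "0 < h"
  have "N (c *\<^sub>R x) < h \<longleftrightarrow> N x < h / c"
    using c \<open>0 < h\<close> by (simp add: N_less_iff mem_scaled_K divide_inverse mult.commute)
  then show "N (c *\<^sub>R x) < h \<longleftrightarrow> c * N x < h" using c by (simp add: field_simps)
qed auto

lemma N_scaleR: "N (c *\<^sub>R x) = \<bar>c\<bar> * N x"
proof -
  consider "c > 0" | "c = 0" | "c < 0" by linarith
  then show ?thesis
  proof cases
    case 3
    have "N (c *\<^sub>R x) = N (- (c *\<^sub>R x))" by simp
    also have "- (c *\<^sub>R x) = (- c) *\<^sub>R x" by simp
    finally show ?thesis using 3 N_scaleR_pos[of "- c" x] by simp
  qed (auto simp: N_scaleR_pos)
qed

lemma N_triangle: "N (x + y) \<le> N x + N y"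
proof (rule field_le_epsilon)
  fix e :: real assume e: "0 < e"
  let ?a = "N x + e / 2" and ?b = "N y + e / 2"
  have a: "?a > 0" "?b > 0" using e by (simp_all add: add_nonneg_pos)
  have "N x < ?a" "N y < ?b" using e by auto
  then have xy: "inverse ?a *\<^sub>R x \<in> K" "inverse ?b *\<^sub>R y \<in> K" using a by (simp_all only: N_less_iff mem_scaled_K)
  have "inverse (a + b) *\<^sub>R (x + y) \<in> K"
    if ab: "a > 0" "b > 0" "inverse a *\<^sub>R x \<in> K" "inverse b *\<^sub>R y \<in> K" for a b :: real
  proof -
    have "(a / (a + b)) *\<^sub>R (inverse a *\<^sub>R x) + (b / (a + b)) *\<^sub>R (inverse b *\<^sub>R y) \<in> K"
      by (rule convexD[OF convex_K ab(3,4)]) (use ab in \<open>auto simp: add_divide_distrib[symmetric]\<close>)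
    moreover have "a / (a + b) * inverse a = inverse (a + b)" "b / (a + b) * inverse b = inverse (a + b)"
      using ab by (simp_all add: field_simps)
    ultimately show ?thesis by (simp only: scaleR_scaleR scaleR_add_right)
  qed
  from this[OF a xy] have "inverse (?a + ?b) *\<^sub>R (x + y) \<in> K" .
  then have "N (x + y) < ?a + ?b" using a by (simp only: N_less_iff mem_scaled_K add_pos_pos)
  then show "N (x + y) \<le> N x + N y + e" by simp
qed

lemma N_diff_abs: "\<bar>N x - N y\<bar> \<le> N (x - y)"
  using N_triangle[of "x - y" y] N_triangle[of "y - x" x] N_minus[of "x - y"] by simp

lemma N_equivalent:
  obtains c R where "c > 0" "R > 0" "\<And>x. N x \<le> c * norm x" "\<And>x. norm x \<le> R * N x"
proof -
  obtain r where r: "r > 0" "ball 0 r \<subseteq> K" by (rule ball_in_K)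
  obtain R where R: "R > 0" "\<And>x. x \<in> K \<Longrightarrow> norm x \<le> R"
    using bounded_K bounded_pos by blast
  have 1: "N x \<le> inverse r * norm x" for x
  proof (rule field_le_epsilon)
    fix e :: real assume e: "0 < e"
    let ?t = "inverse r * norm x + e"
    have t: "?t > 0" using e r by (simp add: add_nonneg_pos)
    have "norm (inverse ?t *\<^sub>R x) < r"
      using t r e by (simp add: field_simps abs_of_pos)
    then have "inverse ?t *\<^sub>R x \<in> K" using r by (auto simp: subset_iff)
    then show "N x \<le> ?t" using t by (intro less_imp_le) (simp only: N_less_iff mem_scaled_K)
  qed
  have 2: "norm x \<le> R * N x" for x
  proof (rule field_le_epsilon)
    fix e :: real assume e: "0 < e"
    let ?t = "N x + e / R"
    have t: "?t > 0" using e R by (simp add: add_nonneg_pos)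
    have "N x < ?t" using e R by simp
    then have "norm (inverse ?t *\<^sub>R x) \<le> R" using t R by (simp only: N_less_iff mem_scaled_K)
    moreover have "norm x \<le> R * t" if "t > 0" "norm (inverse t *\<^sub>R x) \<le> R" for t
      using that by (simp add: field_simps)
    ultimately have "norm x \<le> R * ?t" using t by blast
    then show "norm x \<le> R * N x + e" using R by (simp add: distrib_left)
  qed
  show ?thesis by (rule that[of "inverse r" R]) (use r R 1 2 in auto)
qed

lemma N_eq_0_iff [simp]: "N x = 0 \<longleftrightarrow> x = 0"
  using N_equivalent by (metis N_zero mult_zero_right norm_le_zero_iff)

lemma N_pos_iff [simp]: "0 < N x \<longleftrightarrow> x \<noteq> 0"
  using N_eq_0_iff[of x] N_nonneg[of x] by linarith

lemma continuous_N: "continuous_on S N"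
proof -
  obtain c R where c: "c > 0" "\<And>x. N x \<le> c * norm x" using N_equivalent by metis
  have "c-lipschitz_on S N"
  proof (rule lipschitz_onI)
    fix x y show "dist (N x) (N y) \<le> c * dist x y"
      using N_diff_abs[of x y] c(2)[of "x - y"] by (simp add: dist_norm)
  qed (use c in auto)
  then show ?thesis by (rule lipschitz_on_continuous_on)
qed

lemma N_measurable [measurable]: "N \<in> borel_measurable borel"
  by (intro borel_measurable_continuous_onI continuous_N)

lemma dual_set_bdd: "bdd_above {x \<bullet> z | x. N x \<le> 1}"
proof -
  obtain c R where R: "R > 0" "\<And>x. norm x \<le> R * N x" using N_equivalent by metis
  show ?thesis
  proof (rule bdd_aboveI[of _ "R * norm z"])
    fix t assume "t \<in> {x \<bullet> z | x. N x \<le> 1}"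
    then obtain x where x: "t = x \<bullet> z" "N x \<le> 1" by blast
    have "x \<bullet> z \<le> norm x * norm z" by (rule norm_cauchy_schwarz)
    also have "norm x \<le> R" using R x by (metis mult.right_neutral mult_left_mono less_imp_le order_trans)
    finally show "t \<le> R * norm z" using x by (simp add: mult_right_mono)
  qed
qed

lemma inner_le_dual: "N x \<le> 1 \<Longrightarrow> x \<bullet> z \<le> N' z"
  unfolding dual_norm_def by (intro cSup_upper dual_set_bdd) auto

lemma dual_le: "(\<And>x. N x \<le> 1 \<Longrightarrow> x \<bullet> z \<le> c) \<Longrightarrow> N' z \<le> c"
  unfolding dual_norm_def by (intro cSup_least) (auto intro!: exI[of _ 0])

lemma dual_nonneg [simp]: "0 \<le> N' z"
  using inner_le_dual[of 0 z] by simp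

lemma inner_le_dual_mult: "x \<bullet> z \<le> N' z * N x"
proof (cases "x = 0")
  case False
  then have "inverse (N x) *\<^sub>R x \<bullet> z \<le> N' z" by (intro inner_le_dual) (simp add: N_scaleR)
  then show ?thesis using False by (simp add: field_simps pos_divide_le_eq)
qed simp

lemma abs_inner_le_dual_mult: "\<bar>x \<bullet> z\<bar> \<le> N' z * N x"
  using inner_le_dual_mult[of x z] inner_le_dual_mult[of "- x" z] by simp

lemma dual_minus [simp]: "N' (- z) = N' z"
proof -
  have "N' (- z) \<le> N' z" for z
    using inner_le_dual[of "- x" z for x] by (intro dual_le) auto
  from this[of z] this[of "- z"] show ?thesis by simp
qed

lemma dual_triangle: "N' (z + w) \<le> N' z + N' w"
  by (rule dual_le) (auto simp: inner_add_right intro!: add_mono inner_le_dual)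

lemma dual_scaleR: "c \<ge> 0 \<Longrightarrow> N' (c *\<^sub>R z) = c * N' z"
proof (cases "c = 0")
  case True
  have "N' 0 \<le> 0" by (rule dual_le) simp
  then show ?thesis using True dual_nonneg[of 0] by (simp add: antisym)
next
  case False
  assume "c \<ge> 0"
  with False have c: "c > 0" by simp
  have le: "N' (c *\<^sub>R z) \<le> c * N' z" if "c > 0" for c z
    using that by (intro dual_le) (auto intro!: mult_left_mono inner_le_dual)
  show ?thesis
    using le[OF c, of z] le[of "inverse c" "c *\<^sub>R z"] c by (simp add: field_simps)
qed

lemma dual_bound: obtains R where "R > 0" "\<And>z. N' z \<le> R * norm z"
proof -
  obtain c R where R: "R > 0" "\<And>x. norm x \<le> R * N x" using N_equivalent by metis
  have "N' z \<le> R * norm z" for z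
  proof (rule dual_le)
    fix x assume x: "N x \<le> 1"
    have "x \<bullet> z \<le> norm x * norm z" by (rule norm_cauchy_schwarz)
    also have "norm x \<le> R" using R x by (metis mult.right_neutral mult_left_mono less_imp_le order_trans)
    finally show "x \<bullet> z \<le> R * norm z" by (simp add: mult_right_mono)
  qed
  then show ?thesis using that R by blast
qed

lemma continuous_dual: "continuous_on S N'"
proof -
  obtain R where R: "R > 0" "\<And>z. N' z \<le> R * norm z" using dual_bound by metis
  have "R-lipschitz_on S N'"
  proof (rule lipschitz_onI)
    fix x y show "dist (N' x) (N' y) \<le> R * dist x y"
      using dual_triangle[of "x - y" y] dual_triangle[of "y - x" x] dual_minus[of "x - y"] R(2)[of "x - y"]
      by (simp add: dist_norm)
  qed (use R in auto)
  then show ?thesis by (rule lipschitz_on_continuous_on)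
qed

lemma dual_measurable [measurable]: "N' \<in> borel_measurable borel"
  by (intro borel_measurable_continuous_onI continuous_dual)

text \<open>The hypotheses say that z is a functional bounded by the gauge and attaining it at some
  y. For z the gradient of the gauge at y, the point y itself attains it, by homogeneity.\<close>

lemma dual_eq_1:
  assumes "\<And>x. x \<bullet> z \<le> N x" "y \<bullet> z = N y" "y \<noteq> 0"
  shows "N' z = 1"
proof (rule antisym)
  show "N' z \<le> 1" using assms(1) by (intro dual_le) (use order_trans in blast)
  show "1 \<le> N' z"
    using inner_le_dual[of "inverse (N y) *\<^sub>R y" z] assms by (simp add: N_scaleR)
qed

end

section \<open>Sections of the cone: volume and radial integration\<close>

locale cone_body = convex_body K for K :: "'a::euclidean_space set" +
  fixes C :: "'a set"
  assumes open_C: "open C" and convex_C: "convex C" and cone_C: "positive_cone C"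
begin

definition "m = measure lebesgue (K \<inter> C)"

abbreviation "E h \<equiv> (*\<^sub>R) h ` K \<inter> C"

lemma C_scaleR: "x \<in> C \<Longrightarrow> t > 0 \<Longrightarrow> t *\<^sub>R x \<in> C"
  using cone_C by (auto simp: positive_cone_def)

lemma C_scaleR_iff: "t > 0 \<Longrightarrow> t *\<^sub>R x \<in> C \<longleftrightarrow> x \<in> C"
  using C_scaleR[of x t] C_scaleR[of "t *\<^sub>R x" "inverse t"] by auto

lemma C_add: assumes "x \<in> C" "y \<in> C" shows "x + y \<in> C"
proof -
  have "(1 / 2) *\<^sub>R x + (1 / 2) *\<^sub>R y \<in> C" using assms by (intro convexD[OF convex_C]) auto
  then show ?thesis using C_scaleR[of "(1 / 2) *\<^sub>R x + (1 / 2) *\<^sub>R y" 2] by (simp add: scaleR_add_right)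
qed

lemma C_sets [measurable]: "C \<in> sets borel" using open_C by auto

lemma E_eq: "h > 0 \<Longrightarrow> E h = {z \<in> C. N z < h}"
  using N_less_iff by blast

lemma E_eq_image: "h > 0 \<Longrightarrow> E h = (*\<^sub>R) h ` (K \<inter> C)"
  using C_scaleR_iff[of h] by (auto simp: image_iff)

lemma open_E: "h > 0 \<Longrightarrow> open (E h)"
  using open_K open_C by (intro open_Int open_scaling) auto

lemma E_sets [measurable]: "h > 0 \<Longrightarrow> E h \<in> sets borel"
  using open_E by auto

lemma E_nonempty: assumes "h > 0" shows "E h \<noteq> {}"
proof -
  obtain e where e: "e \<in> C" using cone_C by (auto simp: positive_cone_def)
  define t where "t = h / (1 + N e)"
  have "1 + N e > 0" by (simp add: add_pos_nonneg)
  then have t: "t > 0" "t * (1 + N e) = h" using assms by (simp_all add: t_def)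
  then have "t * N e < h" by (simp add: distrib_left)
  then have "t *\<^sub>R e \<in> {z \<in> C. N z < h}" using t e by (auto simp: N_scaleR intro!: C_scaleR)
  then show ?thesis using E_eq[OF assms] by auto
qed

lemma lmeasurable_KC: "K \<inter> C \<in> lmeasurable"
  using bounded_K open_K open_C by (intro lmeasurable_open open_Int bounded_Int) auto

lemma m_pos: "m > 0"
proof -
  have "K \<inter> C \<noteq> {}" using E_nonempty[of 1] by simp
  then have "\<not> negligible (K \<inter> C)" using open_K open_C open_not_negligible by blast
  then show ?thesis
    unfolding m_def using lmeasurable_KC negligible_iff_measure0 zero_less_measure_iff by metis
qed

lemma emeasure_E:
  assumes "h > 0" shows "emeasure lborel (E h) = ennreal (m * h ^ DIM('a))"
proof -
  have "emeasure lborel (E h) = emeasure lebesgue (E h)" using E_sets[OF assms] by simp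
  also have "\<dots> = emeasure lebesgue ((\<lambda>x. h *\<^sub>R x + 0) ` (K \<inter> C))" by (simp add: E_eq_image[OF assms])
  also have "\<dots> = ennreal (h ^ DIM('a)) * emeasure lebesgue (K \<inter> C)"
    using emeasure_lebesgue_affine[of h 0 "K \<inter> C"] assms by (simp add: ennreal_power)
  also have "emeasure lebesgue (K \<inter> C) = ennreal m"
    unfolding m_def by (rule emeasure_eq_measure2) (rule lmeasurable_KC)
  finally show ?thesis using assms m_pos by (simp add: ennreal_mult mult.commute)
qed

text \<open>The set lies between \<open>E x\<close> and the slightly larger open sections, whose
  volumes tend to that of \<open>E x\<close>. Consequently the gauge spheres have no volume.\<close>

lemma emeasure_closed_sublevel:
  assumes "x \<ge> 0" shows "emeasure lborel {z \<in> C. N z \<le> x} = ennreal (m * x ^ DIM('a))"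
proof (rule antisym)
  have "emeasure lborel {z \<in> C. N z \<le> x} \<le> ennreal (m * (x + inverse (Suc n)) ^ DIM('a))" for n
  proof -
    have pos: "x + inverse (Suc n) > 0" using assms by (simp add: add_nonneg_pos)
    have "emeasure lborel {z \<in> C. N z \<le> x} \<le> emeasure lborel (E (x + inverse (Suc n)))"
      unfolding E_eq[OF pos] by (intro emeasure_mono) (auto intro: le_less_trans)
    then show ?thesis using emeasure_E[OF pos] by simp
  qed
  moreover have "(\<lambda>n. ennreal (m * (x + inverse (Suc n)) ^ DIM('a))) \<longlonglongrightarrow> ennreal (m * (x + 0) ^ DIM('a))"
    by (intro tendsto_intros tendsto_ennrealI LIMSEQ_inverse_real_of_nat)
  ultimately show "emeasure lborel {z \<in> C. N z \<le> x} \<le> ennreal (m * x ^ DIM('a))"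
    by (intro LIMSEQ_le_const[of "\<lambda>n. ennreal (m * (x + inverse (Suc n)) ^ DIM('a))"]) auto
  show "ennreal (m * x ^ DIM('a)) \<le> emeasure lborel {z \<in> C. N z \<le> x}"
  proof (cases "x = 0")
    case False
    then have x: "x > 0" using assms by simp
    have "emeasure lborel (E x) \<le> emeasure lborel {z \<in> C. N z \<le> x}"
      unfolding E_eq[OF x] by (intro emeasure_mono) auto
    then show ?thesis using emeasure_E[OF x] by simp
  qed (simp add: zero_power[OF DIM_positive])
qed

text \<open>Polar coordinates without spheres: the image under the gauge of Lebesgue measure on
  \<open>E h\<close> and the measure with density d m u^(d-1) on [0, h] agree on all half-lines,
  because both are computed from the volumes m x^d. Measures on the line are determined by these
  values.\<close>

lemma nn_integral_radial:
  assumes h: "h > 0" and [measurable]: "\<psi> \<in> borel_measurable borel"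
  shows "(\<integral>\<^sup>+z. \<psi> (N z) * indicator (E h) z \<partial>lborel)
       = (\<integral>\<^sup>+u. \<psi> u * (ennreal (DIM('a) * m * u ^ (DIM('a) - 1)) * indicator {0..h} u) \<partial>lborel)"
proof -
  note [measurable] = E_sets[OF h]
  have [measurable]: "N -` {x<..} \<in> sets borel" for x
    by (rule measurable_sets_borel[OF N_measurable]) simp
  let ?P = "distr (density lborel (indicator (E h))) borel N"
  let ?Q = "density lborel (\<lambda>u. ennreal (DIM('a) * m * u ^ (DIM('a) - 1)) * indicator {0..h} u)"
  have P: "emeasure ?P {x<..} = ennreal (m * (h ^ DIM('a) - min h (max 0 x) ^ DIM('a)))" for x
  proof -
    have "emeasure ?P {x<..} = emeasure (density lborel (indicator (E h))) (N -` {x<..})"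
      by (subst emeasure_distr) auto
    also have "\<dots> = emeasure lborel (E h \<inter> N -` {x<..})"
      by (intro emeasure_restricted) auto
    also have "\<dots> = ennreal (m * (h ^ DIM('a) - min h (max 0 x) ^ DIM('a)))"
    proof (cases "x < 0")
      case True
      then have "E h \<inter> N -` {x<..} = E h" using N_nonneg order_less_le_trans by fastforce
      then show ?thesis using True h emeasure_E[OF h] by (simp add: max_def zero_power[OF DIM_positive])
    next
      case False
      show ?thesis
      proof (cases "x < h")
        case True
        have "E h \<inter> N -` {x<..} = E h - {z \<in> C. N z \<le> x}"
          unfolding E_eq[OF h] by auto
        moreover have "emeasure lborel (E h - {z \<in> C. N z \<le> x})
            = emeasure lborel (E h) - emeasure lborel {z \<in> C. N z \<le> x}"
          using True False emeasure_closed_sublevel[of x] unfolding E_eq[OF h]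
          by (intro emeasure_Diff) auto
        ultimately show ?thesis
          using True False m_pos emeasure_closed_sublevel[of x] emeasure_E[OF h] h
          by (simp add: max_def min_def ennreal_minus right_diff_distrib)
      next
        case False
        then have "E h \<inter> N -` {x<..} = {}" unfolding E_eq[OF h] by auto
        then show ?thesis using False \<open>\<not> x < 0\<close> h by (simp add: max_def min_def)
      qed
    qed
    finally show ?thesis .
  qed
  have Q: "emeasure ?Q {x<..} = ennreal (m * (h ^ DIM('a) - min h (max 0 x) ^ DIM('a)))" for x
  proof -
    let ?y = "min h (max 0 x)"
    have "emeasure ?Q {x<..} = (\<integral>\<^sup>+u. ennreal (DIM('a) * m * u ^ (DIM('a) - 1)) * indicator {0..h} u * indicator {x<..} u \<partial>lborel)"
      by (subst emeasure_density) auto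
    also have "\<dots> = (\<integral>\<^sup>+u. ennreal (DIM('a) * m * u ^ (DIM('a) - 1)) * indicator {?y..h} u \<partial>lborel)"
    proof (rule nn_integral_cong_AE)
      have "AE u in lborel. u \<noteq> x" "AE u in lborel. u \<noteq> h" by (rule AE_lborel_singleton)+
      then show "AE u in lborel. ennreal (DIM('a) * m * u ^ (DIM('a) - 1)) * indicator {0..h} u * indicator {x<..} u
          = ennreal (DIM('a) * m * u ^ (DIM('a) - 1)) * indicator {?y..h} u"
        by eventually_elim (auto simp: indicator_def min_def max_def split: if_splits)
    qed
    also have "\<dots> = ennreal (m * h ^ DIM('a) - m * ?y ^ DIM('a))"
    proof (rule nn_integral_FTC_Icc[where F="\<lambda>u. m * u ^ DIM('a)"])
      show "((\<lambda>u. m * u ^ DIM('a)) has_real_derivative DIM('a) * m * u ^ (DIM('a) - 1)) (at u)" for u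
        by (auto intro!: derivative_eq_intros)
    qed (use h m_pos in \<open>auto simp: min_def max_def split: if_splits\<close>)
    finally show ?thesis by (simp add: right_diff_distrib)
  qed
  have eq: "?P = ?Q"
  proof (rule measure_eqI_lessThan)
    show "emeasure ?P {x<..} = emeasure ?Q {x<..}" for x by (simp only: P Q)
    show "emeasure ?P {x<..} < \<infinity>" for x by (simp only: P) simp
  qed simp_all
  have "(\<integral>\<^sup>+z. \<psi> (N z) * indicator (E h) z \<partial>lborel) = (\<integral>\<^sup>+u. \<psi> u \<partial>?P)"
    by (subst nn_integral_distr) (auto simp: nn_integral_density mult.commute)
  also have "\<dots> = (\<integral>\<^sup>+u. \<psi> u \<partial>?Q)" by (simp only: eq)
  also have "\<dots> = (\<integral>\<^sup>+u. \<psi> u * (ennreal (DIM('a) * m * u ^ (DIM('a) - 1)) * indicator {0..h} u) \<partial>lborel)"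
    by (subst nn_integral_density) (auto simp: mult.commute)
  finally show ?thesis .
qed

end

subsection \<open>The constants\<close>

text \<open>Keeps the frequent exponent \<open>DIM('a) - 1\<close> from being rewritten with
  \<open>Suc 0\<close>.\<close>

declare One_nat_def [simp del]

text \<open>The substitution t = (u / h)^n in the Beta integral; n will be the dimension.\<close>

lemma nn_integral_Beta_power:
  assumes "a > 0" "b > 0" "h > 0" "n \<ge> 1"
  shows "(\<integral>\<^sup>+u. ennreal (((u / h) ^ n) powr (a - 1) * (1 - (u / h) ^ n) powr (b - 1) *
      (real n * u ^ (n - 1) / h ^ n)) * indicator {0..h} u \<partial>lborel) = ennreal (Beta a b)"
proof -
  let ?f = "\<lambda>t::real. t powr (a - 1) * (1 - t) powr (b - 1)"
  let ?g = "\<lambda>u. (u / h) ^ n"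
  have "(\<integral>\<^sup>+x. ennreal (?f x * indicator {?g 0..?g h} x) \<partial>lborel) =
     (\<integral>\<^sup>+x. ennreal (?f (?g x) * (real n * x ^ (n - 1) / h ^ n) * indicator {0..h} x) \<partial>lborel)"
  proof (rule nn_integral_substitution[where f="?f" and g="?g" and a=0 and b=h and g'="\<lambda>x. real n * x ^ (n - 1) / h ^ n"])
    show "set_borel_measurable borel {?g 0..?g h} ?f" unfolding set_borel_measurable_def by measurable
    show "(?g has_real_derivative real n * x ^ (n - 1) / h ^ n) (at x)" for x
      using DERIV_cdivide[OF DERIV_pow[of n x UNIV], of "h ^ n"] by (simp add: power_divide One_nat_def)
    show "continuous_on {0..h} (\<lambda>x. real n * x ^ (n - 1) / h ^ n)"
      using assms by (auto intro!: continuous_intros)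
  qed (use assms in auto)
  then have "(\<integral>\<^sup>+x. ennreal (?f x) * indicator {?g 0..?g h} x \<partial>lborel) =
     (\<integral>\<^sup>+x. ennreal (?f (?g x) * (real n * x ^ (n - 1) / h ^ n)) * indicator {0..h} x \<partial>lborel)"
    by (simp only: nn_integral_set_ennreal)
  moreover have unit: "{?g 0..?g h} = {0..1}" using assms by (simp add: zero_power)
  moreover have "(\<integral>\<^sup>+x. ennreal (?f x) * indicator {0..1} x \<partial>lborel) = ennreal (Beta a b)"
    by (rule nn_integral_has_integral_lebesgue') (auto intro: has_integral_Beta_real assms)
  ultimately show ?thesis by (simp only: unit)
qed

lemma Beta_pos: "a > 0 \<Longrightarrow> b > 0 \<Longrightarrow> Beta a b > (0::real)"
  by (simp add: Beta_def)

text \<open>Relates the two Beta integrals that occur, one for the gradient norm and one for the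
  charge of the extremal function. With a = \<open>beta_arg\<close> and b = \<open>q\<close> the
  quotient a / b is 1/d - 1/p.\<close>

lemma Beta_shift:
  assumes "a > 0" "b > (0::real)" shows "Beta (a + 1) b = a / b * Beta a (b + 1)"
proof -
  have "a \<notin> \<int>\<^sub>\<le>\<^sub>0" "b \<notin> \<int>\<^sub>\<le>\<^sub>0" using assms by (auto dest!: nonpos_Ints_nonpos)
  from Beta_plus1_left[OF this(1), of b] Beta_plus1_right[OF this(2), of a]
  have "(a + b) * (b * Beta (a + 1) b) = (a + b) * (a * Beta a (b + 1))"
    by (metis mult.left_commute)
  then have "b * Beta (a + 1) b = a * Beta a (b + 1)" using assms by simp
  then show ?thesis using assms by (simp add: field_simps)
qed

section \<open>Exponents and integrals of powers of the kernel\<close>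

locale extremal_problem = cone_body K C for K C :: "'a::euclidean_space set" +
  fixes p :: ennreal
  assumes dim_less_p: "of_nat DIM('a) < p"
begin

definition "q = conj_exp p"
definition "r = recip p"

text \<open>The infinite exponent is carried along as r = 0, so that most of the later computations
  are uniform in r and q and need no case distinction.\<close>

lemma p_cases:
  obtains "p = \<infinity>" "q = 1" "r = 0"
  | P where "p \<noteq> \<infinity>" "enn2real p = P" "P > DIM('a)" "P > 1" "q = P / (P - 1)" "r = 1 / P"
proof (cases p)
  case (real P)
  have "ennreal (real DIM('a)) < ennreal P" using dim_less_p real by (simp add: ennreal_of_nat_eq_real_of_nat)
  then have P: "P > DIM('a)" by (simp add: ennreal_less_iff)
  moreover have "real DIM('a) \<ge> 1" using DIM_positive[where 'a='a] by linarith
  moreover have p: "p \<noteq> \<infinity>" "enn2real p = P" using real by auto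
  moreover have "q = P / (P - 1)" using p by (simp add: q_def conj_exp_def)
  moreover have "r = 1 / P"
    unfolding r_def using real P by (simp add: inverse_ennreal inverse_eq_divide)
  ultimately show ?thesis using that(2)[of P] by linarith
next
  case top
  then have "p = \<infinity>" "q = 1" "r = 0" 
    unfolding q_def r_def conj_exp_def by simp_all
  then show ?thesis by (rule that(1))
qed

lemma exponents: "r < 1 / DIM('a) \<and> 1 \<le> q \<and> 1 / q = 1 - r"
proof (cases rule: p_cases)
  case 1
  show ?thesis unfolding 1(2,3) by simp
next
  case (2 P)
  show ?thesis unfolding 2(5,6) using 2(3,4) by (simp add: field_simps)
qed

lemma r_less: "r < 1 / DIM('a)"
  and q_ge_1: "q \<ge> 1" and inverse_q: "1 / q = 1 - r"
  using exponents by auto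

lemma real_DIM_pred: "real (DIM('a) - 1) = real DIM('a) - 1"
  using DIM_positive[where 'a='a] by (metis One_nat_def Suc_leI of_nat_1 of_nat_diff)

lemma DIM_ge_1: "real DIM('a) \<ge> 1"
  using DIM_positive[where 'a='a] by linarith

text \<open>The first Beta argument of \<open>A_const\<close>. It is such that ((u/h)^d)^(beta_arg -
  1) contains the power u^(-(d-1)q) of the q-th power of the kernel.\<close>

definition "beta_arg = 1 - (real DIM('a) - 1) * q / DIM('a)"

lemma beta_arg_over_q: "beta_arg / q = 1 / DIM('a) - r"
proof -
  have "beta_arg / q = 1 / q - (real DIM('a) - 1) / DIM('a)"
    using q_ge_1 by (simp add: beta_arg_def diff_divide_distrib)
  then show ?thesis using DIM_ge_1 by (simp add: inverse_q field_simps)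
qed

text \<open>Here p > d enters, as r < 1/d: near the vertex the radial integrand of the q-th power of
  the kernel behaves like u^(d-1-(d-1)q), which is integrable exactly when \<open>beta_arg\<close>
  is positive.\<close>

lemma beta_arg_pos: "beta_arg > 0"
proof -
  have "beta_arg / q > 0" using r_less by (simp add: beta_arg_over_q)
  then show ?thesis using q_ge_1 by (simp add: zero_less_divide_iff)
qed

abbreviation "g h \<equiv> g_kernel C K h"

text \<open>Separates the singularity at the vertex from a factor that is of Beta type in the
  variable (u/h)^d.\<close>

lemma g_eq:
  assumes "0 < u" "u < h"
  shows "g h u = 1 / (real DIM('a) * m) * (1 / u ^ (DIM('a) - 1)) * (1 - (u / h) ^ DIM('a))"
proof -
  have "u ^ DIM('a) = u * u ^ (DIM('a) - 1)" using DIM_positive[where 'a='a] by (simp flip: power_Suc)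
  then show ?thesis using assms by (simp add: g_kernel_def m_def power_divide field_simps)
qed

lemma ratio_power_less_1:
  fixes u h :: real
  shows "0 < u \<Longrightarrow> u < h \<Longrightarrow> 0 < (u / h) ^ DIM('a) \<and> (u / h) ^ DIM('a) < 1"
  using power_strict_mono[of "u / h" 1 "DIM('a)"] by simp

lemma g_pos: "0 < u \<Longrightarrow> u < h \<Longrightarrow> g h u > 0"
  using g_eq ratio_power_less_1[of u h] m_pos DIM_ge_1 by simp

lemma g_measurable [measurable]: "g h \<in> borel_measurable borel"
  unfolding g_kernel_def by measurable

lemma power_pred_powr: "0 < u \<Longrightarrow> (u ^ (DIM('a) - 1)) powr e = u powr ((real DIM('a) - 1) * e)"
  using DIM_positive[where 'a='a] by (simp add: powr_powr powr_realpow[symmetric] real_DIM_pred)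

lemma g_powr:
  assumes "0 < u" "u < h"
  shows "g h u powr e = (real DIM('a) * m) powr (- e) * u powr (- (real DIM('a) - 1) * e) *
    (1 - (u / h) ^ DIM('a)) powr e"
proof -
  have "g h u powr e = (1 / (real DIM('a) * m)) powr e * (1 / u ^ (DIM('a) - 1)) powr e * (1 - (u / h) ^ DIM('a)) powr e"
  proof -
    have "0 \<le> 1 / (real DIM('a) * m)" "0 \<le> 1 / u ^ (DIM('a) - 1)" "0 \<le> 1 - (u / h) ^ DIM('a)"
      using ratio_power_less_1[OF assms] m_pos assms by simp_all
    then show ?thesis unfolding g_eq[OF assms] by (simp only: powr_mult mult_nonneg_nonneg)
  qed
  also have "(1 / (real DIM('a) * m)) powr e = (real DIM('a) * m) powr (- e)"
    using m_pos by (simp add: powr_divide powr_minus_divide)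
  also have "(1 / u ^ (DIM('a) - 1)) powr e = u powr (- (real DIM('a) - 1) * e)"
    unfolding minus_mult_left[symmetric] powr_minus_divide
    using assms power_pred_powr[of u e] by (simp add: powr_divide)
  finally show ?thesis .
qed

text \<open>\<open>I h\<close> will be the integral of the q-th power of the kernel over
  \<open>E h\<close>, as needed for Hoelder's inequality. \<open>c_I h\<close> is the factor left
  over when the Beta integrand in (u/h)^d is split off.\<close>

definition "c_I h = (real DIM('a) * m) powr (1 - q) * h powr (DIM('a) - (real DIM('a) - 1) * q) / DIM('a)"
definition "I h = c_I h * Beta beta_arg (q + 1)"

lemma c_I_pos: "h > 0 \<Longrightarrow> c_I h > 0"
  using m_pos DIM_ge_1 by (simp add: c_I_def)

lemma I_pos: "h > 0 \<Longrightarrow> I h > 0"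
  using c_I_pos Beta_pos[of beta_arg "q + 1"] beta_arg_pos q_ge_1 by (simp add: I_def)

lemma ratio_powr:
  fixes u h :: real
  assumes "0 < u" "0 < h"
  shows "((u / h) ^ DIM('a)) powr (beta_arg - 1) =
    u powr (- (real DIM('a) - 1) * q) * h powr ((real DIM('a) - 1) * q)"
proof -
  have "((u / h) ^ DIM('a)) powr (beta_arg - 1) = (u / h) powr (DIM('a) * (beta_arg - 1))"
    using assms by (simp add: powr_powr powr_realpow[symmetric])
  also have "DIM('a) * (beta_arg - 1) = - ((real DIM('a) - 1) * q)"
    using DIM_ge_1 by (simp add: beta_arg_def)
  also have "(u / h) powr (- ((real DIM('a) - 1) * q)) =
      u powr (- (real DIM('a) - 1) * q) * h powr ((real DIM('a) - 1) * q)"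
    using assms by (simp only: powr_divide powr_minus_divide minus_mult_left[symmetric]) (simp add: powr_minus_divide)
  finally show ?thesis .
qed

lemma c_I_alt:
  assumes "h > 0"
  shows "c_I h = (real DIM('a) * m) * (real DIM('a) * m) powr (- q) * h ^ DIM('a) / h powr ((real DIM('a) - 1) * q) / DIM('a)"
  using assms m_pos by (simp add: c_I_def powr_diff powr_minus_divide powr_realpow)

lemma integrand_I:
  fixes u h :: real
  assumes "0 < u" "u < h"
  shows "g h u powr q * (real DIM('a) * m * u ^ (DIM('a) - 1)) =
    c_I h * (((u / h) ^ DIM('a)) powr (beta_arg - 1) * (1 - (u / h) ^ DIM('a)) powr (q + 1 - 1) *
      (real DIM('a) * u ^ (DIM('a) - 1) / h ^ DIM('a)))"
proof -
  have h: "h > 0" using assms by simp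
  have "h powr ((real DIM('a) - 1) * q) > 0" using h by simp
  then show ?thesis
    unfolding g_powr[OF assms] c_I_alt[OF h] ratio_powr[OF assms(1) h]
    using h DIM_ge_1 by (simp add: field_simps)
qed

text \<open>Compared with \<open>integrand_I\<close>, the factor (u/h)^d raises the first Beta
  argument by one, and the missing power of the kernel lowers the second by one. That missing power
  also releases a factor u^(d-1), which supplies the derivative of the substitution.\<close>

lemma integrand_Y:
  fixes u h :: real
  assumes "0 < u" "u < h"
  shows "g h u powr (q - 1) * (u / h) ^ DIM('a) =
    c_I h * (((u / h) ^ DIM('a)) powr (beta_arg + 1 - 1) * (1 - (u / h) ^ DIM('a)) powr (q - 1) *
      (real DIM('a) * u ^ (DIM('a) - 1) / h ^ DIM('a)))"
proof -
  have h: "h > 0" using assms by simp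
  have H: "h powr ((real DIM('a) - 1) * q) > 0" using h by simp
  have s: "(u / h) ^ DIM('a) > 0" using ratio_power_less_1[OF assms] by simp
  have 1: "((u / h) ^ DIM('a)) powr (beta_arg + 1 - 1) = ((u / h) ^ DIM('a)) powr (beta_arg - 1) * (u / h) ^ DIM('a)"
    using s powr_add[of "(u / h) ^ DIM('a)" "beta_arg - 1" 1] by simp
  have 2: "u powr (- (real DIM('a) - 1) * (q - 1)) = u powr (- (real DIM('a) - 1) * q) * u ^ (DIM('a) - 1)"
  proof -
    have "- (real DIM('a) - 1) * (q - 1) = - (real DIM('a) - 1) * q + real (DIM('a) - 1)"
      by (simp add: real_DIM_pred algebra_simps)
    then show ?thesis using assms by (simp only: powr_add powr_realpow)
  qed
  have 3: "(real DIM('a) * m) powr (- (q - 1)) = (real DIM('a) * m) * (real DIM('a) * m) powr (- q)"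
    using m_pos powr_add[of "real DIM('a) * m" 1 "- q"] by simp
  show ?thesis
    unfolding g_powr[OF assms] c_I_alt[OF h] 1 2 3 ratio_powr[OF assms(1) h]
    using h H DIM_ge_1 by (simp add: field_simps)
qed

lemma nn_integral_Beta_kernel:
  fixes k :: "real \<Rightarrow> real"
  assumes h: "h > 0" and "a > 0" "b > 0"
    and k: "\<And>u. 0 < u \<Longrightarrow> u < h \<Longrightarrow> k u = c_I h * (((u / h) ^ DIM('a)) powr (a - 1) *
      (1 - (u / h) ^ DIM('a)) powr (b - 1) * (real DIM('a) * u ^ (DIM('a) - 1) / h ^ DIM('a)))"
  shows "(\<integral>\<^sup>+u. ennreal (k u) * indicator {0<..<h} u \<partial>lborel) = ennreal (c_I h * Beta a b)"
proof -
  let ?B = "\<lambda>u::real. ((u / h) ^ DIM('a)) powr (a - 1) * (1 - (u / h) ^ DIM('a)) powr (b - 1) *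
      (real DIM('a) * u ^ (DIM('a) - 1) / h ^ DIM('a))"
  note mult = ennreal_mult'[OF less_imp_le[OF c_I_pos[OF h]]]
  have "(\<integral>\<^sup>+u. ennreal (k u) * indicator {0<..<h} u \<partial>lborel)
      = (\<integral>\<^sup>+u. ennreal (c_I h) * (ennreal (?B u) * indicator {0..h} u) \<partial>lborel)"
  proof (rule nn_integral_cong_AE)
    have "AE u in lborel. u \<noteq> 0" "AE u in lborel. u \<noteq> h" by (rule AE_lborel_singleton)+
    then show "AE u in lborel. ennreal (k u) * indicator {0<..<h} u
        = ennreal (c_I h) * (ennreal (?B u) * indicator {0..h} u)"
    proof eventually_elim
      case (elim u)
      show ?case
      proof (cases "0 < u \<and> u < h")
        case True
        then show ?thesis by (simp only: k mult) simp
      next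
        case False
        then show ?thesis using elim by (auto simp: indicator_def)
      qed
    qed
  qed
  also have "\<dots> = ennreal (c_I h) * ennreal (Beta a b)"
    using nn_integral_Beta_power[of a b h "DIM('a)"] assms DIM_positive[where 'a='a]
    by (subst nn_integral_cmult) (auto simp: Suc_le_eq)
  finally show ?thesis by (simp only: mult)
qed

lemma nn_integral_I:
  assumes h: "h > 0"
  shows "(\<integral>\<^sup>+u. ennreal (g h u powr q * (real DIM('a) * m * u ^ (DIM('a) - 1))) * indicator {0<..<h} u \<partial>lborel)
    = ennreal (I h)"
  unfolding I_def
  by (rule nn_integral_Beta_kernel[OF h beta_arg_pos _ integrand_I]) (use q_ge_1 in simp)

text \<open>By integration over level sets this number is the mean of the extremal function over
  \<open>E h\<close>.\<close>

lemma nn_integral_Y: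
  assumes h: "h > 0"
  shows "(\<integral>\<^sup>+u. ennreal (g h u powr (q - 1) * (u / h) ^ DIM('a)) * indicator {0<..<h} u \<partial>lborel)
    = ennreal ((1 / DIM('a) - r) * I h)"
proof -
  have "(1 / DIM('a) - r) * I h = c_I h * Beta (beta_arg + 1) q"
    using Beta_shift[of beta_arg q] beta_arg_pos q_ge_1 by (simp add: I_def flip: beta_arg_over_q)
  then show ?thesis
    by (simp only:) (rule nn_integral_Beta_kernel[OF h _ _ integrand_Y], use beta_arg_pos q_ge_1 in simp_all)
qed

text \<open>The number is the value of the extremal function at the vertex. Since the kernel times d
  m u^(d-1) equals 1 - (u/h)^d, the integrand splits into those of \<open>nn_integral_I\<close> and
  \<open>nn_integral_Y\<close>; these are the gradient term and the charge term of the additive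
  equality.\<close>

lemma nn_integral_X:
  assumes h: "h > 0"
  shows "(\<integral>\<^sup>+u. ennreal (g h u powr (q - 1)) * indicator {0<..<h} u \<partial>lborel)
    = ennreal ((1 + 1 / DIM('a) - r) * I h)"
proof -
  have eq: "g h u powr (q - 1) = g h u powr q * (real DIM('a) * m * u ^ (DIM('a) - 1)) + g h u powr (q - 1) * (u / h) ^ DIM('a)"
    if "0 < u" "u < h" for u
  proof -
    have "g h u powr q = g h u powr (q - 1) * g h u"
      using g_pos[OF that] powr_add[of "g h u" "q - 1" 1] by simp
    moreover have "g h u * (real DIM('a) * m * u ^ (DIM('a) - 1)) = 1 - (u / h) ^ DIM('a)"
      using m_pos DIM_ge_1 that by (simp add: g_eq[OF that])
    ultimately have "g h u powr q * (real DIM('a) * m * u ^ (DIM('a) - 1)) = g h u powr (q - 1) * (1 - (u / h) ^ DIM('a))"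
      by (simp add: mult.assoc)
    then show ?thesis by (simp add: algebra_simps)
  qed
  have "(\<integral>\<^sup>+u. ennreal (g h u powr (q - 1)) * indicator {0<..<h} u \<partial>lborel)
     = (\<integral>\<^sup>+u. ennreal (g h u powr q * (real DIM('a) * m * u ^ (DIM('a) - 1))) * indicator {0<..<h} u
          + ennreal (g h u powr (q - 1) * (u / h) ^ DIM('a)) * indicator {0<..<h} u \<partial>lborel)"
  proof (rule nn_integral_cong)
    fix u
    show "ennreal (g h u powr (q - 1)) * indicator {0<..<h} u
      = ennreal (g h u powr q * (real DIM('a) * m * u ^ (DIM('a) - 1))) * indicator {0<..<h} u
          + ennreal (g h u powr (q - 1) * (u / h) ^ DIM('a)) * indicator {0<..<h} u"
    proof (cases "0 < u \<and> u < h")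
      case True
      then show ?thesis using eq[of u] m_pos by (simp add: ennreal_plus[symmetric] del: ennreal_plus)
    qed (auto simp: indicator_def)
  qed
  also have "\<dots> = ennreal (I h) + ennreal ((1 / DIM('a) - r) * I h)"
    by (subst nn_integral_add) (auto simp: nn_integral_I[OF h] nn_integral_Y[OF h])
  also have "\<dots> = ennreal ((1 + 1 / DIM('a) - r) * I h)"
  proof -
    have "0 \<le> (1 / DIM('a) - r) * I h" using I_pos[OF h] r_less by simp
    then have "ennreal (I h) + ennreal ((1 / DIM('a) - r) * I h) = ennreal (I h + (1 / DIM('a) - r) * I h)"
      using I_pos[OF h] by simp
    then show ?thesis by (simp add: algebra_simps)
  qed
  finally show ?thesis .
qed

lemma nn_integral_g_powr_q:
  assumes h: "h > 0"
  shows "(\<integral>\<^sup>+z. ennreal (g h (N z) powr q) * indicator (E h) z \<partial>lborel) = ennreal (I h)"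
proof -
  have "(\<integral>\<^sup>+z. ennreal (g h (N z) powr q) * indicator (E h) z \<partial>lborel)
    = (\<integral>\<^sup>+u. ennreal (g h u powr q) * (ennreal (real DIM('a) * m * u ^ (DIM('a) - 1)) * indicator {0..h} u) \<partial>lborel)"
    by (rule nn_integral_radial[OF h, of "\<lambda>u. ennreal (g h u powr q)"]) measurable
  also have "\<dots> = (\<integral>\<^sup>+u. ennreal (g h u powr q * (real DIM('a) * m * u ^ (DIM('a) - 1))) * indicator {0<..<h} u \<partial>lborel)"
  proof (rule nn_integral_cong_AE)
    have "AE u in lborel. u \<noteq> 0" "AE u in lborel. u \<noteq> h" by (rule AE_lborel_singleton)+
    then show "AE u in lborel. ennreal (g h u powr q) * (ennreal (real DIM('a) * m * u ^ (DIM('a) - 1)) * indicator {0..h} u)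
        = ennreal (g h u powr q * (real DIM('a) * m * u ^ (DIM('a) - 1))) * indicator {0<..<h} u"
    proof eventually_elim
      case (elim u)
      show ?case
      proof (cases "0 < u \<and> u < h")
        case True
        then show ?thesis by (simp only: ennreal_mult'[OF powr_ge_zero]) simp
      next
        case False
        then show ?thesis using elim by (auto simp: indicator_def)
      qed
    qed
  qed
  finally show ?thesis using nn_integral_I[OF h] by simp
qed

text \<open>The origin of \<open>A_const\<close>: since 1/q = 1 - r, this is the L_q norm of the
  kernel on \<open>E h\<close>. The powers of d contained in \<open>c_I\<close> combine to d^(-r)
  d^r / d = 1/d.\<close>

lemma I_root:
  assumes h: "h > 0"
  shows "I h powr (1 - r) = A_const DIM('a) p * m powr (- r) * h powr (1 - DIM('a) * r)"
proof -
  have q0: "q > 0" using q_ge_1 by simp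
  have B: "Beta beta_arg (q + 1) > 0" using Beta_pos[of beta_arg "q + 1"] beta_arg_pos q_ge_1 by simp
  have "q * (1 - r) = 1" using inverse_q q0 by (simp add: field_simps)
  then have e: "(1 - q) * (1 - r) = - r" "(DIM('a) - (real DIM('a) - 1) * q) * (1 - r) = 1 - DIM('a) * r"
  proof -
    have "(DIM('a) - (real DIM('a) - 1) * q) * (1 - r) = DIM('a) * (1 - r) - (real DIM('a) - 1) * (q * (1 - r))"
      by (simp add: algebra_simps)
    then show "(DIM('a) - (real DIM('a) - 1) * q) * (1 - r) = 1 - DIM('a) * r"
      by (simp only: \<open>q * (1 - r) = 1\<close>) (simp add: algebra_simps)
    have "(1 - q) * (1 - r) = (1 - r) - q * (1 - r)" by (simp add: algebra_simps)
    then show "(1 - q) * (1 - r) = - r" using \<open>q * (1 - r) = 1\<close> by simp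
  qed
  have "I h powr (1 - r) = (real DIM('a) * m) powr (- r) * h powr (1 - DIM('a) * r) * (1 / DIM('a)) powr (1 - r)
      * Beta beta_arg (q + 1) powr (1 - r)"
    by (simp only: I_def c_I_def powr_mult powr_divide powr_powr e) simp
  also have "(real DIM('a) * m) powr (- r) = DIM('a) powr (- r) * m powr (- r)"
    using m_pos by (simp add: powr_mult)
  also have "(1 / DIM('a)) powr (1 - r) = DIM('a) powr r * (1 / DIM('a))"
    using DIM_ge_1 by (simp add: powr_divide powr_diff)
  also have "DIM('a) powr (- r) * m powr (- r) * h powr (1 - DIM('a) * r) * (DIM('a) powr r * (1 / DIM('a)))
      * Beta beta_arg (q + 1) powr (1 - r) =
      (DIM('a) powr (- r) * DIM('a) powr r) * (1 / DIM('a) * Beta beta_arg (q + 1) powr (1 - r)) * m powr (- r) * h powr (1 - DIM('a) * r)"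
    by (simp add: mult_ac)
  also have "DIM('a) powr (- r) * DIM('a) powr r = (1::real)"
    using DIM_ge_1 by (simp flip: powr_add)
  finally show ?thesis by (simp add: A_const_def q_def[symmetric] beta_arg_def[symmetric] inverse_q)
qed

end

subsection \<open>Calculus with test functions\<close>

definition test_support :: "('a::euclidean_space \<Rightarrow> real) \<Rightarrow> 'a set" where
  "test_support \<phi> = closure {x. \<phi> x \<noteq> 0}"

lemma test_functionD:
  assumes "test_function \<Omega> \<phi>"
  shows "compact (test_support \<phi>)" "test_support \<phi> \<subseteq> \<Omega>"
    and "(\<phi> has_derivative frechet_derivative \<phi> (at x)) (at x)"
    and "continuous_on UNIV (\<lambda>x. frechet_derivative \<phi> (at x) v)"
proof -
  show "compact (test_support \<phi>)" "test_support \<phi> \<subseteq> \<Omega>"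
    using assms by (simp_all add: test_function_def test_support_def)
  have Ck: "Ck k \<phi>" for k using assms by (simp add: test_function_def)
  show "(\<phi> has_derivative frechet_derivative \<phi> (at x)) (at x)" by (rule Ck_SucD(1)[OF Ck])
  show "continuous_on UNIV (\<lambda>x. frechet_derivative \<phi> (at x) v)"
    using Ck_SucD(2)[of 0 \<phi> v, OF Ck] unfolding Ck.simps(1) .
qed

lemma test_function_outside: assumes "x \<notin> test_support \<phi>" shows "\<phi> x = 0"
proof (rule ccontr)
  assume "\<phi> x \<noteq> 0"
  then have "x \<in> {x. \<phi> x \<noteq> 0}" by simp
  then have "x \<in> test_support \<phi>" unfolding test_support_def by (rule subsetD[OF closure_subset])
  with assms show False by contradiction
qed

lemma test_function_deriv_outside:
  assumes "test_function \<Omega> \<phi>" "x \<notin> test_support \<phi>"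
  shows "frechet_derivative \<phi> (at x) v = 0"
proof -
  have "((\<lambda>_. 0) has_derivative frechet_derivative \<phi> (at x)) (at x)"
  proof (rule has_derivative_transform_within_open[OF test_functionD(3)[OF assms(1)]])
    show "open (- test_support \<phi>)" unfolding test_support_def by (intro open_Compl closed_closure)
    show "x \<in> - test_support \<phi>" using assms(2) by simp
    show "\<phi> y = 0" if "y \<in> - test_support \<phi>" for y
      by (rule test_function_outside) (use that in simp)
  qed
  moreover have "((\<lambda>_. 0::real) has_derivative (\<lambda>_. 0)) (at x)" by simp
  ultimately have "frechet_derivative \<phi> (at x) = (\<lambda>_. 0)" by (rule has_derivative_unique)
  then show ?thesis by simp
qed

lemma bounded_if_compactly_supported:
  fixes \<psi> :: "'a::euclidean_space \<Rightarrow> real"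
  assumes "continuous_on UNIV \<psi>" "compact S" "\<And>x. x \<notin> S \<Longrightarrow> \<psi> x = 0"
  obtains B where "B \<ge> 0" "\<And>x. \<bar>\<psi> x\<bar> \<le> B"
proof -
  have "compact (\<psi> ` S)" using assms by (intro compact_continuous_image) (auto intro: continuous_on_subset)
  then obtain B where B: "\<And>x. x \<in> S \<Longrightarrow> \<bar>\<psi> x\<bar> \<le> B"
    using compact_imp_bounded bounded_iff by (metis imageI real_norm_def)
  have "\<bar>\<psi> x\<bar> \<le> max B 0" for x
    using B[of x] assms(3)[of x] by (cases "x \<in> S") auto
  then show ?thesis using that[of "max B 0"] by auto
qed

lemma test_function_bounded:
  assumes "test_function \<Omega> \<phi>" obtains B where "B \<ge> 0" "\<And>x. \<bar>\<phi> x\<bar> \<le> B"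
  using bounded_if_compactly_supported[OF test_function_continuous[OF assms] test_functionD(1)[OF assms]]
    test_function_outside by metis

lemma test_function_deriv_bounded:
  assumes "test_function \<Omega> \<phi>" obtains B where "B \<ge> 0" "\<And>x. \<bar>frechet_derivative \<phi> (at x) v\<bar> \<le> B"
  using bounded_if_compactly_supported[OF test_functionD(4)[OF assms] test_functionD(1)[OF assms]]
    test_function_deriv_outside[OF assms] by metis

lemma test_function_translate:
  assumes \<phi>: "test_function \<Omega> \<phi>" and "\<And>x. x \<in> \<Omega> \<Longrightarrow> x + w \<in> \<Omega>'"
  shows "test_function \<Omega>' (\<lambda>x. \<phi> (x - w))"
proof -
  let ?S = "(\<lambda>x. x + w) ` test_support \<phi>"
  have c: "compact ?S"
    by (intro compact_continuous_image continuous_intros test_functionD(1)[OF \<phi>])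
  show ?thesis
  proof (rule test_functionI[of _ ?S])
    show "Ck k (\<lambda>x. \<phi> (x - w))" for k
      using \<phi> by (intro Ck_translate) (simp add: test_function_def)
    show "closed ?S" "bounded ?S" using c by (auto simp: compact_eq_bounded_closed)
    show "?S \<subseteq> \<Omega>'" using assms(2) test_functionD(2)[OF \<phi>] by blast
    show "\<phi> (x - w) = 0" if "x \<notin> ?S" for x
      by (rule test_function_outside) (use that in \<open>auto simp: image_iff\<close>)
  qed
qed

lemma frechet_derivative_translate:
  assumes "test_function \<Omega> \<phi>"
  shows "frechet_derivative (\<lambda>x. \<phi> (x - w)) (at x) v = frechet_derivative \<phi> (at (x - w)) v"
proof -
  have "((\<lambda>x. \<phi> (x - w)) has_derivative frechet_derivative \<phi> (at (x - w))) (at x)"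
    by (rule has_derivative_compose[where g=\<phi>, OF _ test_functionD(3)[OF assms], of "\<lambda>x. x - w" "\<lambda>v. v", simplified])
      (auto intro!: derivative_eq_intros)
  then show ?thesis using frechet_derivative_at by metis
qed

lemma frechet_derivative_direction:
  assumes "test_function \<Omega> \<phi>"
  shows "frechet_derivative \<phi> (at x) y = (\<Sum>b\<in>Basis. (y \<bullet> b) * frechet_derivative \<phi> (at x) b)"
proof -
  have lin: "linear (frechet_derivative \<phi> (at x))"
    using has_derivative_linear[OF test_functionD(3)[OF assms]] .
  have "frechet_derivative \<phi> (at x) (\<Sum>b\<in>Basis. (y \<bullet> b) *\<^sub>R b) = (\<Sum>b\<in>Basis. (y \<bullet> b) * frechet_derivative \<phi> (at x) b)"
    by (simp add: linear_sum[OF lin] linear_cmul[OF lin])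
  then show ?thesis by (simp add: euclidean_representation)
qed

lemma integrable_mult_compactly_supported:
  fixes f \<psi> :: "'a::euclidean_space \<Rightarrow> real"
  assumes f: "locally_integrable \<Omega> f" and \<psi>: "continuous_on UNIV \<psi>"
    and S: "compact S" "S \<subseteq> \<Omega>" "\<And>x. x \<notin> S \<Longrightarrow> \<psi> x = 0"
  shows "integrable lebesgue (\<lambda>x. indicator \<Omega> x * (f x * \<psi> x))"
proof -
  obtain B where B: "B \<ge> 0" "\<And>x. \<bar>\<psi> x\<bar> \<le> B"
    using bounded_if_compactly_supported[OF \<psi> S(1,3)] by metis
  have fi: "integrable lebesgue (\<lambda>x. indicator S x * f x)"
    using locally_integrableD[OF f S(1,2)] by (simp add: set_integrable_def)
  have \<psi>m: "\<psi> \<in> borel_measurable lebesgue"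
    using borel_measurable_continuous_onI[OF \<psi>] by (intro measurable_completion) simp
  have "integrable lebesgue (\<lambda>x. (indicator S x * f x) * \<psi> x)"
  proof (rule Bochner_Integration.integrable_bound)
    show "integrable lebesgue (\<lambda>x. B * (indicator S x * f x))" using fi by (rule integrable_mult_right)
    show "(\<lambda>x. (indicator S x * f x) * \<psi> x) \<in> borel_measurable lebesgue"
      by (intro borel_measurable_times[OF borel_measurable_integrable[OF fi] \<psi>m])
    show "AE x in lebesgue. norm (indicator S x * f x * \<psi> x) \<le> norm (B * (indicator S x * f x))"
    proof (intro AE_I2)
      fix x
      have "\<bar>indicator S x * f x\<bar> * \<bar>\<psi> x\<bar> \<le> \<bar>indicator S x * f x\<bar> * B"
        using B by (intro mult_left_mono) auto
      then show "norm (indicator S x * f x * \<psi> x) \<le> norm (B * (indicator S x * f x))"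
        using B(1) by (simp add: abs_mult mult_ac)
    qed
  qed
  also have "(\<lambda>x. (indicator S x * f x) * \<psi> x) = (\<lambda>x. indicator \<Omega> x * (f x * \<psi> x))"
    using S by (auto simp: indicator_def fun_eq_iff)
  finally show ?thesis .
qed

text \<open>The definition tests the gradient along \<open>Basis\<close> only, whereas the averaging
  uses every direction in C; linearity of the derivative of \<phi> bridges the gap.\<close>

lemma weak_gradient_direction:
  assumes wg: "has_weak_gradient \<Omega> f G" and \<phi>: "test_function \<Omega> \<phi>"
  shows "integrable lebesgue (\<lambda>x. indicator \<Omega> x * ((G x \<bullet> y) * \<phi> x))"
    and "(LINT x|lebesgue. indicator \<Omega> x * (f x * frechet_derivative \<phi> (at x) y))
       = - (LINT x|lebesgue. indicator \<Omega> x * ((G x \<bullet> y) * \<phi> x))"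
proof -
  have f: "locally_integrable \<Omega> f" and G: "locally_integrable \<Omega> G" using wg by (auto simp: has_weak_gradient_def)
  have Gb: "locally_integrable \<Omega> (\<lambda>x. G x \<bullet> y)" for y
    unfolding locally_integrable_def
  proof (intro allI impI)
    fix S assume "compact S \<and> S \<subseteq> \<Omega>"
    then have "integrable lebesgue (\<lambda>x. indicator S x *\<^sub>R G x)"
      using locally_integrableD[OF G] by (simp add: set_integrable_def)
    then have "integrable lebesgue (\<lambda>x. (indicator S x *\<^sub>R G x) \<bullet> y)" by (rule integrable_inner_left)
    then show "set_integrable lebesgue S (\<lambda>x. G x \<bullet> y)" by (simp add: set_integrable_def)
  qed
  have Gi: "integrable lebesgue (\<lambda>x. indicator \<Omega> x * ((G x \<bullet> y) * \<phi> x))" for y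
    by (rule integrable_mult_compactly_supported[OF Gb test_function_continuous[OF \<phi>] test_functionD(1,2)[OF \<phi>]])
      (rule test_function_outside)
  then show "integrable lebesgue (\<lambda>x. indicator \<Omega> x * ((G x \<bullet> y) * \<phi> x))" .
  have Fi: "integrable lebesgue (\<lambda>x. indicator \<Omega> x * (f x * frechet_derivative \<phi> (at x) y))" for y
    by (rule integrable_mult_compactly_supported[OF f test_functionD(4)[OF \<phi>] test_functionD(1,2)[OF \<phi>]
          test_function_deriv_outside[OF \<phi>]])
  have b: "(LINT x|lebesgue. indicator \<Omega> x * (f x * frechet_derivative \<phi> (at x) b))
       = - (LINT x|lebesgue. indicator \<Omega> x * ((G x \<bullet> b) * \<phi> x))" if "b \<in> Basis" for b
    using wg \<phi> that by (simp add: has_weak_gradient_def set_lebesgue_integral_def)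
  have "(LINT x|lebesgue. indicator \<Omega> x * (f x * frechet_derivative \<phi> (at x) y))
    = (LINT x|lebesgue. (\<Sum>b\<in>Basis. (y \<bullet> b) * (indicator \<Omega> x * (f x * frechet_derivative \<phi> (at x) b))))"
    by (subst frechet_derivative_direction[OF \<phi>]) (simp add: sum_distrib_left mult_ac)
  also have "\<dots> = (\<Sum>b\<in>Basis. (y \<bullet> b) * (LINT x|lebesgue. indicator \<Omega> x * (f x * frechet_derivative \<phi> (at x) b)))"
    by (subst Bochner_Integration.integral_sum) (auto intro!: integrable_mult_right Fi)
  also have "\<dots> = - (\<Sum>b\<in>Basis. (y \<bullet> b) * (LINT x|lebesgue. indicator \<Omega> x * ((G x \<bullet> b) * \<phi> x)))"
    by (simp add: b sum_negf)
  also have "\<dots> = - (LINT x|lebesgue. (\<Sum>b\<in>Basis. (y \<bullet> b) * (indicator \<Omega> x * ((G x \<bullet> b) * \<phi> x))))"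
    by (subst Bochner_Integration.integral_sum) (auto intro!: integrable_mult_right Gi)
  also have "(\<lambda>x. \<Sum>b\<in>Basis. (y \<bullet> b) * (indicator \<Omega> x * ((G x \<bullet> b) * \<phi> x)))
    = (\<lambda>x. indicator \<Omega> x * ((G x \<bullet> y) * \<phi> x))"
  proof
    fix x
    have "G x \<bullet> y = (\<Sum>b\<in>Basis. (G x \<bullet> b) * (y \<bullet> b))" by (rule euclidean_inner)
    then show "(\<Sum>b\<in>Basis. (y \<bullet> b) * (indicator \<Omega> x * ((G x \<bullet> b) * \<phi> x))) = indicator \<Omega> x * ((G x \<bullet> y) * \<phi> x)"
      by (simp add: sum_distrib_left sum_distrib_right mult_ac)
  qed
  finally show "(LINT x|lebesgue. indicator \<Omega> x * (f x * frechet_derivative \<phi> (at x) y))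
       = - (LINT x|lebesgue. indicator \<Omega> x * ((G x \<bullet> y) * \<phi> x))" .
qed

text \<open>The shift is written as x - y because \<phi> receives the increments of f with the
  opposite sign.\<close>

lemma test_function_segment:
  assumes \<phi>: "test_function \<Omega> \<phi>"
  shows "\<phi> x - \<phi> (x - y) = (LINT t|lborel. indicator {0..1} t * frechet_derivative \<phi> (at (x - t *\<^sub>R y)) y)"
proof -
  have "((\<lambda>t. - \<phi> (x - t *\<^sub>R y)) has_vector_derivative frechet_derivative \<phi> (at (x - t *\<^sub>R y)) y) (at t within {0..1})" for t
  proof -
    have lin: "linear (frechet_derivative \<phi> (at (x - t *\<^sub>R y)))"
      using has_derivative_linear[OF test_functionD(3)[OF \<phi>]] .
    have "((\<lambda>t. \<phi> (x - t *\<^sub>R y)) has_derivative (\<lambda>s. frechet_derivative \<phi> (at (x - t *\<^sub>R y)) (- (s *\<^sub>R y)))) (at t within {0..1})"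
      by (rule has_derivative_compose[OF _ test_functionD(3)[OF \<phi>]]) (auto intro!: derivative_eq_intros)
    then have "((\<lambda>t. - \<phi> (x - t *\<^sub>R y)) has_derivative (\<lambda>s. - frechet_derivative \<phi> (at (x - t *\<^sub>R y)) (- (s *\<^sub>R y)))) (at t within {0..1})"
      by (rule has_derivative_minus)
    then show ?thesis
      by (simp add: has_vector_derivative_def linear_neg[OF lin] linear_cmul[OF lin])
  qed
  moreover have "continuous_on {0..1} (\<lambda>t. frechet_derivative \<phi> (at (x - t *\<^sub>R y)) y)"
    by (rule continuous_on_compose2[OF test_functionD(4)[OF \<phi>]]) (auto intro!: continuous_intros)
  ultimately have "(LINT t|lborel. indicator {0..1} t *\<^sub>R frechet_derivative \<phi> (at (x - t *\<^sub>R y)) y)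
     = - \<phi> (x - 1 *\<^sub>R y) - - \<phi> (x - 0 *\<^sub>R y)"
    by (intro integral_FTC_Icc) auto
  then show ?thesis by simp
qed

subsection \<open>Integrals\<close>

lemma nn_integral_lborel_translate:
  fixes k :: "'a::euclidean_space \<Rightarrow> ennreal"
  assumes [measurable]: "k \<in> borel_measurable borel"
  shows "(\<integral>\<^sup>+x. k (x + w) \<partial>lborel) = (\<integral>\<^sup>+x. k x \<partial>lborel)"
proof -
  have "(\<integral>\<^sup>+x. k x \<partial>lborel) = (\<integral>\<^sup>+x. k x \<partial>distr lborel borel ((+) w))" by (simp add: lborel_distr_plus)
  also have "\<dots> = (\<integral>\<^sup>+x. k (w + x) \<partial>lborel)" by (subst nn_integral_distr) auto
  finally show ?thesis by (simp add: add.commute)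
qed

lemma integral_lborel_translate:
  fixes k :: "'a::euclidean_space \<Rightarrow> real"
  assumes [measurable]: "k \<in> borel_measurable borel"
  shows "(LINT x|lborel. k (x + w)) = (LINT x|lborel. k x)"
proof -
  have "(LINT x|lborel. k x) = (LINT x|distr lborel borel ((+) w). k x)" by (simp add: lborel_distr_plus)
  also have "\<dots> = (LINT x|lborel. k (w + x))" by (subst integral_distr) auto
  finally show ?thesis by (simp add: add.commute)
qed

lemma AE_lborel_translate:
  fixes w :: "'a::euclidean_space"
  assumes [measurable]: "{x. P x} \<in> sets borel" and "AE x in lborel. P x"
  shows "AE x in lborel. P (x + w)"
proof -
  have "AE x in distr lborel borel ((+) w). P x" using assms(2) by (subst lborel_distr_plus)
  then have "AE x in lborel. P (w + x)" by (subst (asm) AE_distr_iff) auto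
  then show ?thesis by (simp add: add.commute)
qed

lemma nn_integral_lborel_scale:
  fixes k :: "'a::euclidean_space \<Rightarrow> ennreal"
  assumes [measurable]: "k \<in> borel_measurable borel" and t: "t > 0"
  shows "(\<integral>\<^sup>+y. k (t *\<^sub>R y) \<partial>lborel) = ennreal (1 / t ^ DIM('a)) * (\<integral>\<^sup>+z. k z \<partial>lborel)"
proof -
  have "(\<integral>\<^sup>+z. k z \<partial>lborel) = (\<integral>\<^sup>+z. k z \<partial>density (distr lborel borel (\<lambda>x. 0 + t *\<^sub>R x)) (\<lambda>_. \<bar>t\<bar> ^ DIM('a)))"
    using t by (subst lborel_affine[of t 0]) auto
  also have "\<dots> = (\<integral>\<^sup>+y. ennreal (t ^ DIM('a)) * k (t *\<^sub>R y) \<partial>lborel)"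
    using t by (subst nn_integral_density) (auto simp: nn_integral_distr)
  also have "\<dots> = ennreal (t ^ DIM('a)) * (\<integral>\<^sup>+y. k (t *\<^sub>R y) \<partial>lborel)"
    by (rule nn_integral_cmult) measurable
  finally have "ennreal (1 / t ^ DIM('a)) * (\<integral>\<^sup>+z. k z \<partial>lborel)
      = (ennreal (1 / t ^ DIM('a)) * ennreal (t ^ DIM('a))) * (\<integral>\<^sup>+y. k (t *\<^sub>R y) \<partial>lborel)"
    by (simp add: mult.assoc)
  also have "ennreal (1 / t ^ DIM('a)) * ennreal (t ^ DIM('a)) = 1"
    using t by (simp add: ennreal_mult'[symmetric])
  finally show ?thesis by simp
qed

text \<open>Justifies the exchange of signed integrals in which f is integrable, the other variable
  ranges over a set of finite measure, and the test function or its derivative is bounded.\<close>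

lemma integrable_pair_bounded_factor:
  fixes u :: "'a::euclidean_space \<Rightarrow> real" and v :: "'b::euclidean_space \<Rightarrow> real"
  assumes u: "integrable lborel u" and v: "integrable lborel v"
    and b[measurable]: "b \<in> borel_measurable (borel \<Otimes>\<^sub>M borel)" and bB: "\<And>z. \<bar>b z\<bar> \<le> B"
  shows "integrable (lborel \<Otimes>\<^sub>M lborel) (\<lambda>(x, y). u x * (v y * b (x, y)))"
proof (rule integrableI_bounded)
  have [measurable]: "u \<in> borel_measurable borel" "v \<in> borel_measurable borel" using u v by auto
  show "(\<lambda>(x, y). u x * (v y * b (x, y))) \<in> borel_measurable (lborel \<Otimes>\<^sub>M lborel)" by measurable
  have B: "B \<ge> 0" using bB[of undefined] by linarith
  have "(\<integral>\<^sup>+z. ennreal (norm (case z of (x, y) \<Rightarrow> u x * (v y * b (x, y)))) \<partial>(lborel \<Otimes>\<^sub>M lborel))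
      = (\<integral>\<^sup>+x. \<integral>\<^sup>+y. ennreal (norm (u x * (v y * b (x, y)))) \<partial>lborel \<partial>lborel)"
    by (subst lborel.nn_integral_fst[symmetric]) auto
  also have "\<dots> \<le> (\<integral>\<^sup>+x. \<integral>\<^sup>+y. ennreal B * (ennreal (norm (u x)) * ennreal (norm (v y))) \<partial>lborel \<partial>lborel)"
  proof (intro nn_integral_mono)
    fix x y
    have "norm (u x * (v y * b (x, y))) \<le> B * (norm (u x) * norm (v y))"
      using mult_right_mono[OF bB[of "(x, y)"], of "\<bar>u x\<bar> * \<bar>v y\<bar>"] by (simp add: abs_mult mult_ac)
    then show "ennreal (norm (u x * (v y * b (x, y)))) \<le> ennreal B * (ennreal (norm (u x)) * ennreal (norm (v y)))"
      using B by (simp add: ennreal_mult'[symmetric] ennreal_leI)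
  qed
  also have "\<dots> = ennreal B * ((\<integral>\<^sup>+x. ennreal (norm (u x)) \<partial>lborel) * (\<integral>\<^sup>+y. ennreal (norm (v y)) \<partial>lborel))"
    by (simp add: nn_integral_cmult nn_integral_multc)
  also have "\<dots> < \<infinity>"
    using u v by (auto simp: integrable_iff_bounded ennreal_mult_less_top)
  finally show "(\<integral>\<^sup>+z. ennreal (norm (case z of (x, y) \<Rightarrow> u x * (v y * b (x, y)))) \<partial>(lborel \<Otimes>\<^sub>M lborel)) < \<infinity>" .
qed

text \<open>Convexity of exp at the points P ln x and P / (P - 1) ln y, with weights 1/P and 1 -
  1/P.\<close>

lemma Young_powr:
  assumes P: "P > 1" and x: "x \<ge> 0" and y: "y \<ge> (0::real)"
  shows "x * y \<le> (1 / P) * x powr P + (1 - 1 / P) * y powr (P / (P - 1))"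
proof (cases "x = 0 \<or> y = 0")
  case True
  then show ?thesis using P by auto
next
  case False
  then have x: "x > 0" and y: "y > 0" using x y by auto
  have "exp ((1 - (1 - 1 / P)) *\<^sub>R (P * ln x) + (1 - 1 / P) *\<^sub>R (P / (P - 1) * ln y))
      \<le> (1 - (1 - 1 / P)) * exp (P * ln x) + (1 - 1 / P) * exp (P / (P - 1) * ln y)"
    by (rule convex_onD[OF exp_convex]) (use P in auto)
  moreover have "(1 - (1 - 1 / P)) *\<^sub>R (P * ln x) + (1 - 1 / P) *\<^sub>R (P / (P - 1) * ln y) = ln x + ln y"
    using P by (simp add: field_simps)
  moreover have "exp (ln x + ln y) = x * y" using x y by (simp add: exp_add)
  ultimately show ?thesis using x y by (simp add: powr_def)
qed

lemma ennreal_lincomb: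
  "0 \<le> s \<Longrightarrow> 0 \<le> x \<Longrightarrow> 0 \<le> t \<Longrightarrow> 0 \<le> y \<Longrightarrow>
    ennreal s * ennreal x + ennreal t * ennreal y = ennreal (s * x + t * y)"
  by (simp add: ennreal_mult)

text \<open>Young's inequality for u / a and v / b, where a and b are the two norms: the right-hand
  side then integrates to 1. If a norm vanishes, so does the product almost everywhere.\<close>

lemma nn_integral_Hoelder:
  assumes P: "P > 1" and Q: "Q = P / (P - 1)"
    and [measurable]: "u \<in> borel_measurable M" "v \<in> borel_measurable M"
    and u0: "\<And>x. 0 \<le> u x" and v0: "\<And>x. 0 \<le> v x"
    and A: "(\<integral>\<^sup>+x. ennreal (u x powr P) \<partial>M) = ennreal A" "A \<ge> 0"
    and B: "(\<integral>\<^sup>+x. ennreal (v x powr Q) \<partial>M) = ennreal B" "B \<ge> 0"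
  shows "(\<integral>\<^sup>+x. ennreal (u x * v x) \<partial>M) \<le> ennreal (A powr (1 / P) * B powr (1 / Q))"
proof (cases "A = 0 \<or> B = 0")
  case True
  have "AE x in M. u x * v x = 0"
  proof (cases "A = 0")
    case True
    then have "AE x in M. ennreal (u x powr P) = 0" using A by (subst nn_integral_0_iff_AE[symmetric]) auto
    then show ?thesis by eventually_elim (simp add: ennreal_eq_0_iff)
  next
    case False
    with \<open>A = 0 \<or> B = 0\<close> have "AE x in M. ennreal (v x powr Q) = 0"
      using B by (subst nn_integral_0_iff_AE[symmetric]) auto
    then show ?thesis by eventually_elim (simp add: ennreal_eq_0_iff)
  qed
  then have "(\<integral>\<^sup>+x. ennreal (u x * v x) \<partial>M) = (\<integral>\<^sup>+x. 0 \<partial>M)"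
    by (intro nn_integral_cong_AE) (auto elim: eventually_mono)
  then show ?thesis by simp
next
  case False
  then have AB: "A > 0" "B > 0" using A B by auto
  have Q0: "Q > 0" using P Q by simp
  define a b where "a = A powr (1 / P)" and "b = B powr (1 / Q)"
  have ab: "a > 0" "b > 0" using AB by (simp_all add: a_def b_def)
  have aP: "a powr P = A" and bQ: "b powr Q = B"
    using P Q0 AB by (simp_all add: a_def b_def powr_powr)
  have pw: "u x * v x \<le> (a * b) * ((1 / P / A) * u x powr P + ((1 - 1 / P) / B) * v x powr Q)" for x
  proof -
    have "(u x / a) * (v x / b) \<le> (1 / P) * (u x / a) powr P + (1 - 1 / P) * (v x / b) powr Q"
      unfolding Q by (rule Young_powr) (use P ab u0 v0 in auto)
    also have "\<dots> = (1 / P / A) * u x powr P + ((1 - 1 / P) / B) * v x powr Q"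
      using ab u0[of x] v0[of x] by (simp add: powr_divide aP bQ)
    finally have "u x * v x / (a * b) \<le> (1 / P / A) * u x powr P + ((1 - 1 / P) / B) * v x powr Q" by simp
    then show ?thesis using ab by (simp only: pos_divide_le_eq mult_pos_pos mult.commute)
  qed
  have "(\<integral>\<^sup>+x. ennreal (u x * v x) \<partial>M)
      \<le> (\<integral>\<^sup>+x. ennreal (a * b) * (ennreal (1 / P / A) * ennreal (u x powr P) + ennreal ((1 - 1 / P) / B) * ennreal (v x powr Q)) \<partial>M)"
  proof (rule nn_integral_mono)
    fix x
    have "ennreal (u x * v x) \<le> ennreal ((a * b) * ((1 / P / A) * u x powr P + ((1 - 1 / P) / B) * v x powr Q))"
      by (rule ennreal_leI[OF pw])
    also have "\<dots> = ennreal (a * b) * (ennreal (1 / P / A) * ennreal (u x powr P) + ennreal ((1 - 1 / P) / B) * ennreal (v x powr Q))"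
    proof -
      have "0 \<le> a * b" using ab by simp
      then show ?thesis using P AB by (subst ennreal_lincomb) (simp_all only: ennreal_mult'[of "a * b"], simp_all)
    qed
    finally show "ennreal (u x * v x) \<le> \<dots>" .
  qed
  also have "\<dots> = ennreal (a * b) * (ennreal (1 / P / A) * ennreal A + ennreal ((1 - 1 / P) / B) * ennreal B)"
    by (simp add: nn_integral_cmult nn_integral_add A B)
  also have "ennreal (1 / P / A) * ennreal A + ennreal ((1 - 1 / P) / B) * ennreal B = 1"
  proof -
    have "ennreal (1 / P / A) * ennreal A + ennreal ((1 - 1 / P) / B) * ennreal B = ennreal (1 / P / A * A + (1 - 1 / P) / B * B)"
      using P AB by (intro ennreal_lincomb) simp_all
    also have "1 / P / A * A + (1 - 1 / P) / B * B = 1" using AB by simp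
    finally show ?thesis unfolding ennreal_1 .
  qed
  finally show ?thesis by (simp add: a_def b_def)
qed

subsection \<open>The additive inequality\<close>

context extremal_problem
begin

text \<open>The integral over the position t on a segment, with a = N z / h. The value 1/d at the
  end t = 1 becomes the subtracted term u / h^d of the kernel.\<close>

lemma inverse_power_integral:
  assumes a: "a > 0"
  shows "(\<integral>\<^sup>+t. ennreal (inverse t ^ (DIM('a) + 1)) * indicator {0<..1} t * (if a < t then 1 else 0) \<partial>lborel)
     = (if a < 1 then ennreal ((inverse a ^ DIM('a) - 1) / DIM('a)) else 0)"
  (is "?I = _")
proof (cases "a < 1")
  case True
  have "?I
     = (\<integral>\<^sup>+t. ennreal (inverse t ^ (DIM('a) + 1)) * indicator {a..1} t \<partial>lborel)"
  proof (rule nn_integral_cong_AE)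
    have "AE t in lborel. t \<noteq> a" by (rule AE_lborel_singleton)
    then show "AE t in lborel. ennreal (inverse t ^ (DIM('a) + 1)) * indicator {0<..1} t * (if a < t then 1 else 0)
        = ennreal (inverse t ^ (DIM('a) + 1)) * indicator {a..1} t"
      by eventually_elim (use a in \<open>auto simp: indicator_def\<close>)
  qed
  also have "\<dots> = ennreal ((- (inverse 1 ^ DIM('a)) / DIM('a)) - (- (inverse a ^ DIM('a)) / DIM('a)))"
  proof (rule nn_integral_FTC_Icc[where F="\<lambda>t. - (inverse t ^ DIM('a)) / DIM('a)"])
    fix t :: real assume "t \<in> {a..1}"
    then have t: "a \<le> t" "t \<le> 1" by auto
    have "((\<lambda>t. inverse t ^ DIM('a)) has_real_derivative DIM('a) * (inverse t ^ (DIM('a) - 1) * - (inverse t ^ 2))) (at t)"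
      using t a by (auto intro!: derivative_eq_intros simp: power2_eq_square One_nat_def)
    then have "((\<lambda>t. - (inverse t ^ DIM('a)) / DIM('a)) has_real_derivative
        - (DIM('a) * (inverse t ^ (DIM('a) - 1) * - (inverse t ^ 2))) / DIM('a)) (at t)"
      by (intro DERIV_cdivide DERIV_minus)
    moreover have "inverse t ^ (DIM('a) - 1) * inverse t ^ 2 = inverse t ^ (DIM('a) + 1)"
    proof -
      have "(DIM('a) - 1) + 2 = DIM('a) + 1" using DIM_positive[where 'a='a] by linarith
      then show ?thesis by (metis power_add)
    qed
    ultimately show "((\<lambda>t. - (inverse t ^ DIM('a)) / DIM('a)) has_real_derivative inverse t ^ (DIM('a) + 1)) (at t)"
      by simp
  qed (use True a in auto)
  finally show ?thesis using True by (simp add: diff_divide_distrib)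
next
  case False
  then have "?I = (\<integral>\<^sup>+t. 0 \<partial>(lborel::real measure))"
    by (intro nn_integral_cong) (auto simp: indicator_def)
  then show ?thesis using False by simp
qed

text \<open>Averaging over the segments from \<open>x\<close> to the points of \<open>x + E h\<close> produces the kernel
  \<^term>\<open>g h\<close>.\<close>

lemma segment_average:
  fixes H :: "'a \<Rightarrow> real"
  assumes h: "h > 0" and [measurable]: "H \<in> borel_measurable borel" and H0: "\<And>x. 0 \<le> H x"
  shows "(\<integral>\<^sup>+t. indicator {0<..1} t * (\<integral>\<^sup>+y. ennreal (H (x + t *\<^sub>R y) * N y) * indicator (E h) y \<partial>lborel) \<partial>lborel)
     = ennreal (m * h ^ DIM('a)) * (\<integral>\<^sup>+z. ennreal (H (x + z) * g h (N z)) * indicator (E h) z \<partial>lborel)"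
proof -
  note [measurable] = E_sets[OF h]
  \<comment> \<open>The exponent d + 1 collects t^(-d) from the substitution z = t y and one more
    1/t from N y = N z / t.\<close>
  define c where "c t = ennreal (inverse t ^ (DIM('a) + 1)) * indicator {0<..1} t" for t :: real
  have [measurable]: "c \<in> borel_measurable borel" unfolding c_def by measurable
  let ?J = "\<lambda>t. \<integral>\<^sup>+y. ennreal (H (x + t *\<^sub>R y) * N y) * indicator (E h) y \<partial>lborel"
  let ?b = "\<lambda>z t. ennreal (H (x + z) * N z) * indicator C z * (c t * (if N z / h < t then 1 else 0))"
  have inner: "indicator {0<..1} t * ?J t
     = (\<integral>\<^sup>+z. ?b z t \<partial>lborel)" for t :: real
  proof (cases "t \<in> {0<..1}")
    case True
    then have t: "t > 0" by simp
    define k where "k z = ennreal (inverse t) * (ennreal (H (x + z) * N z) * indicator C z * (if N z / h < t then 1 else 0))" for z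
    have [measurable]: "k \<in> borel_measurable borel" unfolding k_def by measurable
    have "ennreal (H (x + t *\<^sub>R y) * N y) * indicator (E h) y = k (t *\<^sub>R y)" for y
    proof -
      have "indicator (E h) y = (indicator C (t *\<^sub>R y) * (if N (t *\<^sub>R y) / h < t then 1 else 0) :: ennreal)"
        unfolding E_eq[OF h] using t h C_scaleR_iff[OF t, of y]
        by (auto simp: indicator_def N_scaleR field_simps)
      moreover have "ennreal (H (x + t *\<^sub>R y) * N y) = ennreal (inverse t) * ennreal (H (x + t *\<^sub>R y) * N (t *\<^sub>R y))"
        using t H0 by (simp add: ennreal_mult'[symmetric] N_scaleR)
      ultimately show ?thesis by (simp add: k_def mult_ac)
    qed
    then have "?J t = (\<integral>\<^sup>+y. k (t *\<^sub>R y) \<partial>lborel)"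
      by simp
    also have "\<dots> = ennreal (1 / t ^ DIM('a)) * (\<integral>\<^sup>+z. k z \<partial>lborel)"
      by (rule nn_integral_lborel_scale[OF _ t]) measurable
    also have "\<dots> = (\<integral>\<^sup>+z. ennreal (1 / t ^ DIM('a)) * k z \<partial>lborel)"
      by (rule nn_integral_cmult[symmetric]) measurable
    also have "\<dots> = (\<integral>\<^sup>+z. ?b z t \<partial>lborel)"
    proof (rule nn_integral_cong)
      fix z
      have ct: "c t = ennreal (1 / t ^ DIM('a)) * ennreal (inverse t)"
        using t True by (simp add: c_def ennreal_mult'[symmetric] inverse_eq_divide power_divide power_add)
      then show "ennreal (1 / t ^ DIM('a)) * k z = ?b z t"
        by (simp add: k_def ct mult_ac)
    qed
    finally show ?thesis using True by simp
  next
    case False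
    then show ?thesis by (simp add: c_def)
  qed
  have "(\<integral>\<^sup>+t. indicator {0<..1} t * ?J t \<partial>lborel)
     = (\<integral>\<^sup>+t. \<integral>\<^sup>+z. ?b z t \<partial>lborel \<partial>lborel)"
    by (simp only: inner)
  also have "\<dots> = (\<integral>\<^sup>+z. \<integral>\<^sup>+t. ?b z t \<partial>lborel \<partial>lborel)"
    by (rule lborel_pair.Fubini') measurable
  also have "\<dots> = (\<integral>\<^sup>+z. ennreal (m * h ^ DIM('a)) * (ennreal (H (x + z) * g h (N z)) * indicator (E h) z) \<partial>lborel)"
  proof (rule nn_integral_cong_AE)
    have "AE z in lborel. z \<noteq> (0::'a)" by (rule AE_lborel_singleton)
    then show "AE z in lborel. (\<integral>\<^sup>+t. ?b z t \<partial>lborel)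
        = ennreal (m * h ^ DIM('a)) * (ennreal (H (x + z) * g h (N z)) * indicator (E h) z)"
    proof eventually_elim
      case (elim z)
      have Nz: "N z > 0" using elim by simp
      have "(\<integral>\<^sup>+t. ?b z t \<partial>lborel)
        = ennreal (H (x + z) * N z) * indicator C z * (\<integral>\<^sup>+t. c t * (if N z / h < t then 1 else 0) \<partial>lborel)"
        by (rule nn_integral_cmult) measurable
      also have "(\<integral>\<^sup>+t. c t * (if N z / h < t then 1 else 0) \<partial>lborel)
        = (if N z / h < 1 then ennreal ((inverse (N z / h) ^ DIM('a) - 1) / DIM('a)) else 0)"
        unfolding c_def using Nz h by (intro inverse_power_integral) simp
      also have "ennreal (H (x + z) * N z) * indicator C z * \<dots>
        = ennreal (m * h ^ DIM('a)) * (ennreal (H (x + z) * g h (N z)) * indicator (E h) z)"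
      proof (cases "z \<in> C \<and> N z < h")
        case True
        then have "z \<in> E h" unfolding E_eq[OF h] by simp
        have pw: "N z ^ DIM('a) = N z * N z ^ (DIM('a) - 1)"
          using DIM_positive[where 'a='a] by (simp add: power_eq_if)
        \<comment> \<open>N z times the integral over t is the kernel, up to the volume of
          \<open>E h\<close>.\<close>
        have kern: "N z * ((inverse (N z / h) ^ DIM('a) - 1) / DIM('a)) = m * h ^ DIM('a) * g h (N z)"
          unfolding g_eq[OF Nz conjunct2[OF True]] using Nz h m_pos DIM_ge_1
          by (simp add: power_divide pw) (simp add: field_simps)
        have "H (x + z) * N z * ((inverse (N z / h) ^ DIM('a) - 1) / DIM('a)) = m * h ^ DIM('a) * (H (x + z) * g h (N z))"
          using arg_cong[OF kern, of "\<lambda>s. H (x + z) * s"] by (simp only: mult_ac)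
        moreover have "ennreal (H (x + z) * N z) * ennreal ((inverse (N z / h) ^ DIM('a) - 1) / DIM('a))
          = ennreal (H (x + z) * N z * ((inverse (N z / h) ^ DIM('a) - 1) / DIM('a)))"
          using H0 by (intro ennreal_mult'[symmetric]) simp
        moreover have "ennreal (m * h ^ DIM('a)) * ennreal (H (x + z) * g h (N z)) = ennreal (m * h ^ DIM('a) * (H (x + z) * g h (N z)))"
          using m_pos h by (intro ennreal_mult'[symmetric]) simp
        ultimately show ?thesis using True \<open>z \<in> E h\<close> h by simp
      next
        case False
        then have "z \<notin> E h" unfolding E_eq[OF h] by simp
        then show ?thesis using False h by (auto simp: indicator_def)
      qed
      finally show ?case .
    qed
  qed
  also have "\<dots> = ennreal (m * h ^ DIM('a)) * (\<integral>\<^sup>+z. ennreal (H (x + z) * g h (N z)) * indicator (E h) z \<partial>lborel)"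
    by (rule nn_integral_cmult) measurable
  finally show ?thesis .
qed

text \<open>\<open>H\<close> lives on the whole space, so its norm does not change under the
  translation by x and the bound is uniform in x.\<close>

lemma Hoelder_kernel:
  assumes h: "h > 0" and [measurable]: "H \<in> borel_measurable borel" and H0: "\<And>x. 0 \<le> H x"
    and L: "Lp_norm p lborel H = ennreal L" "L \<ge> 0"
  shows "(\<integral>\<^sup>+z. ennreal (H (x + z) * g h (N z)) * indicator (E h) z \<partial>lborel) \<le> ennreal (L * I h powr (1 - r))"
proof -
  note [measurable] = E_sets[OF h]
  \<comment> \<open>The origin, which lies in \<open>E h\<close> if C is the whole space, is removed
    because the sign of the kernel is only known at positive arguments.\<close>
  let ?v = "\<lambda>z. g h (N z) * indicator (E h - {0}) z"
  have v0: "0 \<le> ?v z" for z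
    using g_pos[of "N z" h] E_eq[OF h] by (auto simp: indicator_def less_imp_le)
  have nz: "AE z in lborel. z \<noteq> (0::'a)" by (rule AE_lborel_singleton)
  have lhs: "(\<integral>\<^sup>+z. ennreal (H (x + z) * g h (N z)) * indicator (E h) z \<partial>lborel) = (\<integral>\<^sup>+z. ennreal (H (x + z) * ?v z) \<partial>lborel)"
  proof (rule nn_integral_cong_AE)
    show "AE z in lborel. ennreal (H (x + z) * g h (N z)) * indicator (E h) z = ennreal (H (x + z) * ?v z)"
      using nz by eventually_elim (auto simp: indicator_def)
  qed
  have vq: "(\<integral>\<^sup>+z. ennreal (?v z powr q) \<partial>lborel) = ennreal (I h)"
  proof -
    have "(\<integral>\<^sup>+z. ennreal (?v z powr q) \<partial>lborel) = (\<integral>\<^sup>+z. ennreal (g h (N z) powr q) * indicator (E h) z \<partial>lborel)"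
    proof (rule nn_integral_cong_AE)
      show "AE z in lborel. ennreal (?v z powr q) = ennreal (g h (N z) powr q) * indicator (E h) z"
        using nz by eventually_elim (auto simp: indicator_def)
    qed
    then show ?thesis by (simp add: nn_integral_g_powr_q[OF h])
  qed
  show ?thesis
  proof (cases rule: p_cases)
    case 1
    have "AE x in lborel. ennreal \<bar>H x\<bar> \<le> ennreal L"
      using esssup_AE[where M=lborel and f="\<lambda>x. ennreal \<bar>H x\<bar>"] L(1) 1(1) by (simp add: Lp_norm_def)
    then have "AE z in lborel. ennreal \<bar>H (z + x)\<bar> \<le> ennreal L"
      by (intro AE_lborel_translate) auto
    then have "AE z in lborel. H (x + z) \<le> L"
      using L(2) H0 by (auto elim!: eventually_mono simp: add.commute)
    then have "(\<integral>\<^sup>+z. ennreal (H (x + z) * ?v z) \<partial>lborel) \<le> (\<integral>\<^sup>+z. ennreal L * ennreal (?v z) \<partial>lborel)"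
    proof (intro nn_integral_mono_AE, elim eventually_mono)
      fix z assume "H (x + z) \<le> L"
      then have "H (x + z) * ?v z \<le> L * ?v z" using v0 by (rule mult_right_mono)
      then show "ennreal (H (x + z) * ?v z) \<le> ennreal L * ennreal (?v z)"
        using L(2) by (simp only: ennreal_mult'[symmetric] ennreal_leI)
    qed
    also have "\<dots> = ennreal L * (\<integral>\<^sup>+z. ennreal (?v z) \<partial>lborel)" by (rule nn_integral_cmult) measurable
    also have "(\<integral>\<^sup>+z. ennreal (?v z) \<partial>lborel) = ennreal (I h)"
      using vq v0 unfolding 1(2) by simp
    finally show ?thesis
      unfolding lhs using 1(3) L(2) I_pos[OF h] by (simp add: ennreal_mult'[symmetric])
  next
    case (2 P)
    let ?A = "\<integral>\<^sup>+x. ennreal (\<bar>H x\<bar> powr P) \<partial>lborel"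
    have Afin: "?A \<noteq> \<infinity>" and LA: "L = enn2real ?A powr (1 / P)"
      using L 2(1,2) by (auto simp: Lp_norm_def epowr_def split: if_splits)
    have A: "(\<integral>\<^sup>+z. ennreal (H (x + z) powr P) \<partial>lborel) = ennreal (enn2real ?A)"
    proof -
      have "(\<integral>\<^sup>+z. ennreal (H (x + z) powr P) \<partial>lborel) = (\<integral>\<^sup>+z. ennreal (\<bar>H (z + x)\<bar> powr P) \<partial>lborel)"
        using H0 by (simp add: add.commute)
      also have "\<dots> = ?A" by (rule nn_integral_lborel_translate) measurable
      finally show ?thesis using Afin by (simp add: less_top)
    qed
    have "(\<integral>\<^sup>+z. ennreal (H (x + z) * ?v z) \<partial>lborel) \<le> ennreal (enn2real ?A powr (1 / P) * I h powr (1 / q))"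
      by (rule nn_integral_Hoelder[OF 2(4,5)]) (use A vq I_pos[OF h] v0 H0 in auto)
    then show ?thesis unfolding lhs LA inverse_q .
  qed
qed

text \<open>Translating \<phi> by t y with y in C moves its support further into C, so the translate
  may be inserted in the definition of the weak gradient. \<open>f0\<close> and \<open>H\<close> are
  Borel functions on the whole space, as the later exchanges of integrals are made for
  \<open>lborel\<close>.\<close>

lemma integral_weak_derivative_bound:
  assumes wg: "has_weak_gradient C f G" and \<phi>: "test_function C \<phi>" and \<phi>0: "\<And>x. 0 \<le> \<phi> x"
    and [measurable]: "f0 \<in> borel_measurable borel" "H \<in> borel_measurable borel"
    and f0: "AE x in lborel. f0 x = indicator C x * f x"
    and H: "AE x in lborel. x \<in> C \<longrightarrow> N' (G x) \<le> H x" and H0: "\<And>x. 0 \<le> H x"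
    and y: "y \<in> C" and t: "t \<ge> 0"
  shows "ennreal \<bar>LINT x|lborel. f0 x * frechet_derivative \<phi> (at (x - t *\<^sub>R y)) y\<bar>
    \<le> (\<integral>\<^sup>+x. ennreal (H x * N y * \<phi> (x - t *\<^sub>R y)) \<partial>lborel)"
proof -
  let ?\<psi> = "\<lambda>x. \<phi> (x - t *\<^sub>R y)"
  have \<psi>: "test_function C ?\<psi>"
  proof (rule test_function_translate[OF \<phi>])
    show "x + t *\<^sub>R y \<in> C" if "x \<in> C" for x
      using t that C_add[OF that C_scaleR[OF y]] by (cases "t = 0") auto
  qed
  have [measurable]: "(\<lambda>x. frechet_derivative \<phi> (at (x - t *\<^sub>R y)) y) \<in> borel_measurable borel"
    by (intro borel_measurable_continuous_onI continuous_on_compose2[OF test_functionD(4)[OF \<phi>]])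
      (auto intro!: continuous_intros)
  have [measurable]: "?\<psi> \<in> borel_measurable borel" by (rule test_function_measurable[OF \<psi>])
  note wd = weak_gradient_direction[OF wg \<psi>, of y]
  have "(LINT x|lborel. f0 x * frechet_derivative \<phi> (at (x - t *\<^sub>R y)) y)
      = (LINT x|lebesgue. f0 x * frechet_derivative \<phi> (at (x - t *\<^sub>R y)) y)"
    by (rule integral_completion[symmetric]) measurable
  also have "\<dots> = (LINT x|lebesgue. indicator C x * (f x * frechet_derivative ?\<psi> (at x) y))"
  proof (rule integral_cong_AE)
    show "(\<lambda>x. f0 x * frechet_derivative \<phi> (at (x - t *\<^sub>R y)) y) \<in> borel_measurable lebesgue"
      by (rule measurable_completion) measurable
    show "AE x in lebesgue. f0 x * frechet_derivative \<phi> (at (x - t *\<^sub>R y)) y = indicator C x * (f x * frechet_derivative ?\<psi> (at x) y)"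
      using AE_completion[OF f0] by eventually_elim (simp add: frechet_derivative_translate[OF \<phi>])
    then show "(\<lambda>x. indicator C x * (f x * frechet_derivative ?\<psi> (at x) y)) \<in> borel_measurable lebesgue"
      by (intro borel_measurable_integrable integrable_mult_compactly_supported[OF _ test_functionD(4)[OF \<psi>] test_functionD(1,2)[OF \<psi>]
            test_function_deriv_outside[OF \<psi>]]) (use wg in \<open>auto simp: has_weak_gradient_def\<close>)
  qed
  also have "\<dots> = - (LINT x|lebesgue. indicator C x * ((G x \<bullet> y) * ?\<psi> x))" by (rule wd(2))
  finally have "ennreal \<bar>LINT x|lborel. f0 x * frechet_derivative \<phi> (at (x - t *\<^sub>R y)) y\<bar>
     = ennreal (norm (LINT x|lebesgue. indicator C x * ((G x \<bullet> y) * ?\<psi> x)))" by simp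
  also have "\<dots> \<le> (\<integral>\<^sup>+x. norm (indicator C x * ((G x \<bullet> y) * ?\<psi> x)) \<partial>lebesgue)"
    by (rule integral_norm_bound_ennreal[OF wd(1)])
  also have "\<dots> \<le> (\<integral>\<^sup>+x. ennreal (H x * N y * ?\<psi> x) \<partial>lebesgue)"
  proof (rule nn_integral_mono_AE)
    show "AE x in lebesgue. ennreal (norm (indicator C x * ((G x \<bullet> y) * ?\<psi> x))) \<le> ennreal (H x * N y * ?\<psi> x)"
      using AE_completion[OF H]
    proof eventually_elim
      case (elim x)
      show ?case
      proof (cases "x \<in> C")
        case True
        have "\<bar>G x \<bullet> y\<bar> \<le> H x * N y"
          using abs_inner_le_dual_mult[of y "G x"] mult_right_mono[of "N' (G x)" "H x" "N y"] elim True
          by (simp add: inner_commute)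
        then show ?thesis using True \<phi>0 by (auto simp: abs_mult intro!: ennreal_leI mult_right_mono)
      qed simp
    qed
  qed
  also have "\<dots> = (\<integral>\<^sup>+x. ennreal (H x * N y * ?\<psi> x) \<partial>lborel)" by (rule nn_integral_completion)
  finally show ?thesis .
qed

text \<open>The segment formula is integrated against \<open>f0\<close>; exchanging x and t reduces
  the claim to \<open>integral_weak_derivative_bound\<close> for fixed t. The null set t = 0 is
  dropped to match the half-open interval of \<open>segment_average\<close>.\<close>

lemma integral_increment_bound:
  assumes wg: "has_weak_gradient C f G" and \<phi>: "test_function C \<phi>" and \<phi>0: "\<And>x. 0 \<le> \<phi> x"
    and f0i: "integrable lborel f0" and [measurable]: "H \<in> borel_measurable borel"
    and f0: "AE x in lborel. f0 x = indicator C x * f x"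
    and H: "AE x in lborel. x \<in> C \<longrightarrow> N' (G x) \<le> H x" and H0: "\<And>x. 0 \<le> H x"
    and y: "y \<in> C"
  shows "ennreal \<bar>LINT x|lborel. f0 x * (\<phi> x - \<phi> (x - y))\<bar>
    \<le> (\<integral>\<^sup>+t. indicator {0<..1} t * (\<integral>\<^sup>+x. ennreal (H x * N y * \<phi> (x - t *\<^sub>R y)) \<partial>lborel) \<partial>lborel)"
proof -
  let ?D = "\<lambda>x t. frechet_derivative \<phi> (at (x - t *\<^sub>R y)) y"
  have [measurable]: "f0 \<in> borel_measurable borel" using f0i by auto
  have Dm: "(\<lambda>z. frechet_derivative \<phi> (at z) y) \<in> borel_measurable borel"
    by (intro borel_measurable_continuous_onI test_functionD(4)[OF \<phi>])
  have [measurable]: "(\<lambda>z. ?D (fst z) (snd z)) \<in> borel_measurable (borel \<Otimes>\<^sub>M borel)"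
    by (rule measurable_compose[OF _ Dm]) measurable
  obtain B where B: "\<And>x. \<bar>frechet_derivative \<phi> (at x) y\<bar> \<le> B"
    using test_function_deriv_bounded[OF \<phi>] by metis
  have ind: "integrable lborel (indicator {0..1} :: real \<Rightarrow> real)" by (intro integrable_real_indicator) auto
  have pi: "integrable (lborel \<Otimes>\<^sub>M lborel) (\<lambda>(x, t). f0 x * (indicator {0..1} t * ?D x t))"
    using integrable_pair_bounded_factor[OF f0i ind, of "\<lambda>z. ?D (fst z) (snd z)" B] B by simp
  have "(LINT x|lborel. f0 x * (\<phi> x - \<phi> (x - y))) = (LINT x|lborel. LINT t|lborel. f0 x * (indicator {0..1} t * ?D x t))"
    by (simp add: test_function_segment[OF \<phi>])
  also have "\<dots> = (LINT t|lborel. LINT x|lborel. f0 x * (indicator {0..1} t * ?D x t))"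
    by (rule lborel_pair.Fubini_integral[OF pi, symmetric])
  finally have eq: "(LINT x|lborel. f0 x * (\<phi> x - \<phi> (x - y))) = (LINT t|lborel. LINT x|lborel. f0 x * (indicator {0..1} t * ?D x t))" .
  have "ennreal (norm (LINT t|lborel. LINT x|lborel. f0 x * (indicator {0..1} t * ?D x t)))
     \<le> (\<integral>\<^sup>+t. norm (LINT x|lborel. f0 x * (indicator {0..1} t * ?D x t)) \<partial>lborel)"
    by (rule integral_norm_bound_ennreal) (rule lborel_pair.integrable_snd[OF pi])
  also have "\<dots> \<le> (\<integral>\<^sup>+t. indicator {0<..1} t * (\<integral>\<^sup>+x. ennreal (H x * N y * \<phi> (x - t *\<^sub>R y)) \<partial>lborel) \<partial>lborel)"
  proof (rule nn_integral_mono_AE)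
    have "AE t in lborel. t \<noteq> (0::real)" by (rule AE_lborel_singleton)
    then show "AE t in lborel. ennreal (norm (LINT x|lborel. f0 x * (indicator {0..1} t * ?D x t)))
      \<le> indicator {0<..1} t * (\<integral>\<^sup>+x. ennreal (H x * N y * \<phi> (x - t *\<^sub>R y)) \<partial>lborel)"
    proof eventually_elim
      case (elim t)
      show ?case
      proof (cases "t \<in> {0..1}")
        case True
        then show ?thesis
          using integral_weak_derivative_bound[OF wg \<phi> \<phi>0 _ _ f0 H H0 y, of t] elim by simp
      qed simp
    qed
  qed
  finally show ?thesis unfolding eq by simp
qed

end

subsection \<open>Borel versions\<close>

text \<open>The data are Lebesgue measurable on C only. Translations and product integrals are
  treated for Borel functions on the whole space, extended by 0.\<close>

lemma borel_version_on:
  fixes u :: "'a::euclidean_space \<Rightarrow> real"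
  assumes \<Omega>: "\<Omega> \<in> sets borel" and u: "(\<lambda>x. indicator \<Omega> x * u x) \<in> borel_measurable lebesgue"
  obtains u0 where "u0 \<in> borel_measurable borel" "AE x in lborel. u0 x = indicator \<Omega> x * u x"
proof -
  obtain u0 where "u0 \<in> borel_measurable lborel" "AE x in lborel. indicator \<Omega> x * u x = u0 x"
    using completion_ex_borel_measurable_real[OF u] by blast
  then have "u0 \<in> borel_measurable borel" "AE x in lborel. u0 x = indicator \<Omega> x * u x"
    by (auto elim: eventually_mono)
  then show ?thesis by (rule that)
qed

text \<open>Local integrability gives measurability on compact subsets only; an exhaustion of the
  open set by such subsets yields the rest as a pointwise limit.\<close>

lemma locally_integrable_measurable:
  fixes G :: "'a::euclidean_space \<Rightarrow> 'b::{banach, second_countable_topology}"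
  assumes "open \<Omega>" "locally_integrable \<Omega> G"
  shows "(\<lambda>x. indicator \<Omega> x *\<^sub>R G x) \<in> borel_measurable lebesgue"
proof (rule open_Union_compact_subsets[OF assms(1)])
  fix S :: "nat \<Rightarrow> 'a set"
  assume S: "\<And>n. compact (S n)" "\<And>n. S n \<subseteq> \<Omega>"
    and exhaust: "\<And>K. compact K \<Longrightarrow> K \<subseteq> \<Omega> \<Longrightarrow> \<exists>k. \<forall>n\<ge>k. K \<subseteq> S n"
  show ?thesis
  proof (rule borel_measurable_LIMSEQ_metric)
    show "(\<lambda>x. indicator (S n) x *\<^sub>R G x) \<in> borel_measurable lebesgue" for n
      using locally_integrableD[OF assms(2) S] by (simp add: set_integrable_def)
    show "(\<lambda>n. indicator (S n) x *\<^sub>R G x) \<longlonglongrightarrow> indicator \<Omega> x *\<^sub>R G x" for x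
    proof (cases "x \<in> \<Omega>")
      case True
      then obtain k where "\<forall>n\<ge>k. {x} \<subseteq> S n" using exhaust[of "{x}"] by auto
      then have "indicator (S n) x *\<^sub>R G x = indicator \<Omega> x *\<^sub>R G x" if "n \<ge> k" for n
        using True that by (auto simp: indicator_def)
      then show ?thesis by (intro tendsto_eventually eventually_sequentiallyI)
    next
      case False
      then have "x \<notin> S n" for n using S(2) by blast
      then show ?thesis using False by simp
    qed
  qed
qed

lemma Lp_norm_lebesgue_on:
  fixes u u0 :: "'a::euclidean_space \<Rightarrow> real"
  assumes \<Omega>: "\<Omega> \<in> sets borel" and u: "(\<lambda>x. indicator \<Omega> x * u x) \<in> borel_measurable lebesgue"
    and u0[measurable]: "u0 \<in> borel_measurable borel" and ae: "AE x in lborel. u0 x = indicator \<Omega> x * u x"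
    and p: "p \<noteq> 0"
  shows "Lp_norm p (lebesgue_on \<Omega>) u = Lp_norm p lborel u0"
proof -
  have \<Omega>l: "\<Omega> \<inter> space lebesgue \<in> sets lebesgue" using \<Omega> by simp
  have um: "u \<in> borel_measurable (lebesgue_on \<Omega>)"
    using u by (subst borel_measurable_restrict_space_iff[OF \<Omega>l]) simp
  show ?thesis
  proof (cases "p = \<infinity>")
    case True
    have "(AE x in lebesgue_on \<Omega>. ennreal \<bar>u x\<bar> \<le> z) \<longleftrightarrow> (AE x in lborel. ennreal \<bar>u0 x\<bar> \<le> z)" for z
    proof -
      have "(AE x in lebesgue_on \<Omega>. ennreal \<bar>u x\<bar> \<le> z) \<longleftrightarrow> (AE x in lborel. x \<in> \<Omega> \<longrightarrow> ennreal \<bar>u x\<bar> \<le> z)"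
        by (simp add: AE_restrict_space_iff[OF \<Omega>l] AE_completion_iff)
      also have "\<dots> \<longleftrightarrow> (AE x in lborel. ennreal \<bar>u0 x\<bar> \<le> z)"
        using ae by (intro iffI; elim AE_mp; intro AE_I2; auto simp: indicator_def)
      finally show ?thesis .
    qed
    moreover have "(\<lambda>x. ennreal \<bar>u x\<bar>) \<in> borel_measurable (lebesgue_on \<Omega>)" using um by measurable
    moreover have "(\<lambda>x. ennreal \<bar>u0 x\<bar>) \<in> borel_measurable lborel" by measurable
    ultimately show ?thesis using True by (simp add: Lp_norm_def esssup_eq_AE)
  next
    case False
    have "(\<integral>\<^sup>+x. ennreal (\<bar>u x\<bar> powr enn2real p) \<partial>lebesgue_on \<Omega>)
        = (\<integral>\<^sup>+x. ennreal (\<bar>u x\<bar> powr enn2real p) * indicator \<Omega> x \<partial>lborel)"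
      by (simp add: nn_integral_restrict_space[OF \<Omega>l] nn_integral_completion)
    also have "\<dots> = (\<integral>\<^sup>+x. ennreal (\<bar>u0 x\<bar> powr enn2real p) \<partial>lborel)"
    proof (rule nn_integral_cong_AE)
      show "AE x in lborel. ennreal (\<bar>u x\<bar> powr enn2real p) * indicator \<Omega> x = ennreal (\<bar>u0 x\<bar> powr enn2real p)"
        using ae by eventually_elim (auto simp: indicator_def)
    qed
    finally show ?thesis using False by (simp add: Lp_norm_def)
  qed
qed

context cone_body
begin

lemma dual_gradient_measurable:
  assumes "has_weak_gradient C f G"
  shows "(\<lambda>x. indicator C x * N' (G x)) \<in> borel_measurable lebesgue"
proof -
  have "(\<lambda>x. indicator C x *\<^sub>R G x) \<in> borel_measurable lebesgue"
    using assms by (intro locally_integrable_measurable open_C) (simp add: has_weak_gradient_def)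
  then have "(\<lambda>x. N' (indicator C x *\<^sub>R G x)) \<in> borel_measurable lebesgue" by measurable
  then show ?thesis by (simp add: dual_scaleR)
qed

lemma integrable_lebesgue_onD:
  fixes f :: "'a \<Rightarrow> real"
  assumes "integrable (lebesgue_on C) f"
  shows "integrable lebesgue (\<lambda>x. indicator C x * f x)"
  using assms by (subst (asm) integrable_restrict_space) auto

lemma density_borel_version:
  assumes "has_RN_deriv C \<nu> f"
  obtains f0 where "integrable lborel f0" "AE x in lborel. f0 x = indicator C x * f x"
proof -
  have fi: "integrable lebesgue (\<lambda>x. indicator C x * f x)"
    using assms by (intro integrable_lebesgue_onD) (simp add: has_RN_deriv_def)
  obtain f0 where f0: "f0 \<in> borel_measurable borel" "AE x in lborel. f0 x = indicator C x * f x"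
    by (rule borel_version_on[OF C_sets borel_measurable_integrable[OF fi]])
  have "integrable lebesgue f0"
    by (rule integrable_cong_AE_imp[OF fi]) (use f0 AE_completion[OF f0(2)] in \<open>auto intro: measurable_completion elim: eventually_mono\<close>)
  then have "integrable lborel f0" using f0(1) by (simp add: integrable_completion)
  then show ?thesis using that f0 by blast
qed

text \<open>As x + \<open>E h\<close> stays inside C, the density can be replaced there by its Borel
  version and the integral moved back to \<open>E h\<close>.\<close>

lemma charge_translate:
  assumes \<nu>: "has_RN_deriv C \<nu> f" and f0: "f0 \<in> borel_measurable borel" "AE x in lborel. f0 x = indicator C x * f x"
    and x: "x \<in> C" and h: "h > 0"
  shows "\<nu> ((+) x ` E h) = (LINT y|lborel. indicator (E h) y * f0 (x + y))"
proof -
  let ?A = "(+) x ` E h"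
  have "open ?A" using open_E[OF h] by (rule open_translation)
  then have A: "?A \<in> sets borel" by simp
  have AC: "?A \<subseteq> C" using C_add[OF x] by auto
  note [measurable] = A f0(1)
  have "?A \<in> sets (lebesgue_on C)" using A AC by (simp add: sets_restrict_space_iff)
  then have "\<nu> ?A = (LINT z|lebesgue_on C. indicator ?A z *\<^sub>R f z)"
    using \<nu> by (simp add: has_RN_deriv_def set_lebesgue_integral_def)
  also have "\<dots> = (LINT z|lebesgue. indicator C z *\<^sub>R (indicator ?A z *\<^sub>R f z))"
    by (rule integral_restrict_space) simp
  also have "\<dots> = (LINT z|lebesgue. indicator ?A z * f0 z)"
  proof (rule integral_cong_AE)
    have "(\<lambda>z. indicator ?A z * f0 z) \<in> borel_measurable borel" by measurable
    then show *: "(\<lambda>z. indicator ?A z * f0 z) \<in> borel_measurable lebesgue" by (intro measurable_completion) simp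
    have fi: "integrable lebesgue (\<lambda>x. indicator C x * f x)"
      using \<nu> by (intro integrable_lebesgue_onD) (simp add: has_RN_deriv_def)
    have "(\<lambda>z. indicator ?A z * (indicator C z * f z)) \<in> borel_measurable lebesgue"
      using A by (intro borel_measurable_times borel_measurable_integrable[OF fi] borel_measurable_indicator) simp
    then show "(\<lambda>z. indicator C z *\<^sub>R (indicator ?A z *\<^sub>R f z)) \<in> borel_measurable lebesgue"
      by (simp add: mult_ac)
    show "AE z in lebesgue. indicator C z *\<^sub>R (indicator ?A z *\<^sub>R f z) = indicator ?A z * f0 z"
      using AE_completion[OF f0(2)] by eventually_elim simp
  qed
  also have "\<dots> = (LINT z|lborel. indicator ?A z * f0 z)"
    by (rule integral_completion) measurable
  also have "\<dots> = (LINT y|lborel. indicator ?A (y + x) * f0 (y + x))"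
    by (rule integral_lborel_translate[symmetric]) measurable
  also have "(\<lambda>y. indicator ?A (y + x) * f0 (y + x)) = (\<lambda>y. indicator (E h) y * f0 (x + y))"
    by (auto simp: indicator_def fun_eq_iff add.commute image_iff)
  finally show ?thesis .
qed

end

section \<open>Averaging over translated sections\<close>

context extremal_problem
begin

lemma p_nonzero: "p \<noteq> 0"
  using dim_less_p by auto

text \<open>Let a be the integral of f times \<phi>, and b(y) the same with \<phi> translated by y.
  The mean of a - b(y) over \<open>E h\<close> is controlled by the gradient, while the integral of
  b over \<open>E h\<close> is that of \<phi>(x) times the charge of x + \<open>E h\<close>. The two
  parts add up to the bound on a.\<close>

lemma test_inequality:
  assumes h: "h > 0" and wg: "has_weak_gradient C f G" and \<phi>: "test_function C \<phi>" and \<phi>0: "\<And>x. 0 \<le> \<phi> x"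
    and f0i: "integrable lborel f0" and [measurable]: "H \<in> borel_measurable borel"
    and f0: "AE x in lborel. f0 x = indicator C x * f x"
    and H: "AE x in lborel. x \<in> C \<longrightarrow> N' (G x) \<le> H x" and H0: "\<And>x. 0 \<le> H x"
    and L: "Lp_norm p lborel H = ennreal L" "L \<ge> 0"
    and V: "V \<ge> 0" "\<And>x. x \<in> C \<Longrightarrow> \<bar>LINT y|lborel. indicator (E h) y * f0 (x + y)\<bar> \<le> V"
  shows "\<bar>LINT x|lborel. f0 x * \<phi> x\<bar> \<le> (I h powr (1 - r) * L + V / (m * h ^ DIM('a))) * (LINT x|lborel. \<phi> x)"
proof -
  note [measurable] = E_sets[OF h]
  define mu where "mu = m * h ^ DIM('a)"
  have mu: "mu > 0" using m_pos h by (simp add: mu_def)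
  have [measurable]: "f0 \<in> borel_measurable borel" "\<phi> \<in> borel_measurable borel"
    using f0i test_function_measurable[OF \<phi>] by auto
  obtain B where B: "\<And>x. \<bar>\<phi> x\<bar> \<le> B" "B \<ge> 0" using test_function_bounded[OF \<phi>] by metis
  have \<phi>i: "integrable lborel \<phi>"
  proof (rule Bochner_Integration.integrable_bound)
    show "integrable lborel (\<lambda>x. B * indicator (test_support \<phi>) x)"
      using test_functionD(1)[OF \<phi>] emeasure_compact_finite[of "test_support \<phi>"]
      by (intro integrable_mult_right integrable_real_indicator) (simp_all add: compact_imp_closed)
    show "AE x in lborel. norm (\<phi> x) \<le> norm (B * indicator (test_support \<phi>) x)"
      using B test_function_outside[of _ \<phi>] by (auto simp: indicator_def)
  qed measurable
  define \<Phi> where "\<Phi> = (LINT x|lborel. \<phi> x)"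
  have \<Phi>: "\<Phi> \<ge> 0" "(\<integral>\<^sup>+x. ennreal (\<phi> x) \<partial>lborel) = ennreal \<Phi>"
    using \<phi>i \<phi>0 by (auto simp: \<Phi>_def nn_integral_eq_integral)
  have fB: "integrable lborel (\<lambda>x. f0 x * \<phi> (x - y))" for y
  proof (rule Bochner_Integration.integrable_bound)
    show "integrable lborel (\<lambda>x. f0 x * B)" using f0i by (rule integrable_mult_left)
    show "AE x in lborel. norm (f0 x * \<phi> (x - y)) \<le> norm (f0 x * B)"
      using B by (intro AE_I2) (simp add: abs_mult mult_left_mono)
  qed measurable
  define a where "a = (LINT x|lborel. f0 x * \<phi> x)"
  define b where "b y = (LINT x|lborel. f0 x * \<phi> (x - y))" for y
  have indE: "integrable lborel (indicator (E h) :: 'a \<Rightarrow> real)"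
    by (rule integrable_real_indicator) (auto simp: emeasure_E[OF h])
  have muE: "(LINT y|lborel. indicator (E h) y) = mu"
    using emeasure_E[OF h] mu by (simp add: measure_def mu_def)
  have pi: "integrable (lborel \<Otimes>\<^sub>M lborel) (\<lambda>(x, y). f0 x * (indicator (E h) y * \<phi> (x - y)))"
    using integrable_pair_bounded_factor[OF f0i indE, of "\<lambda>z. \<phi> (fst z - snd z)" B] B by simp
  have inner: "(LINT x|lborel. f0 x * (indicator (E h) y * \<phi> (x - y))) = indicator (E h) y * b y" for y
    unfolding b_def by (subst integral_mult_right_zero[symmetric]) (simp add: mult_ac)
  have bi: "integrable lborel (\<lambda>y. indicator (E h) y * b y)"
    using lborel_pair.integrable_snd[OF pi] by (simp only: inner)

  \<comment> \<open>Here x has been replaced by x + t y, so that \<phi> depends on neither y nor t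
    and only \<open>H\<close> is averaged along segments.\<close>
  let ?k = "\<lambda>(t::real) y x. indicator (E h) y * (indicator {0<..1} t * ennreal (H (x + t *\<^sub>R y) * N y * \<phi> x))"
  let ?J = "\<lambda>x t. \<integral>\<^sup>+y. ennreal (H (x + t *\<^sub>R y) * N y) * indicator (E h) y \<partial>lborel"
  have part1: "\<bar>a * mu - (LINT y|lborel. indicator (E h) y * b y)\<bar> \<le> mu * (I h powr (1 - r) * L) * \<Phi>"
  proof -
    have ai: "integrable lborel (\<lambda>y. a * indicator (E h) y)" using indE by (rule integrable_mult_right)
    have di: "integrable lborel (\<lambda>y. indicator (E h) y * (a - b y))"
      using Bochner_Integration.integrable_diff[OF ai bi] by (simp add: algebra_simps)
    have "a * mu - (LINT y|lborel. indicator (E h) y * b y) = (LINT y|lborel. a * indicator (E h) y - indicator (E h) y * b y)"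
      unfolding Bochner_Integration.integral_diff[OF ai bi] by (simp only: integral_mult_right_zero muE)
    also have "\<dots> = (LINT y|lborel. indicator (E h) y * (a - b y))" by (simp add: algebra_simps)
    finally have "ennreal \<bar>a * mu - (LINT y|lborel. indicator (E h) y * b y)\<bar>
        = ennreal (norm (LINT y|lborel. indicator (E h) y * (a - b y)))" by simp
    also have "\<dots> \<le> (\<integral>\<^sup>+y. norm (indicator (E h) y * (a - b y)) \<partial>lborel)"
      by (rule integral_norm_bound_ennreal[OF di])
    also have "\<dots> \<le> (\<integral>\<^sup>+y. \<integral>\<^sup>+t. \<integral>\<^sup>+x. ?k t y x \<partial>lborel \<partial>lborel \<partial>lborel)"
    proof (rule nn_integral_mono)
      fix y
      show "ennreal (norm (indicator (E h) y * (a - b y)))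
        \<le> (\<integral>\<^sup>+t. \<integral>\<^sup>+x. ?k t y x \<partial>lborel \<partial>lborel)"
      proof (cases "y \<in> E h")
        case True
        then have y: "y \<in> C" by simp
        have "a - b y = (LINT x|lborel. f0 x * \<phi> x - f0 x * \<phi> (x - y))"
          unfolding a_def b_def using fB[of 0] fB[of y] by (subst Bochner_Integration.integral_diff) auto
        then have "ennreal (norm (indicator (E h) y * (a - b y))) = ennreal \<bar>LINT x|lborel. f0 x * (\<phi> x - \<phi> (x - y))\<bar>"
          using True by (simp add: algebra_simps)
        also have "\<dots> \<le> (\<integral>\<^sup>+t. indicator {0<..1} t * (\<integral>\<^sup>+x. ennreal (H x * N y * \<phi> (x - t *\<^sub>R y)) \<partial>lborel) \<partial>lborel)"
          by (rule integral_increment_bound[OF wg \<phi> \<phi>0 f0i _ f0 H H0 y]) measurable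
        also have "\<dots> = (\<integral>\<^sup>+t. \<integral>\<^sup>+x. ?k t y x \<partial>lborel \<partial>lborel)"
        proof (rule nn_integral_cong)
          fix t :: real
          have "(\<integral>\<^sup>+x. ennreal (H (x + t *\<^sub>R y) * N y * \<phi> ((x + t *\<^sub>R y) - t *\<^sub>R y)) \<partial>lborel)
              = (\<integral>\<^sup>+x. ennreal (H x * N y * \<phi> (x - t *\<^sub>R y)) \<partial>lborel)"
            by (rule nn_integral_lborel_translate) measurable
          then show "indicator {0<..1} t * (\<integral>\<^sup>+x. ennreal (H x * N y * \<phi> (x - t *\<^sub>R y)) \<partial>lborel)
            = (\<integral>\<^sup>+x. ?k t y x \<partial>lborel)"
            using True by (simp add: nn_integral_cmult)
        qed
        finally show ?thesis .
      qed simp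
    qed
    \<comment> \<open>Three exchanges put x outermost and y innermost, the order in which
      \<open>segment_average\<close> applies at fixed x.\<close>
    also have "\<dots> = (\<integral>\<^sup>+t. \<integral>\<^sup>+y. \<integral>\<^sup>+x. ?k t y x \<partial>lborel \<partial>lborel \<partial>lborel)"
      by (rule lborel_pair.Fubini') measurable
    also have "\<dots> = (\<integral>\<^sup>+t. \<integral>\<^sup>+x. \<integral>\<^sup>+y. ?k t y x \<partial>lborel \<partial>lborel \<partial>lborel)"
      by (intro nn_integral_cong lborel_pair.Fubini') measurable
    also have "\<dots> = (\<integral>\<^sup>+x. \<integral>\<^sup>+t. \<integral>\<^sup>+y. ?k t y x \<partial>lborel \<partial>lborel \<partial>lborel)"
      by (rule lborel_pair.Fubini') measurable
    also have "\<dots> \<le> (\<integral>\<^sup>+x. ennreal (mu * (L * I h powr (1 - r))) * ennreal (\<phi> x) \<partial>lborel)"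
    proof (rule nn_integral_mono)
      fix x
      have "(\<integral>\<^sup>+t. \<integral>\<^sup>+y. ?k t y x \<partial>lborel \<partial>lborel)
        = (\<integral>\<^sup>+t. ennreal (\<phi> x) * (indicator {0<..1} t * ?J x t) \<partial>lborel)"
      proof (rule nn_integral_cong)
        fix t :: real
        have "?k t y x
          = (ennreal (\<phi> x) * indicator {0<..1} t) * (ennreal (H (x + t *\<^sub>R y) * N y) * indicator (E h) y)" for y
          using H0 \<phi>0 by (simp add: ennreal_mult'' mult_ac)
        then show "(\<integral>\<^sup>+y. ?k t y x \<partial>lborel)
          = ennreal (\<phi> x) * (indicator {0<..1} t * ?J x t)"
          by (simp only:) (subst nn_integral_cmult; simp add: mult_ac)
      qed
      also have "\<dots> = ennreal (\<phi> x) * (\<integral>\<^sup>+t. indicator {0<..1} t * ?J x t \<partial>lborel)"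
        by (rule nn_integral_cmult) measurable
      also have "\<dots> = ennreal (\<phi> x) * (ennreal mu * (\<integral>\<^sup>+z. ennreal (H (x + z) * g h (N z)) * indicator (E h) z \<partial>lborel))"
        unfolding mu_def by (subst segment_average[OF h _ H0]) auto
      also have "\<dots> \<le> ennreal (\<phi> x) * (ennreal mu * ennreal (L * I h powr (1 - r)))"
        by (intro mult_left_mono Hoelder_kernel[OF h _ H0 L]) auto
      also have "\<dots> = ennreal (mu * (L * I h powr (1 - r))) * ennreal (\<phi> x)"
        unfolding ennreal_mult'[OF less_imp_le[OF mu]] by (simp only: mult_ac)
      finally show "(\<integral>\<^sup>+t. \<integral>\<^sup>+y. ?k t y x \<partial>lborel \<partial>lborel)
        \<le> ennreal (mu * (L * I h powr (1 - r))) * ennreal (\<phi> x)" .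
    qed
    also have "\<dots> = ennreal (mu * (L * I h powr (1 - r))) * ennreal \<Phi>"
      using \<Phi>(2) by (subst nn_integral_cmult) auto
    also have "\<dots> = ennreal (mu * (I h powr (1 - r) * L) * \<Phi>)"
      unfolding ennreal_mult''[OF \<Phi>(1), symmetric] by (simp only: mult_ac)
    finally show ?thesis
      using mu L(2) \<Phi>(1) by (subst (asm) ennreal_le_iff) auto
  qed

  let ?l = "\<lambda>x y. \<phi> x * (indicator (E h) y * f0 (x + y))"
  \<comment> \<open>Only points x in C contribute, since \<phi> vanishes elsewhere; there the inner
    integral is a charge bounded by \<open>V\<close>.\<close>
  have part2: "\<bar>LINT y|lborel. indicator (E h) y * b y\<bar> \<le> V * \<Phi>"
  proof -
    have pi2: "integrable (lborel \<Otimes>\<^sub>M lborel) (\<lambda>(x, y). ?l x y)"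
    proof (rule integrableI_bounded)
      have "(\<integral>\<^sup>+z. ennreal (norm (case z of (x, y) \<Rightarrow> ?l x y)) \<partial>(lborel \<Otimes>\<^sub>M lborel))
        = (\<integral>\<^sup>+x. \<integral>\<^sup>+y. ennreal (norm (?l x y)) \<partial>lborel \<partial>lborel)"
        by (subst lborel.nn_integral_fst[symmetric]) auto
      also have "\<dots> \<le> (\<integral>\<^sup>+x. ennreal (\<phi> x) * (\<integral>\<^sup>+y. ennreal (norm (f0 y)) \<partial>lborel) \<partial>lborel)"
      proof (rule nn_integral_mono)
        fix x
        have "(\<integral>\<^sup>+y. ennreal (norm (?l x y)) \<partial>lborel)
          \<le> (\<integral>\<^sup>+y. ennreal (\<phi> x) * ennreal (norm (f0 (y + x))) \<partial>lborel)"
          using \<phi>0 by (intro nn_integral_mono) (auto simp: abs_mult indicator_def ennreal_mult' add.commute)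
        also have "\<dots> = ennreal (\<phi> x) * (\<integral>\<^sup>+y. ennreal (norm (f0 (y + x))) \<partial>lborel)"
          by (rule nn_integral_cmult) measurable
        also have "(\<integral>\<^sup>+y. ennreal (norm (f0 (y + x))) \<partial>lborel) = (\<integral>\<^sup>+y. ennreal (norm (f0 y)) \<partial>lborel)"
          by (rule nn_integral_lborel_translate) measurable
        finally show "(\<integral>\<^sup>+y. ennreal (norm (?l x y)) \<partial>lborel)
          \<le> ennreal (\<phi> x) * (\<integral>\<^sup>+y. ennreal (norm (f0 y)) \<partial>lborel)" .
      qed
      also have "\<dots> = ennreal \<Phi> * (\<integral>\<^sup>+y. ennreal (norm (f0 y)) \<partial>lborel)"
        by (simp add: nn_integral_multc \<Phi>(2))
      also have "\<dots> < \<infinity>"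
        using f0i by (auto simp: integrable_iff_bounded ennreal_mult_less_top)
      finally show "(\<integral>\<^sup>+z. ennreal (norm (case z of (x, y) \<Rightarrow> ?l x y)) \<partial>(lborel \<Otimes>\<^sub>M lborel)) < \<infinity>" .
    qed measurable
    have shift: "indicator (E h) y * b y = (LINT x|lborel. ?l x y)" for y
    proof -
      have "b y = (LINT x|lborel. f0 (x + y) * \<phi> (x + y - y))"
        unfolding b_def by (rule integral_lborel_translate[symmetric]) measurable
      then have b_eq: "b y = (LINT x|lborel. f0 (x + y) * \<phi> x)" by simp
      have "indicator (E h) y * b y = (LINT x|lborel. indicator (E h) y * (f0 (x + y) * \<phi> x))"
        unfolding b_eq by (rule integral_mult_right_zero[symmetric])
      then show ?thesis by (simp only: mult_ac)
    qed
    let ?\<nu> = "\<lambda>x. LINT y|lborel. indicator (E h) y * f0 (x + y)"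
    have pull: "(LINT y|lborel. ?l x y) = \<phi> x * ?\<nu> x" for x
      by (rule integral_mult_right_zero)
    have "(LINT y|lborel. indicator (E h) y * b y) = (LINT y|lborel. LINT x|lborel. ?l x y)"
      by (simp only: shift)
    also have "\<dots> = (LINT x|lborel. LINT y|lborel. ?l x y)"
      by (rule lborel_pair.Fubini_integral[OF pi2])
    finally have eq: "(LINT y|lborel. indicator (E h) y * b y) = (LINT x|lborel. \<phi> x * ?\<nu> x)"
      by (simp only: pull)
    have ii: "integrable lborel (\<lambda>x. \<phi> x * ?\<nu> x)"
      using lborel_pair.integrable_fst[OF pi2] by (simp only: pull)
    have "\<bar>LINT x|lborel. \<phi> x * ?\<nu> x\<bar> \<le> (LINT x|lborel. norm (\<phi> x * ?\<nu> x))"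
      using integral_norm_bound[of lborel "\<lambda>x. \<phi> x * ?\<nu> x"] by simp
    also have "\<dots> \<le> (LINT x|lborel. V * \<phi> x)"
    proof (rule integral_mono)
      show "integrable lborel (\<lambda>x. norm (\<phi> x * ?\<nu> x))" using ii by (rule integrable_norm)
      show "integrable lborel (\<lambda>x. V * \<phi> x)" using \<phi>i by (rule integrable_mult_right)
      fix x
      show "norm (\<phi> x * ?\<nu> x) \<le> V * \<phi> x"
      proof (cases "x \<in> C")
        case True
        then show ?thesis using mult_left_mono[OF V(2)[OF True] \<phi>0[of x]] \<phi>0[of x] by (simp add: abs_mult mult.commute)
      next
        case False
        then have "\<phi> x = 0" using test_functionD(2)[OF \<phi>] test_function_outside[of x \<phi>] by blast
        then show ?thesis by simp
      qed
    qed
    finally show ?thesis unfolding eq by (simp add: \<Phi>_def)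
  qed

  have "\<bar>a * mu\<bar> \<le> mu * (I h powr (1 - r) * L) * \<Phi> + V * \<Phi>" using part1 part2 by linarith
  then have "\<bar>a\<bar> * mu \<le> (mu * (I h powr (1 - r) * L) + V) * \<Phi>" using mu by (simp add: abs_mult algebra_simps)
  then have "\<bar>a\<bar> \<le> (mu * (I h powr (1 - r) * L) + V) * \<Phi> / mu" using mu by (simp add: pos_le_divide_eq)
  also have "\<dots> = (I h powr (1 - r) * L + V / mu) * \<Phi>" using mu by (simp add: field_simps)
  finally show ?thesis by (simp add: a_def mu_def \<Phi>_def)
qed

text \<open>The tested estimate has the same constant c for every nonnegative test function and is
  two-sided, so \<open>AE_le_of_test_functions\<close> bounds both f and -f by c almost everywhere.
  If the gradient norm is infinite, so is the right-hand side, because its coefficient is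
  positive.\<close>

lemma additive_inequality:
  assumes h: "h > 0" and \<nu>: "charge_norm_h C K h \<nu> < \<infinity>" "has_RN_deriv C \<nu> f" and wg: "has_weak_gradient C f G"
  shows "Lp_norm \<infinity> (lebesgue_on C) f
    \<le> ennreal (I h powr (1 - r)) * Lp_norm p (lebesgue_on C) (\<lambda>x. N' (G x))
      + ennreal (m powr (-1) * h powr (- real DIM('a))) * charge_norm_h C K h \<nu>"
proof (cases "Lp_norm p (lebesgue_on C) (\<lambda>x. N' (G x)) = \<infinity>")
  case True
  then show ?thesis using I_pos[OF h] by (simp add: ennreal_mult_top)
next
  case False
  obtain f0 where f0: "integrable lborel f0" "AE x in lborel. f0 x = indicator C x * f x"
    by (rule density_borel_version[OF \<nu>(2)])
  obtain H1 where H1: "H1 \<in> borel_measurable borel" "AE x in lborel. H1 x = indicator C x * N' (G x)"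
    by (rule borel_version_on[OF C_sets dual_gradient_measurable[OF wg]])
  \<comment> \<open>The absolute value makes \<open>H\<close> nonnegative everywhere and changes it
    only on a null set.\<close>
  define H where "H x = \<bar>H1 x\<bar>" for x
  have Hm: "H \<in> borel_measurable borel" unfolding H_def using H1(1) by measurable
  have H: "AE x in lborel. H x = indicator C x * N' (G x)"
    using H1(2) by eventually_elim (simp add: H_def)
  have Lp: "Lp_norm p (lebesgue_on C) (\<lambda>x. N' (G x)) = Lp_norm p lborel H"
    by (rule Lp_norm_lebesgue_on[OF C_sets dual_gradient_measurable[OF wg] Hm H p_nonzero])
  define L where "L = enn2real (Lp_norm p lborel H)"
  have L: "Lp_norm p lborel H = ennreal L" "L \<ge> 0"
    using False Lp by (auto simp: L_def less_top)
  define V where "V = enn2real (charge_norm_h C K h \<nu>)"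
  have V: "charge_norm_h C K h \<nu> = ennreal V" "V \<ge> 0" using \<nu>(1) by (auto simp: V_def)
  have Vb: "\<bar>LINT y|lborel. indicator (E h) y * f0 (x + y)\<bar> \<le> V" if "x \<in> C" for x
  proof -
    have "ennreal \<bar>\<nu> ((+) x ` E h)\<bar> \<le> ennreal V"
      unfolding V(1)[symmetric] charge_norm_h_def using that by (intro SUP_upper) auto
    then show ?thesis
      using V(2) charge_translate[OF \<nu>(2) _ f0(2) that h] f0(1) by simp
  qed
  define c where "c = I h powr (1 - r) * L + V / (m * h ^ DIM('a))"
  have c0: "c \<ge> 0" using L(2) V(2) m_pos h by (simp add: c_def)
  have HG: "AE x in lborel. x \<in> C \<longrightarrow> N' (G x) \<le> H x" using H by eventually_elim simp
  have H0: "0 \<le> H x" for x by (simp add: H_def)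
  have test: "\<bar>LINT x:C|lebesgue. f x * \<phi> x\<bar> \<le> c * (LINT x|lebesgue. \<phi> x)"
    if \<phi>: "test_function C \<phi>" "\<And>x. 0 \<le> \<phi> x" for \<phi>
  proof -
    note [measurable] = test_function_measurable[OF \<phi>(1)]
    have [measurable]: "f0 \<in> borel_measurable borel" using f0(1) by auto
    have "(LINT x:C|lebesgue. f x * \<phi> x) = (LINT x|lebesgue. f0 x * \<phi> x)"
      unfolding set_lebesgue_integral_def
    proof (rule integral_cong_AE)
      show "(\<lambda>x. f0 x * \<phi> x) \<in> borel_measurable lebesgue" by (rule measurable_completion) measurable
      show "AE x in lebesgue. indicator C x *\<^sub>R (f x * \<phi> x) = f0 x * \<phi> x"
        using AE_completion[OF f0(2)] by eventually_elim simp
      have "\<phi> \<in> borel_measurable lebesgue" by (rule measurable_completion) measurable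
      then have "(\<lambda>x. (indicator C x * f x) * \<phi> x) \<in> borel_measurable lebesgue"
        using \<nu>(2) by (intro borel_measurable_times borel_measurable_integrable[OF integrable_lebesgue_onD]) (simp_all add: has_RN_deriv_def)
      then show "(\<lambda>x. indicator C x *\<^sub>R (f x * \<phi> x)) \<in> borel_measurable lebesgue" by (simp add: mult_ac)
    qed
    also have "\<dots> = (LINT x|lborel. f0 x * \<phi> x)" by (rule integral_completion) measurable
    finally have "\<bar>LINT x:C|lebesgue. f x * \<phi> x\<bar> = \<bar>LINT x|lborel. f0 x * \<phi> x\<bar>" by simp
    also have "\<dots> \<le> c * (LINT x|lborel. \<phi> x)"
      unfolding c_def by (rule test_inequality[OF h wg \<phi> f0(1) Hm f0(2) HG H0 L V(2) Vb])
    also have "(LINT x|lborel. \<phi> x) = (LINT x|lebesgue. \<phi> x)" by (rule integral_completion[symmetric]) measurable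
    finally show ?thesis .
  qed
  have lf: "locally_integrable C f" using wg by (simp add: has_weak_gradient_def)
  have lf': "locally_integrable C (\<lambda>x. - f x)" using lf by (auto simp: locally_integrable_def set_integrable_def)
  have "AE x in lebesgue. x \<in> C \<longrightarrow> f x \<le> c"
    by (rule AE_le_of_test_functions[OF open_C lf]) (use test in fastforce)
  moreover have "AE x in lebesgue. x \<in> C \<longrightarrow> - f x \<le> c"
  proof (rule AE_le_of_test_functions[OF open_C lf'])
    fix \<phi> :: "'a \<Rightarrow> real" assume \<phi>: "test_function C \<phi>" "\<And>x. 0 \<le> \<phi> x"
    have "(LINT x:C|lebesgue. - f x * \<phi> x) = - (LINT x:C|lebesgue. f x * \<phi> x)"
      unfolding set_lebesgue_integral_def by (simp flip: integral_minus)
    then show "(LINT x:C|lebesgue. - f x * \<phi> x) \<le> c * (LINT x|lebesgue. \<phi> x)"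
      using test[OF \<phi>] by linarith
  qed
  ultimately have "AE x in lebesgue. x \<in> C \<longrightarrow> ennreal \<bar>f x\<bar> \<le> ennreal c"
    by eventually_elim (auto intro!: ennreal_leI)
  then have "AE x in lebesgue_on C. ennreal \<bar>f x\<bar> \<le> ennreal c"
    by (subst AE_restrict_space_iff) auto
  moreover have "(\<lambda>x. ennreal \<bar>f x\<bar>) \<in> borel_measurable (lebesgue_on C)"
    using \<nu>(2) by (auto simp: has_RN_deriv_def)
  ultimately have "Lp_norm \<infinity> (lebesgue_on C) f \<le> ennreal c"
    unfolding Lp_norm_def by (simp add: esssup_I)
  also have "\<dots> = ennreal (I h powr (1 - r)) * ennreal L + ennreal (m powr (-1) * h powr (- real DIM('a))) * ennreal V"
  proof -
    have V_eq: "V / (m * h ^ DIM('a)) = (m powr (-1) * h powr (- real DIM('a))) * V"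
      using m_pos h by (simp add: powr_minus_divide powr_realpow)
    have sum_eq: "ennreal (s * L + t * V) = ennreal s * ennreal L + ennreal t * ennreal V" if "0 \<le> s" "0 \<le> t" for s t
      using that L(2) V(2) by (simp add: ennreal_mult)
    show ?thesis unfolding c_def V_eq by (rule sum_eq) simp_all
  qed
  finally show ?thesis unfolding Lp L(1) V(1) .
qed

end

subsection \<open>Weak derivatives as limits of difference quotients\<close>

lemma integrable_continuous_compact_support:
  fixes \<psi> :: "'a::euclidean_space \<Rightarrow> real"
  assumes \<psi>: "continuous_on UNIV \<psi>" and S: "compact S" "\<And>x. x \<notin> S \<Longrightarrow> \<psi> x = 0"
  shows "integrable lborel \<psi>"
proof -
  obtain B where B: "B \<ge> 0" "\<And>x. \<bar>\<psi> x\<bar> \<le> B"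
    using bounded_if_compactly_supported[OF \<psi> S] by metis
  show ?thesis
  proof (rule Bochner_Integration.integrable_bound)
    show "integrable lborel (\<lambda>x. B * indicator S x)"
      using S(1) emeasure_compact_finite[of S]
      by (intro integrable_mult_right integrable_real_indicator) (simp_all add: compact_imp_closed)
    show "AE x in lborel. norm (\<psi> x) \<le> norm (B * indicator S x)"
      using B S(2) by (intro AE_I2) (simp add: indicator_def)
    show "\<psi> \<in> borel_measurable lborel" using borel_measurable_continuous_onI[OF \<psi>] by simp
  qed
qed

lemma filterlim_inverse_Suc_at_0: "filterlim (\<lambda>n. 1 / real (Suc n)) (at 0) sequentially"
  using LIMSEQ_inverse_real_of_nat by (auto simp: filterlim_at inverse_eq_divide)

text \<open>Dominates the difference quotients of \<phi> uniformly in the step.\<close>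

lemma test_function_increment_bound:
  assumes \<phi>: "test_function \<Omega> \<phi>" and B: "\<And>x. \<bar>frechet_derivative \<phi> (at x) v\<bar> \<le> B" and s: "s \<ge> 0"
  shows "\<bar>\<phi> x - \<phi> (x - s *\<^sub>R v)\<bar> \<le> s * B"
proof -
  have lin: "frechet_derivative \<phi> (at z) (s *\<^sub>R v) = s * frechet_derivative \<phi> (at z) v" for z
    using linear_cmul[OF has_derivative_linear[OF test_functionD(3)[OF \<phi>]]] by simp
  have "norm (\<phi> x - \<phi> (x - s *\<^sub>R v))
    \<le> (LINT t|lborel. norm (indicator {0..1} t * frechet_derivative \<phi> (at (x - t *\<^sub>R (s *\<^sub>R v))) (s *\<^sub>R v)))"
    unfolding test_function_segment[OF \<phi>] by (rule integral_norm_bound)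
  also have "\<dots> \<le> (LINT t|(lborel :: real measure). indicator {0..1} t * (s * B))"
  proof (rule integral_mono')
    show "integrable lborel (\<lambda>t::real. indicator {0..1} t * (s * B))"
      by (intro integrable_mult_left integrable_real_indicator) auto
    have "B \<ge> 0" using B[of undefined] by linarith
    then show "0 \<le> indicator {0..1} t * (s * B)" for t :: real using s by simp
    show "norm (indicator {0..1} t * frechet_derivative \<phi> (at (x - t *\<^sub>R (s *\<^sub>R v))) (s *\<^sub>R v)) \<le> indicator {0..1} t * (s * B)" for t
      using B s by (auto simp: lin abs_mult indicator_def intro!: mult_left_mono)
  qed
  also have "\<dots> = s * B" by simp
  finally show ?thesis by simp
qed

lemma test_function_difference_quotient:
  assumes "test_function \<Omega> \<phi>"
  shows "(\<lambda>n. real (Suc n) * (\<phi> x - \<phi> (x - (1 / Suc n) *\<^sub>R v))) \<longlonglongrightarrow> frechet_derivative \<phi> (at x) v"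
proof -
  have lin: "linear (frechet_derivative \<phi> (at x))" by (rule has_derivative_linear[OF test_functionD(3)[OF assms]])
  have "((\<lambda>t. \<phi> (x - t *\<^sub>R v)) has_derivative (\<lambda>s. frechet_derivative \<phi> (at (x - 0 *\<^sub>R v)) (- (s *\<^sub>R v)))) (at 0)"
    by (rule has_derivative_compose[OF _ test_functionD(3)[OF assms]]) (auto intro!: derivative_eq_intros)
  then have "((\<lambda>t. \<phi> (x - t *\<^sub>R v)) has_real_derivative - frechet_derivative \<phi> (at x) v) (at 0)"
    unfolding has_field_derivative_def
    by (rule has_derivative_eq_rhs) (simp add: linear_neg[OF lin] linear_cmul[OF lin] fun_eq_iff)
  then have "((\<lambda>t. (\<phi> (x - t *\<^sub>R v) - \<phi> x) / t) \<longlongrightarrow> - frechet_derivative \<phi> (at x) v) (at 0)"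
    by (simp add: DERIV_def)
  from tendsto_minus[OF filterlim_compose[OF this filterlim_inverse_Suc_at_0]]
  show ?thesis by (simp add: algebra_simps)
qed

text \<open>Discrete integration by parts: translation invariance moves the difference quotient from
  \<phi> to k, and the step tends to 0 on both sides by dominated convergence. Only steps 1/(n+1)
  occur, so an almost everywhere one-sided derivative of k suffices.\<close>

lemma weak_derivative_of_Lipschitz:
  fixes k :: "'a::euclidean_space \<Rightarrow> real"
  assumes \<phi>: "test_function \<Omega> \<phi>" and Lip: "\<And>x y. \<bar>k x - k y\<bar> \<le> L * norm (x - y)"
    and [measurable]: "Dk \<in> borel_measurable borel"
    and lim: "AE y in lborel. (\<lambda>n. real (Suc n) * (k (y + (1 / Suc n) *\<^sub>R v) - k y)) \<longlonglongrightarrow> Dk y"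
  shows "(LINT y|lborel. k y * frechet_derivative \<phi> (at y) v) = - (LINT y|lborel. Dk y * \<phi> y)"
proof -
  let ?s = "\<lambda>n. 1 / real (Suc n)"
  let ?S = "test_support \<phi>"
  have L0: "L \<ge> 0"
  proof -
    obtain b :: 'a where "b \<in> Basis" using nonempty_Basis by blast
    then show ?thesis using Lip[of b 0] by simp
  qed
  have kc: "continuous_on UNIV k"
    by (rule lipschitz_on_continuous_on[of L]) (use Lip L0 in \<open>auto intro!: lipschitz_onI simp: dist_norm\<close>)
  then have km[measurable]: "k \<in> borel_measurable borel" by (rule borel_measurable_continuous_onI)
  note \<phi>c = test_function_continuous[OF \<phi>]
  have \<phi>m[measurable]: "\<phi> \<in> borel_measurable borel" by (rule test_function_measurable[OF \<phi>])
  have [measurable]: "(\<lambda>y. frechet_derivative \<phi> (at y) v) \<in> borel_measurable borel"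
    by (rule borel_measurable_continuous_onI[OF test_functionD(4)[OF \<phi>]])
  obtain B where B: "\<And>x. \<bar>frechet_derivative \<phi> (at x) v\<bar> \<le> B" "B \<ge> 0"
    using test_function_deriv_bounded[OF \<phi>] by metis
  \<comment> \<open>One compact set that contains the supports of all translates by s v with s in
    [0, 1], so that a single majorant serves every n.\<close>
  define T where "T = (\<lambda>(x, t). x + t *\<^sub>R v) ` (?S \<times> {0..1})"
  have T: "compact T"
    unfolding T_def case_prod_unfold
    by (intro compact_continuous_image compact_Times test_functionD(1)[OF \<phi>] continuous_intros) auto
  have T_out: "\<phi> x = 0" "\<phi> (x - s *\<^sub>R v) = 0" if "x \<notin> T" "0 \<le> s" "s \<le> 1" for x s
  proof -
    have "x - s *\<^sub>R v \<notin> ?S"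
    proof
      assume "x - s *\<^sub>R v \<in> ?S"
      then have "(\<lambda>(x, t). x + t *\<^sub>R v) (x - s *\<^sub>R v, s) \<in> T"
        unfolding T_def using that(2,3) by (intro imageI) auto
      then show False using that(1) by simp
    qed
    then show "\<phi> (x - s *\<^sub>R v) = 0" by (rule test_function_outside)
    have "x \<notin> ?S"
    proof
      assume "x \<in> ?S"
      then have "(\<lambda>(x, t). x + t *\<^sub>R v) (x, 0) \<in> T" unfolding T_def by (intro imageI) auto
      then show False using that(1) by simp
    qed
    then show "\<phi> x = 0" by (rule test_function_outside)
  qed
  have ki: "integrable lborel (\<lambda>x. k x * \<phi> (x - s *\<^sub>R v))" if "0 \<le> s" "s \<le> 1" for s
    by (rule integrable_continuous_compact_support[OF _ T])
      (use T_out[OF _ that] kc in \<open>auto intro!: continuous_intros continuous_on_compose2[OF \<phi>c]\<close>)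
  have kti: "integrable lborel (\<lambda>x. k (x + s *\<^sub>R v) * \<phi> x)" for s
    by (rule integrable_continuous_compact_support[OF _ test_functionD(1)[OF \<phi>]])
      (use test_function_outside[of _ \<phi>] \<phi>c in \<open>auto intro!: continuous_intros continuous_on_compose2[OF kc]\<close>)
  have parts: "(LINT y|lborel. k y * (real (Suc n) * (\<phi> y - \<phi> (y - ?s n *\<^sub>R v))))
      = - (LINT y|lborel. (real (Suc n) * (k (y + ?s n *\<^sub>R v) - k y)) * \<phi> y)" for n
  proof -
    have s: "0 \<le> ?s n" "?s n \<le> 1" by auto
    have "(LINT y|lborel. k (y + ?s n *\<^sub>R v) * \<phi> ((y + ?s n *\<^sub>R v) - ?s n *\<^sub>R v)) = (LINT y|lborel. k y * \<phi> (y - ?s n *\<^sub>R v))"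
      by (rule integral_lborel_translate) measurable
    then have tr: "(LINT y|lborel. k y * \<phi> (y - ?s n *\<^sub>R v)) = (LINT y|lborel. k (y + ?s n *\<^sub>R v) * \<phi> y)" by simp
    have "(LINT y|lborel. k y * (real (Suc n) * (\<phi> y - \<phi> (y - ?s n *\<^sub>R v))))
       = (LINT y|lborel. real (Suc n) * (k y * \<phi> y - k y * \<phi> (y - ?s n *\<^sub>R v)))" by (simp add: algebra_simps)
    also have "\<dots> = real (Suc n) * ((LINT y|lborel. k y * \<phi> y) - (LINT y|lborel. k y * \<phi> (y - ?s n *\<^sub>R v)))"
      using ki[of 0] ki[OF s] by (simp only: integral_mult_right_zero) (subst Bochner_Integration.integral_diff; simp)
    also have "\<dots> = - (real (Suc n) * ((LINT y|lborel. k (y + ?s n *\<^sub>R v) * \<phi> y) - (LINT y|lborel. k y * \<phi> y)))"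
      unfolding tr by (simp add: algebra_simps)
    also have "(LINT y|lborel. k (y + ?s n *\<^sub>R v) * \<phi> y) - (LINT y|lborel. k y * \<phi> y)
        = (LINT y|lborel. k (y + ?s n *\<^sub>R v) * \<phi> y - k y * \<phi> y)"
      using ki[of 0] kti[of "?s n"] by (subst Bochner_Integration.integral_diff) auto
    also have "real (Suc n) * \<dots> = (LINT y|lborel. (real (Suc n) * (k (y + ?s n *\<^sub>R v) - k y)) * \<phi> y)"
      by (subst integral_mult_right_zero[symmetric]) (simp add: algebra_simps)
    finally show ?thesis .
  qed
  obtain M where M: "\<And>x. x \<in> T \<Longrightarrow> \<bar>k x\<bar> \<le> M"
  proof -
    have "bounded (k ` T)"
      by (intro compact_imp_bounded compact_continuous_image T) (rule continuous_on_subset[OF kc], simp)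
    then show ?thesis using that by (auto simp: bounded_iff)
  qed
  have lim1: "(\<lambda>n. LINT y|lborel. k y * (real (Suc n) * (\<phi> y - \<phi> (y - ?s n *\<^sub>R v))))
      \<longlonglongrightarrow> (LINT y|lborel. k y * frechet_derivative \<phi> (at y) v)"
  proof (rule integral_dominated_convergence[where w="\<lambda>y. (\<bar>M\<bar> * B) * indicator T y"])
    show "integrable lborel (\<lambda>y. (\<bar>M\<bar> * B) * indicator T y)"
      using T emeasure_compact_finite[of T]
      by (intro integrable_mult_right integrable_real_indicator) (simp_all add: compact_imp_closed)
    show "AE y in lborel. (\<lambda>n. k y * (real (Suc n) * (\<phi> y - \<phi> (y - ?s n *\<^sub>R v)))) \<longlonglongrightarrow> k y * frechet_derivative \<phi> (at y) v"
      by (intro AE_I2 tendsto_mult_left test_function_difference_quotient[OF \<phi>])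
    show "AE y in lborel. norm (k y * (real (Suc n) * (\<phi> y - \<phi> (y - ?s n *\<^sub>R v)))) \<le> (\<bar>M\<bar> * B) * indicator T y" for n
    proof (intro AE_I2)
      fix y
      show "norm (k y * (real (Suc n) * (\<phi> y - \<phi> (y - ?s n *\<^sub>R v)))) \<le> (\<bar>M\<bar> * B) * indicator T y"
      proof (cases "y \<in> T")
        case True
        have "\<bar>real (Suc n) * (\<phi> y - \<phi> (y - ?s n *\<^sub>R v))\<bar> \<le> real (Suc n) * (?s n * B)"
          using test_function_increment_bound[OF \<phi> B(1), of "?s n" y] by (simp only: abs_mult abs_of_nat) (intro mult_left_mono; simp)
        then have "\<bar>real (Suc n) * (\<phi> y - \<phi> (y - ?s n *\<^sub>R v))\<bar> \<le> B" by simp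
        moreover have "\<bar>k y\<bar> \<le> \<bar>M\<bar>" using M[OF True] by linarith
        ultimately have "\<bar>k y\<bar> * \<bar>real (Suc n) * (\<phi> y - \<phi> (y - ?s n *\<^sub>R v))\<bar> \<le> \<bar>M\<bar> * B"
          by (intro mult_mono) auto
        then show ?thesis using True by (simp only: real_norm_def abs_mult) simp
      next
        case False
        then show ?thesis using T_out(1)[OF False, of 0] T_out(2)[OF False, of "?s n"] by simp
      qed
    qed
  qed measurable
  have \<phi>i: "integrable lborel \<phi>"
    by (rule integrable_continuous_compact_support[OF \<phi>c test_functionD(1)[OF \<phi>]]) (rule test_function_outside)
  have lim2: "(\<lambda>n. LINT y|lborel. (real (Suc n) * (k (y + ?s n *\<^sub>R v) - k y)) * \<phi> y) \<longlonglongrightarrow> (LINT y|lborel. Dk y * \<phi> y)"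
  proof (rule integral_dominated_convergence[where w="\<lambda>y. (L * norm v) * \<bar>\<phi> y\<bar>"])
    show "integrable lborel (\<lambda>y. (L * norm v) * \<bar>\<phi> y\<bar>)"
      using \<phi>i by (intro integrable_mult_right integrable_abs)
    show "AE y in lborel. (\<lambda>n. (real (Suc n) * (k (y + ?s n *\<^sub>R v) - k y)) * \<phi> y) \<longlonglongrightarrow> Dk y * \<phi> y"
      using lim by eventually_elim (intro tendsto_mult_right)
    show "AE y in lborel. norm ((real (Suc n) * (k (y + ?s n *\<^sub>R v) - k y)) * \<phi> y) \<le> (L * norm v) * \<bar>\<phi> y\<bar>" for n
    proof (intro AE_I2)
      fix y
      have "\<bar>k (y + ?s n *\<^sub>R v) - k y\<bar> \<le> L * (?s n * norm v)" using Lip[of "y + ?s n *\<^sub>R v" y] by simp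
      then have "real (Suc n) * \<bar>k (y + ?s n *\<^sub>R v) - k y\<bar> \<le> real (Suc n) * (L * (?s n * norm v))"
        by (rule mult_left_mono) simp
      then have "\<bar>real (Suc n) * (k (y + ?s n *\<^sub>R v) - k y)\<bar> \<le> L * norm v"
        by (simp only: abs_mult abs_of_nat) simp
      then show "norm ((real (Suc n) * (k (y + ?s n *\<^sub>R v) - k y)) * \<phi> y) \<le> (L * norm v) * \<bar>\<phi> y\<bar>"
        by (simp only: real_norm_def abs_mult[of _ "\<phi> y"]) (rule mult_right_mono; simp)
    qed
  qed measurable
  show ?thesis
    using LIMSEQ_unique[OF lim1] tendsto_minus[OF lim2] unfolding parts by blast
qed

subsection \<open>The gradient of the gauge\<close>

context convex_body
begin

text \<open>The one-sided directional derivative of the gauge at y along v, taken along a sequence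
  of steps so that measurability in y is immediate.\<close>

definition DN :: "'a \<Rightarrow> 'a \<Rightarrow> real" where
  "DN v y = lim (\<lambda>n. real (Suc n) * (N (y + (1 / Suc n) *\<^sub>R v) - N y))"

lemma N_increment_bound: "\<bar>real (Suc n) * (N (y + (1 / Suc n) *\<^sub>R v) - N y)\<bar> \<le> N v"
proof -
  have "\<bar>N (y + (1 / Suc n) *\<^sub>R v) - N y\<bar> \<le> N ((1 / Suc n) *\<^sub>R v)"
    using N_diff_abs[of "y + (1 / Suc n) *\<^sub>R v" y] by simp
  also have "\<dots> = (1 / Suc n) * N v" by (simp add: N_scaleR)
  finally have "real (Suc n) * \<bar>N (y + (1 / Suc n) *\<^sub>R v) - N y\<bar> \<le> real (Suc n) * ((1 / Suc n) * N v)"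
    by (rule mult_left_mono) simp
  then show ?thesis by (simp only: abs_mult abs_of_nat) simp
qed

lemma N_difference_quotient_mono:
  assumes "0 < s" "s \<le> t" shows "(N (y + s *\<^sub>R v) - N y) / s \<le> (N (y + t *\<^sub>R v) - N y) / t"
proof -
  have "y + s *\<^sub>R v = (1 - s / t) *\<^sub>R y + (s / t) *\<^sub>R (y + t *\<^sub>R v)"
    using assms by (simp add: algebra_simps)
  then have "N (y + s *\<^sub>R v) \<le> N ((1 - s / t) *\<^sub>R y) + N ((s / t) *\<^sub>R (y + t *\<^sub>R v))"
    by (metis N_triangle)
  also have "\<dots> = (1 - s / t) * N y + (s / t) * N (y + t *\<^sub>R v)"
    using assms by (simp add: N_scaleR)
  finally have "N (y + s *\<^sub>R v) - N y \<le> (s / t) * (N (y + t *\<^sub>R v) - N y)" by (simp add: algebra_simps)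
  then show ?thesis using assms by (simp add: field_simps)
qed

text \<open>By convexity the difference quotients decrease as the step shrinks, and they are bounded
  below by -N v. So the limit exists at every point and in every direction.\<close>

lemma DN_LIMSEQ: "(\<lambda>n. real (Suc n) * (N (y + (1 / Suc n) *\<^sub>R v) - N y)) \<longlonglongrightarrow> DN v y"
proof -
  let ?X = "\<lambda>n. real (Suc n) * (N (y + (1 / Suc n) *\<^sub>R v) - N y)"
  have dec: "decseq ?X"
  proof (rule decseq_SucI)
    fix n
    show "?X (Suc n) \<le> ?X n"
      using N_difference_quotient_mono[of "1 / Suc (Suc n)" "1 / Suc n" y v] by (simp add: frac_le mult.commute)
  qed
  have "- N v \<le> ?X n" for n
    using abs_le_D2[OF N_increment_bound[of n y v]] by (subst minus_le_iff)
  then have "\<forall>n. - N v \<le> ?X n" by (rule allI)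
  then obtain l where l: "?X \<longlonglongrightarrow> l"
    by (rule decseq_convergent[OF dec]) (rule that)
  then show ?thesis unfolding DN_def by (simp only: limI[OF l])
qed

lemma DN_measurable [measurable]: "DN v \<in> borel_measurable borel"
  by (rule borel_measurable_LIMSEQ_real[OF DN_LIMSEQ]) measurable

lemma DN_bound: "\<bar>DN v y\<bar> \<le> N v"
  by (rule LIMSEQ_le_const2[OF tendsto_rabs[OF DN_LIMSEQ]]) (intro exI allI impI, rule N_increment_bound)

text \<open>Continuity in the direction, which later extends linearity from a dense set of
  directions to all of them.\<close>

lemma DN_diff_bound: "\<bar>DN v y - DN w y\<bar> \<le> N (v - w)"
proof (rule LIMSEQ_le_const2[OF tendsto_rabs[OF tendsto_diff[OF DN_LIMSEQ DN_LIMSEQ]]], intro exI allI impI)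
  fix n :: nat
  let ?s = "1 / real (Suc n)"
  have "\<bar>N (y + ?s *\<^sub>R v) - N (y + ?s *\<^sub>R w)\<bar> \<le> N (?s *\<^sub>R (v - w))"
    using N_diff_abs[of "y + ?s *\<^sub>R v" "y + ?s *\<^sub>R w"] by (simp add: scaleR_diff_right)
  also have "\<dots> = ?s * N (v - w)" by (simp add: N_scaleR)
  finally have "real (Suc n) * \<bar>N (y + ?s *\<^sub>R v) - N (y + ?s *\<^sub>R w)\<bar> \<le> real (Suc n) * (?s * N (v - w))"
    by (rule mult_left_mono) simp
  then have "\<bar>real (Suc n) * (N (y + ?s *\<^sub>R v) - N (y + ?s *\<^sub>R w))\<bar> \<le> N (v - w)"
    by (simp only: abs_mult abs_of_nat) simp
  then show "\<bar>real (Suc n) * (N (y + ?s *\<^sub>R v) - N y) - real (Suc n) * (N (y + ?s *\<^sub>R w) - N y)\<bar> \<le> N (v - w)"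
    by (simp add: algebra_simps)
qed

text \<open>Euler's relation for a function homogeneous of degree 1.\<close>

lemma DN_self: "DN y y = N y"
proof -
  have "real (Suc n) * (N (y + (1 / Suc n) *\<^sub>R y) - N y) = N y" for n
  proof -
    have "y + (1 / Suc n) *\<^sub>R y = (1 + 1 / Suc n) *\<^sub>R y" by (simp add: scaleR_add_left)
    then have "N (y + (1 / Suc n) *\<^sub>R y) = (1 + 1 / Suc n) * N y" by (simp only: N_scaleR) simp
    then show ?thesis by (simp add: field_simps)
  qed
  then show ?thesis using LIMSEQ_unique[OF DN_LIMSEQ[of y y]] by simp
qed

lemma N_Lipschitz: obtains L where "L > 0" "\<And>x y. \<bar>N x - N y\<bar> \<le> L * norm (x - y)"
proof -
  obtain c where "c > 0" "\<And>x. N x \<le> c * norm x" using N_equivalent by metis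
  then have "\<bar>N x - N y\<bar> \<le> c * norm (x - y)" for x y using N_diff_abs[of x y] order_trans by blast
  then show ?thesis using that \<open>c > 0\<close> by blast
qed

text \<open>Defined at every point from the directional derivatives along \<open>Basis\<close>; that
  it represents the derivatives in other directions is only claimed almost everywhere.\<close>

definition "VN y = (\<Sum>b\<in>Basis. DN b y *\<^sub>R b)"

lemma VN_inner: "VN y \<bullet> v = (\<Sum>b\<in>Basis. (v \<bullet> b) * DN b y)"
  unfolding VN_def inner_sum_left inner_scaleR_left by (simp add: inner_commute[of _ v] mult.commute)

lemma VN_inner_Basis: "b \<in> Basis \<Longrightarrow> VN y \<bullet> b = DN b y"
  by (simp add: VN_def)

text \<open>Both sides are the weak derivative of the gauge in the direction \<open>v\<close>.\<close>

lemma DN_linear_AE: "AE y in lborel. DN v y = VN y \<bullet> v"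
proof -
  define q where "q y = DN v y - VN y \<bullet> v" for y
  have qm[measurable]: "q \<in> borel_measurable borel"
    unfolding q_def VN_inner by measurable
  have qb: "\<bar>q y\<bar> \<le> N v + (\<Sum>b\<in>Basis. \<bar>v \<bullet> b\<bar> * N b)" for y
  proof -
    have "\<bar>VN y \<bullet> v\<bar> \<le> (\<Sum>b\<in>Basis. \<bar>(v \<bullet> b) * DN b y\<bar>)" unfolding VN_inner by (rule sum_abs)
    also have "\<dots> \<le> (\<Sum>b\<in>Basis. \<bar>v \<bullet> b\<bar> * N b)"
      by (intro sum_mono) (simp add: abs_mult mult_left_mono DN_bound)
    finally show ?thesis using DN_bound[of v y] unfolding q_def by linarith
  qed
  \<comment> \<open>The factor s is specialised to 1 and -1 below, which gives both q \<le> 0 and -q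
    \<le> 0.\<close>
  have li: "locally_integrable UNIV (\<lambda>y. s * q y)" for s
    unfolding locally_integrable_def set_integrable_def
  proof (intro allI impI)
    fix S :: "'a set" assume S: "compact S \<and> S \<subseteq> UNIV"
    define c where "c = \<bar>s\<bar> * (N v + (\<Sum>b\<in>Basis. \<bar>v \<bullet> b\<bar> * N b))"
    have c: "\<bar>s * q y\<bar> \<le> c" for y
      unfolding c_def abs_mult by (intro mult_left_mono qb) simp
    have "integrable lborel (\<lambda>y. indicator S y *\<^sub>R (s * q y))"
    proof (rule Bochner_Integration.integrable_bound)
      show "integrable lborel (\<lambda>y. c * indicator S y)"
        using S emeasure_compact_finite[of S]
        by (intro integrable_mult_right integrable_real_indicator) (simp_all add: compact_imp_closed)
      show "AE y in lborel. norm (indicator S y *\<^sub>R (s * q y)) \<le> norm (c * indicator S y)"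
        using c by (intro AE_I2) (auto simp: indicator_def intro: order_trans[OF _ abs_ge_self])
      have "S \<in> sets borel" using S by (auto simp: compact_imp_closed)
      then show "(\<lambda>y. indicator S y *\<^sub>R (s * q y)) \<in> borel_measurable lborel" by measurable
    qed
    then show "integrable lebesgue (\<lambda>y. indicator S y *\<^sub>R (s * q y))"
      by (subst integrable_completion) auto
  qed
  obtain L where L: "L > 0" "\<And>x y. \<bar>N x - N y\<bar> \<le> L * norm (x - y)" using N_Lipschitz by metis
  have wd: "(LINT y|lborel. N y * frechet_derivative \<phi> (at y) u) = - (LINT y|lborel. DN u y * \<phi> y)"
    if "test_function UNIV \<phi>" for \<phi> u
    by (rule weak_derivative_of_Lipschitz[OF that L(2)]) (auto intro: DN_LIMSEQ simp del: of_nat_Suc)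
  have zero: "(LINT y|lborel. q y * \<phi> y) = 0" if \<phi>: "test_function UNIV \<phi>" for \<phi>
  proof -
    note [measurable] = test_function_measurable[OF \<phi>]
    have \<phi>i: "integrable lborel \<phi>"
      by (rule integrable_continuous_compact_support[OF test_function_continuous[OF \<phi>] test_functionD(1)[OF \<phi>]])
        (rule test_function_outside)
    have Di: "integrable lborel (\<lambda>y. DN u y * \<phi> y)" for u
    proof (rule Bochner_Integration.integrable_bound)
      show "integrable lborel (\<lambda>y. N u * \<phi> y)" using \<phi>i by (rule integrable_mult_right)
      show "AE y in lborel. norm (DN u y * \<phi> y) \<le> norm (N u * \<phi> y)"
        by (intro AE_I2) (simp add: abs_mult mult_right_mono DN_bound)
    qed measurable
    have Ni: "integrable lborel (\<lambda>y. N y * frechet_derivative \<phi> (at y) u)" for u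
      by (rule integrable_continuous_compact_support[OF _ test_functionD(1)[OF \<phi>]])
        (use test_functionD(4)[OF \<phi>] test_function_deriv_outside[OF \<phi>] continuous_N in \<open>auto intro!: continuous_intros\<close>)
    have "- (LINT y|lborel. DN v y * \<phi> y) = (LINT y|lborel. (\<Sum>b\<in>Basis. (v \<bullet> b) * (N y * frechet_derivative \<phi> (at y) b)))"
      unfolding wd[OF \<phi>, symmetric] by (subst frechet_derivative_direction[OF \<phi>]) (simp add: sum_distrib_left mult_ac)
    also have "\<dots> = (\<Sum>b\<in>Basis. (v \<bullet> b) * (LINT y|lborel. N y * frechet_derivative \<phi> (at y) b))"
      by (subst Bochner_Integration.integral_sum) (auto intro!: integrable_mult_right Ni)
    also have "\<dots> = - (\<Sum>b\<in>Basis. (v \<bullet> b) * (LINT y|lborel. DN b y * \<phi> y))"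
      by (simp add: wd[OF \<phi>] sum_negf)
    also have "(\<Sum>b\<in>Basis. (v \<bullet> b) * (LINT y|lborel. DN b y * \<phi> y)) = (LINT y|lborel. (\<Sum>b\<in>Basis. (v \<bullet> b) * (DN b y * \<phi> y)))"
      by (subst Bochner_Integration.integral_sum) (auto intro!: integrable_mult_right Di)
    finally have eq: "(LINT y|lborel. DN v y * \<phi> y) = (LINT y|lborel. (\<Sum>b\<in>Basis. (v \<bullet> b) * (DN b y * \<phi> y)))" by simp
    have "(LINT y|lborel. q y * \<phi> y) = (LINT y|lborel. DN v y * \<phi> y - (\<Sum>b\<in>Basis. (v \<bullet> b) * (DN b y * \<phi> y)))"
      unfolding q_def VN_inner by (simp only: left_diff_distrib sum_distrib_right mult.assoc)
    also have "\<dots> = 0"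
      by (subst Bochner_Integration.integral_diff) (auto intro!: integrable_mult_right Bochner_Integration.integrable_sum Di simp: eq)
    finally show ?thesis .
  qed
  have "AE y in lebesgue. y \<in> UNIV \<longrightarrow> s * q y \<le> 0" for s
  proof (rule AE_le_of_test_functions[OF open_UNIV li])
    fix \<phi> :: "'a \<Rightarrow> real" assume \<phi>: "test_function UNIV \<phi>"
    note [measurable] = test_function_measurable[OF \<phi>]
    have "(LINT y:UNIV|lebesgue. s * q y * \<phi> y) = (LINT y|lborel. s * (q y * \<phi> y))"
      unfolding set_lebesgue_integral_def by (subst integral_completion) (auto simp: mult_ac)
    also have "\<dots> = 0" using zero[OF \<phi>] by simp
    finally show "(LINT y:UNIV|lebesgue. s * q y * \<phi> y) \<le> 0 * (LINT x|lebesgue. \<phi> x)" by simp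
  qed
  from this[of 1] this[of "-1"] have "AE y in lebesgue. q y = 0" by eventually_elim auto
  then show ?thesis unfolding AE_completion_iff by eventually_elim (simp add: q_def)
qed

text \<open>Outside a null set, linearity on the dense set extends to every v since both sides are
  continuous in v. Then \<open>DN_bound\<close> bounds the functional by the gauge, and Euler's
  relation \<open>DN_self\<close> gives equality at y.\<close>

lemma dual_VN: "AE y in lborel. N' (VN y) = 1"
proof -
  obtain D :: "'a set" where D: "countable D" "\<And>X. open X \<Longrightarrow> X \<noteq> {} \<Longrightarrow> \<exists>d\<in>D. d \<in> X"
    using countable_dense_setE by metis
  have "AE y in lborel. \<forall>v\<in>D. DN v y = VN y \<bullet> v"
    by (subst AE_ball_countable[OF D(1)]) (intro ballI DN_linear_AE)
  moreover have "AE y in lborel. y \<noteq> (0::'a)" by (rule AE_lborel_singleton)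
  ultimately show ?thesis
  proof eventually_elim
    case (elim y)
    have "continuous_on UNIV (\<lambda>v. DN v y)"
    proof -
      obtain c where c: "c > 0" "\<And>x. N x \<le> c * norm x" using N_equivalent by metis
      have "c-lipschitz_on UNIV (\<lambda>v. DN v y)"
      proof (rule lipschitz_onI)
        show "dist (DN v y) (DN w y) \<le> c * dist v w" for v w
          using DN_diff_bound[of v y w] c(2)[of "v - w"] by (simp add: dist_norm)
      qed (use c in simp)
      then show ?thesis by (rule lipschitz_on_continuous_on)
    qed
    then have "open {v. DN v y \<noteq> VN y \<bullet> v}"
      by (intro open_Collect_neq) (auto intro!: continuous_intros)
    then have all: "DN v y = VN y \<bullet> v" for v
      using D(2)[of "{v. DN v y \<noteq> VN y \<bullet> v}"] elim(1) by blast
    show ?case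
    proof (rule dual_eq_1[OF _ _ elim(2)])
      show "x \<bullet> VN y \<le> N x" for x
        using all[of x] DN_bound[of x y] by (simp add: inner_commute)
      show "y \<bullet> VN y = N y" using all[of y] DN_self[of y] by (simp add: inner_commute)
    qed
  qed
qed

end

subsection \<open>The extremal function\<close>

text \<open>A chain rule along one sequence of steps, for an inner function that has only a
  one-sided derivative. Caratheodory's form of the derivative avoids dividing by x n - a, which may
  vanish.\<close>

lemma DERIV_LIMSEQ_quotient:
  fixes f :: "real \<Rightarrow> real"
  assumes "(f has_real_derivative D) (at a)" "x \<longlonglongrightarrow> a" "(\<lambda>n. real (Suc n) * (x n - a)) \<longlonglongrightarrow> L"
  shows "(\<lambda>n. real (Suc n) * (f (x n) - f a)) \<longlonglongrightarrow> D * L"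
proof -
  obtain s where s: "\<And>z. f z - f a = s z * (z - a)" "isCont s a" "s a = D"
    using assms(1) unfolding CARAT_DERIV by blast
  have "(\<lambda>n. s (x n) * (real (Suc n) * (x n - a))) \<longlonglongrightarrow> s a * L"
    by (intro tendsto_mult isCont_tendsto_compose[OF s(2)] assms)
  then show ?thesis unfolding s(1) s(3) by (simp add: mult_ac)
qed

text \<open>With the whole space as the cone, the volume and radial formulas apply to gauge
  balls.\<close>

lemma (in convex_body) full_cone: "cone_body K UNIV"
  by unfold_locales (auto simp: positive_cone_def)

text \<open>The cut-off profiles have kinks on two gauge spheres; this makes them
  negligible.\<close>

lemma (in convex_body) AE_N_neq:
  assumes "s > 0" shows "AE y in lborel. N y \<noteq> s"
proof -
  interpret full: cone_body K UNIV by (rule full_cone)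
  have "emeasure lborel ({y. N y \<le> s} - {y. N y < s}) = emeasure lborel {y. N y \<le> s} - emeasure lborel {y. N y < s}"
    using full.emeasure_E[OF assms] full.E_eq[OF assms] by (intro emeasure_Diff) auto
  also have "\<dots> = 0"
    using full.emeasure_E[OF assms] full.E_eq[OF assms] full.emeasure_closed_sublevel[of s] assms by simp
  also have "{y. N y \<le> s} - {y. N y < s} = {y. N y = s}" by auto
  finally have "{y. N y = s} \<in> null_sets lborel" by (auto intro!: null_setsI)
  from AE_not_in[OF this] show ?thesis by simp
qed

context extremal_problem
begin

text \<open>\<open>F h\<close> is the radial profile of the extremal function, \<open>w h\<close> is
  minus its derivative, and \<open>X h\<close> will be its value at 0. The condition v < u inside an
  integral over the line makes measurability in v immediate.\<close>

definition "w h u = indicator {0<..<h} u * g h u powr (q - 1)"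
definition "F h v = (LINT u|lborel. (if v < u then w h u else 0))"
definition "X h = (1 + 1 / DIM('a) - r) * I h"

lemma w_measurable [measurable]: "w h \<in> borel_measurable borel"
  unfolding w_def by measurable

lemma F_measurable [measurable]: "F h \<in> borel_measurable borel"
  unfolding F_def by measurable

lemma w_nonneg [simp]: "0 \<le> w h u"
  by (simp add: w_def)

lemma nn_integral_w: "h > 0 \<Longrightarrow> (\<integral>\<^sup>+u. ennreal (w h u) \<partial>lborel) = ennreal (X h)"
proof -
  assume h: "h > 0"
  have "ennreal (w h u) = ennreal (g h u powr (q - 1)) * indicator {0<..<h} u" for u
    by (simp add: w_def indicator_def)
  then show ?thesis using nn_integral_X[OF h] by (simp add: X_def)
qed

lemma X_pos: "h > 0 \<Longrightarrow> X h > 0"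
  using I_pos[of h] r_less by (simp add: X_def)

lemma w_integrable: "h > 0 \<Longrightarrow> integrable lborel (w h)"
  by (rule integrableI_nonneg) (auto simp: nn_integral_w)

lemma w_part_integrable: "h > 0 \<Longrightarrow> integrable lborel (\<lambda>u. if v < u then w h u else 0)"
  by (rule Bochner_Integration.integrable_bound[OF w_integrable]) auto

lemma integral_w: "h > 0 \<Longrightarrow> (LINT u|lborel. w h u) = X h"
  using X_pos[of h] by (subst integral_eq_nn_integral) (auto simp: nn_integral_w)

lemma F_zero: "h > 0 \<Longrightarrow> F h 0 = X h"
proof -
  assume h: "h > 0"
  have "(if 0 < u then w h u else 0) = w h u" for u by (simp add: w_def)
  then show ?thesis using integral_w[OF h] by (simp add: F_def)
qed

lemma F_nonneg: "0 \<le> F h v"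
  unfolding F_def by (rule Bochner_Integration.integral_nonneg) simp

lemma F_antimono: "h > 0 \<Longrightarrow> a \<le> b \<Longrightarrow> F h b \<le> F h a"
  unfolding F_def by (intro integral_mono w_part_integrable) auto

lemma F_le_X: "h > 0 \<Longrightarrow> 0 \<le> v \<Longrightarrow> F h v \<le> X h"
  using F_antimono[of h 0 v] F_zero by simp

lemma F_eq_0: "v \<ge> h \<Longrightarrow> F h v = 0"
proof -
  assume "v \<ge> h"
  then have "(if v < u then w h u else 0) = 0" for u by (simp add: w_def)
  then show ?thesis by (simp add: F_def)
qed

lemma f_extremal_eq:
  assumes h: "h > 0" shows "f_extremal C K p h y = indicator C y * F h (N y)"
proof (cases "y \<in> E h")
  case True
  have "indicator {N y<..<h} u *\<^sub>R g h u powr (q - 1) = (if N y < u then w h u else 0)" for u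
    using le_less_trans[OF N_nonneg[of y], of u] by (auto simp: w_def indicator_def)
  then show ?thesis using True by (simp add: f_extremal_def F_def set_lebesgue_integral_def q_def[symmetric])
next
  case False
  then have "y \<in> C \<longrightarrow> N y \<ge> h" using E_eq[OF h] by auto
  then show ?thesis using False F_eq_0[of h "N y"] by (auto simp: f_extremal_def indicator_def)
qed

text \<open>The weight can be unbounded only near 0, so away from 0 the profile is
  Lipschitz.\<close>

lemma w_bound:
  assumes e: "e > 0" obtains M where "M \<ge> 0" "\<And>u. u \<ge> e \<Longrightarrow> w h u \<le> M"
proof -
  let ?M = "(1 / (real DIM('a) * m) * (1 / e ^ (DIM('a) - 1))) powr (q - 1)"
  have "w h u \<le> ?M" if u: "u \<ge> e" for u
  proof (cases "u < h")
    case True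
    have u0: "u > 0" using u e by simp
    have "g h u \<le> 1 / (real DIM('a) * m) * (1 / u ^ (DIM('a) - 1)) * 1"
      unfolding g_eq[OF u0 True] using ratio_power_less_1[OF u0 True] m_pos u0 by (intro mult_left_mono) auto
    also have "\<dots> \<le> 1 / (real DIM('a) * m) * (1 / e ^ (DIM('a) - 1))"
      using m_pos e u by (auto intro!: mult_left_mono divide_left_mono power_mono)
    finally have "g h u powr (q - 1) \<le> ?M"
      using g_pos[OF u0 True] q_ge_1 by (intro powr_mono2) auto
    then show ?thesis using True u0 by (simp add: w_def)
  next
    case False
    then show ?thesis by (simp add: w_def)
  qed
  then show ?thesis using that[of ?M] by auto
qed

lemma F_diff_bound:
  assumes h: "h > 0" and M: "\<And>u. u \<ge> e \<Longrightarrow> w h u \<le> M" "M \<ge> 0" and ab: "e \<le> a" "a \<le> b"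
  shows "F h a - F h b \<le> M * (b - a)"
proof -
  have "F h a - F h b = (LINT u|lborel. (if a < u then w h u else 0) - (if b < u then w h u else 0))"
    unfolding F_def using w_part_integrable[OF h] by (subst Bochner_Integration.integral_diff) auto
  also have "\<dots> \<le> (LINT u|lborel. M * indicator {a..b} u)"
  proof (rule integral_mono')
    show "integrable lborel (\<lambda>u. M * indicator {a..b} u)"
      by (intro integrable_mult_right integrable_real_indicator) (use ab in auto)
    show "(if a < u then w h u else 0) - (if b < u then w h u else 0) \<le> M * indicator {a..b} u" for u
      using M ab by (auto simp: indicator_def)
  qed (use M(2) in auto)
  also have "\<dots> = M * (b - a)" using ab by simp
  finally show ?thesis .
qed

lemma F_Lipschitz:
  assumes h: "h > 0" and M: "\<And>u. u \<ge> e \<Longrightarrow> w h u \<le> M" "M \<ge> 0"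
  shows "\<bar>F h (max e a) - F h (max e b)\<bar> \<le> M * \<bar>a - b\<bar>"
proof -
  have *: "\<bar>F h (max e a) - F h (max e b)\<bar> \<le> M * \<bar>a - b\<bar>" if "a \<le> b" for a b
  proof -
    have "F h (max e a) - F h (max e b) \<le> M * (max e b - max e a)"
      by (rule F_diff_bound[OF h M]) (use that in auto)
    also have "\<dots> \<le> M * (b - a)" using that M(2) by (intro mult_left_mono) auto
    finally show ?thesis using F_antimono[OF h, of "max e a" "max e b"] that by auto
  qed
  show ?thesis using *[of a b] *[of b a] by (cases "a \<le> b") (auto simp: abs_minus_commute)
qed

lemma continuous_g_powr:
  assumes "0 < a" "b < h" shows "continuous_on {a..b} (\<lambda>u. g h u powr (q - 1))"
proof (rule continuous_on_powr)
  show "continuous_on {a..b} (g h)"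
    unfolding g_kernel_def using assms by (intro continuous_intros) auto
  show "\<forall>u\<in>{a..b}. g h u \<noteq> 0"
    using assms g_pos[of _ h] by (metis atLeastAtMost_iff less_irrefl order_less_le_trans order_le_less_trans)
qed (rule continuous_on_const)

text \<open>The point h is excluded because the weight may jump there: for q = 1 it drops from 1 to
  0.\<close>

lemma F_has_derivative:
  assumes h: "h > 0" and v: "v > 0" "v \<noteq> h"
  shows "(F h has_real_derivative - w h v) (at v)"
proof (cases "v < h")
  case True
  \<comment> \<open>The interval [a, b] stays inside (0, h), where the kernel is continuous and
    positive.\<close>
  define a b where "a = v / 2" and "b = (v + h) / 2"
  have ab: "0 < a" "a < v" "v < b" "b < h" using True v by (auto simp: a_def b_def)
  let ?k = "\<lambda>u. g h u powr (q - 1)"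
  have wk: "w h u = ?k u" if "u \<in> {a..b}" for u using that ab by (simp add: w_def)
  have F: "F h a - integral {a..x} ?k = F h x" if x: "x \<in> {a..b}" for x
  proof -
    have "F h a - F h x = (LINT u|lborel. (if a < u then w h u else 0) - (if x < u then w h u else 0))"
      unfolding F_def using w_part_integrable[OF h] by (subst Bochner_Integration.integral_diff) auto
    also have "\<dots> = (LINT u|lborel. indicator {a..x} u *\<^sub>R ?k u)"
    proof (rule integral_cong_AE)
      have "AE u in lborel. u \<noteq> a" by (rule AE_lborel_singleton)
      then show "AE u in lborel. (if a < u then w h u else 0) - (if x < u then w h u else 0) = indicator {a..x} u *\<^sub>R ?k u"
        by eventually_elim (use x wk in \<open>auto simp: indicator_def\<close>)
    qed measurable
    also have "\<dots> = integral {a..x} ?k"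
    proof -
      have "set_integrable lborel {a..x} ?k"
        unfolding set_integrable_def
        by (intro borel_integrable_compact compact_Icc continuous_on_subset[OF continuous_g_powr[OF ab(1,4)]]) (use x in auto)
      from set_borel_integral_eq_integral(2)[OF this] show ?thesis by (simp add: set_lebesgue_integral_def)
    qed
    finally show ?thesis by simp
  qed
  have "((\<lambda>x. integral {a..x} ?k) has_real_derivative ?k v) (at v within {a..b})"
    by (rule integral_has_real_derivative[OF continuous_g_powr[OF ab(1,4)]]) (use ab in auto)
  then have "((\<lambda>x. F h a - integral {a..x} ?k) has_real_derivative 0 - ?k v) (at v within {a..b})"
    by (intro DERIV_diff DERIV_const)
  then have "(F h has_real_derivative 0 - ?k v) (at v within {a..b})"
    by (rule has_field_derivative_transform_within[where d=1]) (use ab F in auto)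
  then show ?thesis using wk[of v] ab by (simp add: at_within_Icc_at)
next
  case False
  then have "v > h" using v by simp
  then have "((\<lambda>_. 0) has_real_derivative - w h v) (at v)" by (simp add: w_def)
  then show ?thesis
    by (rule has_field_derivative_transform_within_open[where S="{h<..}"]) (use \<open>v > h\<close> F_eq_0[of h] in auto)
qed

lemma F_max_has_derivative:
  assumes h: "h > 0" and e: "e > 0" and v: "v \<noteq> e" "v \<noteq> h"
  shows "((\<lambda>u. F h (max e u)) has_real_derivative - (if e < v then w h v else 0)) (at v)"
proof (cases "e < v")
  case True
  have "(F h has_real_derivative - w h v) (at v)" using True e v by (intro F_has_derivative h) auto
  then have "((\<lambda>u. F h (max e u)) has_real_derivative - w h v) (at v)"
    by (rule has_field_derivative_transform_within_open[where S="{e<..}"]) (use True in auto)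
  then show ?thesis using True by simp
next
  case False
  have "((\<lambda>_. F h e) has_real_derivative 0) (at v)" by simp
  then have "((\<lambda>u. F h (max e u)) has_real_derivative 0) (at v)"
    by (rule has_field_derivative_transform_within_open[where S="{..<e}"]) (use False v in auto)
  then show ?thesis using False by simp
qed

text \<open>Integrability is needed on the whole space, where the gauge is differentiated, hence the
  full cone. The radial density u^(d-1) is at most h^(d-1), and \<open>w h\<close> is integrable on
  the line.\<close>

lemma wN_integrable: assumes h: "h > 0" shows "integrable lborel (\<lambda>y. w h (N y))"
proof (rule integrableI_nonneg)
  interpret full: cone_body K UNIV by (rule full_cone)
  have "(\<integral>\<^sup>+y. ennreal (w h (N y)) \<partial>lborel) = (\<integral>\<^sup>+y. ennreal (w h (N y)) * indicator (full.E h) y \<partial>lborel)"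
    by (rule nn_integral_cong) (use full.E_eq[OF h] in \<open>auto simp: w_def indicator_def\<close>)
  also have "\<dots> = (\<integral>\<^sup>+u. ennreal (w h u) * (ennreal (real DIM('a) * full.m * u ^ (DIM('a) - 1)) * indicator {0..h} u) \<partial>lborel)"
    by (rule full.nn_integral_radial[OF h, of "\<lambda>u. ennreal (w h u)"]) measurable
  also have "\<dots> \<le> (\<integral>\<^sup>+u. ennreal (real DIM('a) * full.m * h ^ (DIM('a) - 1)) * ennreal (w h u) \<partial>lborel)"
  proof (rule nn_integral_mono)
    fix u
    show "ennreal (w h u) * (ennreal (real DIM('a) * full.m * u ^ (DIM('a) - 1)) * indicator {0..h} u)
      \<le> ennreal (real DIM('a) * full.m * h ^ (DIM('a) - 1)) * ennreal (w h u)"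
    proof (cases "u \<in> {0..h}")
      case True
      then have le: "ennreal (real DIM('a) * full.m * u ^ (DIM('a) - 1)) \<le> ennreal (real DIM('a) * full.m * h ^ (DIM('a) - 1))"
        using full.m_pos by (intro ennreal_leI mult_left_mono power_mono) auto
      show ?thesis
        unfolding indicator_simps(1)[OF True] mult_1_right
        by (subst mult.commute, rule mult_right_mono[OF le]) simp
    qed simp
  qed
  also have "\<dots> = ennreal (real DIM('a) * full.m * h ^ (DIM('a) - 1)) * ennreal (X h)"
    by (subst nn_integral_cmult) (auto simp: nn_integral_w[OF h])
  also have "\<dots> < \<infinity>" by (simp add: ennreal_mult_less_top)
  finally show "(\<integral>\<^sup>+y. ennreal (w h (N y)) \<partial>lborel) < \<infinity>" .
qed auto

text \<open>The derivative of \<^term>\<open>F h\<close> may be unbounded at 0, so \<^term>\<open>F h\<close> is first cut off near 0, which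
  makes \<^term>\<open>\<lambda>y. F h (N y)\<close> Lipschitz.\<close>

lemma weak_derivative_radial:
  assumes h: "h > 0" and \<phi>: "test_function \<Omega> \<phi>"
  shows "(LINT y|lborel. F h (N y) * frechet_derivative \<phi> (at y) v)
    = (LINT y|lborel. w h (N y) * DN v y * \<phi> y)"
proof -
  let ?e = "\<lambda>n. 1 / real (Suc n)"
  note [measurable] = test_function_measurable[OF \<phi>] borel_measurable_continuous_onI[OF test_functionD(4)[OF \<phi>], of v]
  obtain L where L: "L > 0" "\<And>x y. \<bar>N x - N y\<bar> \<le> L * norm (x - y)" using N_Lipschitz by metis
  have cut: "(LINT y|lborel. F h (max e (N y)) * frechet_derivative \<phi> (at y) v)
    = - (LINT y|lborel. (- (if e < N y then w h (N y) else 0) * DN v y) * \<phi> y)" if e: "e > 0" for e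
  proof -
    obtain M where M: "M \<ge> 0" "\<And>u. u \<ge> e \<Longrightarrow> w h u \<le> M" using w_bound[OF e] by metis
    show ?thesis
    proof (rule weak_derivative_of_Lipschitz[OF \<phi>, where L="M * L"])
      fix x y
      have "\<bar>F h (max e (N x)) - F h (max e (N y))\<bar> \<le> M * \<bar>N x - N y\<bar>"
        by (rule F_Lipschitz[OF h M(2,1)])
      also have "\<dots> \<le> M * (L * norm (x - y))" using M(1) by (intro mult_left_mono L(2))
      finally show "\<bar>F h (max e (N x)) - F h (max e (N y))\<bar> \<le> M * L * norm (x - y)" by (simp add: mult.assoc)
    next
      show "AE y in lborel. (\<lambda>n. real (Suc n) * (F h (max e (N (y + ?e n *\<^sub>R v))) - F h (max e (N y))))
        \<longlonglongrightarrow> - (if e < N y then w h (N y) else 0) * DN v y"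
        using AE_N_neq[OF e] AE_N_neq[OF h]
      proof eventually_elim
        case (elim y)
        show ?case
        proof (rule DERIV_LIMSEQ_quotient[OF F_max_has_derivative[OF h e elim] _ DN_LIMSEQ])
          have "(\<lambda>n. y + ?e n *\<^sub>R v) \<longlonglongrightarrow> y + 0 *\<^sub>R v"
            using LIMSEQ_inverse_real_of_nat by (intro tendsto_intros) (simp add: inverse_eq_divide)
          then have "(\<lambda>n. y + ?e n *\<^sub>R v) \<longlonglongrightarrow> y" by simp
          then show "(\<lambda>n. N (y + ?e n *\<^sub>R v)) \<longlonglongrightarrow> N y"
            by (rule continuous_on_tendsto_compose[OF continuous_N[of UNIV]]) auto
        qed
      qed
    qed measurable
  qed
  have \<phi>i: "integrable lborel \<phi>"
    by (rule integrable_continuous_compact_support[OF test_function_continuous[OF \<phi>] test_functionD(1)[OF \<phi>]])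
      (rule test_function_outside)
  have di: "integrable lborel (\<lambda>y. frechet_derivative \<phi> (at y) v)"
    by (rule integrable_continuous_compact_support[OF test_functionD(4)[OF \<phi>] test_functionD(1)[OF \<phi>]])
      (rule test_function_deriv_outside[OF \<phi>])
  obtain B where B: "\<And>x. \<bar>\<phi> x\<bar> \<le> B" using test_function_bounded[OF \<phi>] by metis
  have nz: "AE y in lborel. y \<noteq> (0::'a)" by (rule AE_lborel_singleton)
  have ev: "\<forall>\<^sub>F n in sequentially. ?e n < N y" if "y \<noteq> 0" for y
    using order_tendstoD(2)[OF LIMSEQ_inverse_real_of_nat, of "N y"] that by (simp add: inverse_eq_divide)
  have lim1: "(\<lambda>n. LINT y|lborel. F h (max (?e n) (N y)) * frechet_derivative \<phi> (at y) v)
    \<longlonglongrightarrow> (LINT y|lborel. F h (N y) * frechet_derivative \<phi> (at y) v)"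
  proof (rule integral_dominated_convergence[where w="\<lambda>y. X h * \<bar>frechet_derivative \<phi> (at y) v\<bar>"])
    show "integrable lborel (\<lambda>y. X h * \<bar>frechet_derivative \<phi> (at y) v\<bar>)"
      using di by (intro integrable_mult_right integrable_abs)
    show "AE y in lborel. (\<lambda>n. F h (max (?e n) (N y)) * frechet_derivative \<phi> (at y) v) \<longlonglongrightarrow> F h (N y) * frechet_derivative \<phi> (at y) v"
      using nz
    proof eventually_elim
      case (elim y)
      show ?case by (rule tendsto_eventually, rule eventually_mono[OF ev[OF elim]]) (simp add: max_def)
    qed
    show "AE y in lborel. norm (F h (max (?e n) (N y)) * frechet_derivative \<phi> (at y) v) \<le> X h * \<bar>frechet_derivative \<phi> (at y) v\<bar>" for n
      using F_nonneg F_le_X[OF h]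
      by (intro AE_I2) (auto simp: abs_mult le_max_iff_disj intro!: mult_right_mono)
  qed measurable
  \<comment> \<open>Removing the cut-off on the derivative side is dominated by a multiple of w(N
    y), uniformly in n, since \<open>DN v\<close> is bounded by N v and \<phi> by
    \<open>B\<close>.\<close>
  have lim2: "(\<lambda>n. LINT y|lborel. (- (if ?e n < N y then w h (N y) else 0) * DN v y) * \<phi> y)
    \<longlonglongrightarrow> (LINT y|lborel. (- w h (N y) * DN v y) * \<phi> y)"
  proof (rule integral_dominated_convergence[where w="\<lambda>y. (N v * B) * w h (N y)"])
    show "integrable lborel (\<lambda>y. (N v * B) * w h (N y))"
      by (intro integrable_mult_right wN_integrable h)
    show "AE y in lborel. (\<lambda>n. (- (if ?e n < N y then w h (N y) else 0) * DN v y) * \<phi> y) \<longlonglongrightarrow> (- w h (N y) * DN v y) * \<phi> y"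
      using nz
    proof eventually_elim
      case (elim y)
      show ?case by (rule tendsto_eventually, rule eventually_mono[OF ev[OF elim]]) simp
    qed
    show "AE y in lborel. norm ((- (if ?e n < N y then w h (N y) else 0) * DN v y) * \<phi> y) \<le> (N v * B) * w h (N y)" for n
    proof (intro AE_I2)
      fix y
      have "\<bar>DN v y\<bar> * \<bar>\<phi> y\<bar> \<le> N v * B" by (intro mult_mono DN_bound B) auto
      then have "w h (N y) * (\<bar>DN v y\<bar> * \<bar>\<phi> y\<bar>) \<le> w h (N y) * (N v * B)" by (rule mult_left_mono) simp
      moreover have "0 \<le> w h (N y) * (N v * B)" using order_trans[OF abs_ge_zero B[of y]] by simp
      ultimately show "norm ((- (if ?e n < N y then w h (N y) else 0) * DN v y) * \<phi> y) \<le> (N v * B) * w h (N y)"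
        by (simp add: abs_mult mult_ac)
    qed
  qed measurable
  have "(LINT y|lborel. F h (N y) * frechet_derivative \<phi> (at y) v) = - (LINT y|lborel. (- w h (N y) * DN v y) * \<phi> y)"
    using LIMSEQ_unique[OF lim1] tendsto_minus[OF lim2] by (simp only: cut of_nat_0_less_iff zero_less_Suc zero_less_divide_1_iff)
  then show ?thesis by simp
qed

definition "G_ext h y = - w h (N y) *\<^sub>R VN y"

lemma VN_measurable [measurable]: "VN \<in> borel_measurable borel"
  unfolding VN_def by measurable

lemma G_ext_measurable [measurable]: "G_ext h \<in> borel_measurable borel"
  unfolding G_ext_def by measurable

lemma f_extremal_measurable: assumes "h > 0" shows "f_extremal C K p h \<in> borel_measurable borel"
proof -
  have "f_extremal C K p h = (\<lambda>y. indicator C y * F h (N y))" using f_extremal_eq[OF assms] by blast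
  then show ?thesis by simp
qed

lemma f_extremal_bounds:
  assumes "h > 0"
  shows "0 \<le> f_extremal C K p h y" "f_extremal C K p h y \<le> X h * indicator (E h) y"
proof -
  show "0 \<le> f_extremal C K p h y" using F_nonneg by (simp add: f_extremal_eq[OF assms])
  show "f_extremal C K p h y \<le> X h * indicator (E h) y"
    using F_le_X[OF assms, of "N y"] F_eq_0[of h "N y"]
    by (auto simp: f_extremal_eq[OF assms] E_eq[OF assms] indicator_def not_less)
qed

lemma f_extremal_integrable: assumes h: "h > 0" shows "integrable lborel (f_extremal C K p h)"
proof (rule Bochner_Integration.integrable_bound)
  show "integrable lborel (\<lambda>y. X h * indicator (E h) y)"
    using E_sets[OF h] by (intro integrable_mult_right integrable_real_indicator) (auto simp: emeasure_E[OF h])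
  show "AE y in lborel. norm (f_extremal C K p h y) \<le> norm (X h * indicator (E h) y)"
    using f_extremal_bounds[OF h] X_pos[OF h] by (intro AE_I2) (simp add: abs_mult)
  show "f_extremal C K p h \<in> borel_measurable lborel" using f_extremal_measurable[OF h] by simp
qed

lemma locally_integrable_of_integrable:
  assumes f: "integrable lborel (f :: 'a \<Rightarrow> 'b::{banach, second_countable_topology})"
  shows "locally_integrable \<Omega> f"
  unfolding locally_integrable_def
proof (intro allI impI)
  fix S assume "compact S \<and> S \<subseteq> \<Omega>"
  then have "S \<in> sets borel" by (auto simp: compact_imp_closed)
  moreover have "f \<in> borel_measurable borel" using f by auto
  moreover have "integrable lborel (\<lambda>x. indicator S x *\<^sub>R f x)"
    by (rule Bochner_Integration.integrable_bound[OF f]) (use calculation in \<open>auto simp: indicator_def\<close>)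
  ultimately show "set_integrable lebesgue S f"
    unfolding set_integrable_def by (subst integrable_completion) auto
qed

text \<open>The cone produces no boundary terms: a test function on C vanishes off C together with
  its derivative, so \<open>weak_derivative_radial\<close> on the whole space is the identity on
  C.\<close>

lemma has_weak_gradient_extremal:
  assumes h: "h > 0" shows "has_weak_gradient C (f_extremal C K p h) (G_ext h)"
  unfolding has_weak_gradient_def
proof (intro conjI allI impI ballI)
  show "locally_integrable C (f_extremal C K p h)"
    by (rule locally_integrable_of_integrable[OF f_extremal_integrable[OF h]])
  show "locally_integrable C (G_ext h)"
  proof (rule locally_integrable_of_integrable, rule Bochner_Integration.integrable_bound)
    show "integrable lborel (\<lambda>y. (\<Sum>b::'a\<in>Basis. N b) * w h (N y))"
      by (intro integrable_mult_right wN_integrable h)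
    show "AE y in lborel. norm (G_ext h y) \<le> norm ((\<Sum>b::'a\<in>Basis. N b) * w h (N y))"
    proof (intro AE_I2)
      fix y
      have "norm (VN y) \<le> (\<Sum>b\<in>Basis. norm (DN b y *\<^sub>R b))" unfolding VN_def by (rule norm_sum)
      also have "\<dots> \<le> (\<Sum>b::'a\<in>Basis. N b)" by (intro sum_mono) (simp add: DN_bound)
      finally have "w h (N y) * norm (VN y) \<le> w h (N y) * (\<Sum>b::'a\<in>Basis. N b)" by (rule mult_left_mono) simp
      moreover have "0 \<le> (\<Sum>b::'a\<in>Basis. N b)" by (simp add: sum_nonneg)
      ultimately show "norm (G_ext h y) \<le> norm ((\<Sum>b::'a\<in>Basis. N b) * w h (N y))"
        by (simp add: G_ext_def abs_mult mult.commute)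
    qed
  qed measurable
next
  fix \<phi> :: "'a \<Rightarrow> real" and b :: 'a assume \<phi>: "test_function C \<phi>" and b: "b \<in> Basis"
  note [measurable] = test_function_measurable[OF \<phi>] borel_measurable_continuous_onI[OF test_functionD(4)[OF \<phi>], of b]
  have out: "\<phi> y = 0" "frechet_derivative \<phi> (at y) b = 0" if "y \<notin> C" for y
    using that test_functionD(2)[OF \<phi>] test_function_outside[of y \<phi>] test_function_deriv_outside[OF \<phi>, of y b] by blast+
  have 1: "indicator C y *\<^sub>R (f_extremal C K p h y * frechet_derivative \<phi> (at y) b) = F h (N y) * frechet_derivative \<phi> (at y) b" for y
    using out(2)[of y] by (cases "y \<in> C") (auto simp: f_extremal_eq[OF h])
  have 2: "indicator C y *\<^sub>R ((G_ext h y \<bullet> b) * \<phi> y) = - (w h (N y) * DN b y * \<phi> y)" for y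
    using out(1)[of y] by (cases "y \<in> C") (auto simp: G_ext_def VN_inner_Basis[OF b])
  have "(LINT x:C|lebesgue. f_extremal C K p h x * frechet_derivative \<phi> (at x) b)
      = (LINT y|lborel. F h (N y) * frechet_derivative \<phi> (at y) b)"
    unfolding set_lebesgue_integral_def 1 by (rule integral_completion) measurable
  also have "\<dots> = (LINT y|lborel. w h (N y) * DN b y * \<phi> y)" by (rule weak_derivative_radial[OF h \<phi>])
  also have "\<dots> = - (LINT x:C|lebesgue. (G_ext h x \<bullet> b) * \<phi> x)"
    unfolding set_lebesgue_integral_def 2 by (subst integral_completion) auto
  finally show "(LINT x:C|lebesgue. f_extremal C K p h x * frechet_derivative \<phi> (at x) b)
      = - (LINT x:C|lebesgue. (G_ext h x \<bullet> b) * \<phi> x)" .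
qed

lemma dual_G_ext: "AE y in lborel. N' (G_ext h y) = w h (N y)"
  using dual_VN
proof eventually_elim
  case (elim y)
  have "N' (G_ext h y) = N' (w h (N y) *\<^sub>R VN y)" unfolding G_ext_def by simp
  then show ?case using elim by (simp add: dual_scaleR)
qed

end

subsection \<open>Norms of the extremal function\<close>

text \<open>The fundamental lemma with bound 0, applied to each component in both orders. It
  transfers computations for \<open>G_ext\<close> to an arbitrary weak gradient.\<close>

lemma weak_gradient_unique:
  assumes "open \<Omega>" and wg: "has_weak_gradient \<Omega> f G1" "has_weak_gradient \<Omega> f G2"
  shows "AE x in lebesgue. x \<in> \<Omega> \<longrightarrow> G1 x = G2 x"
proof -
  have component: "AE x in lebesgue. x \<in> \<Omega> \<longrightarrow> (G1 x - G2 x) \<bullet> b \<le> 0"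
    if wg: "has_weak_gradient \<Omega> f G1" "has_weak_gradient \<Omega> f G2" for G1 G2 b
  proof (rule AE_le_of_test_functions[OF assms(1)])
    show "locally_integrable \<Omega> (\<lambda>x. (G1 x - G2 x) \<bullet> b)"
      unfolding locally_integrable_def
    proof (intro allI impI)
      fix S assume "compact S \<and> S \<subseteq> \<Omega>"
      then have "set_integrable lebesgue S G1" "set_integrable lebesgue S G2"
        using wg by (auto simp: has_weak_gradient_def locally_integrable_def)
      then have "set_integrable lebesgue S (\<lambda>x. G1 x - G2 x)" by (rule set_integral_diff(1))
      then have "integrable lebesgue (\<lambda>x. (indicator S x *\<^sub>R (G1 x - G2 x)) \<bullet> b)"
        unfolding set_integrable_def by (rule integrable_inner_left)
      then show "set_integrable lebesgue S (\<lambda>x. (G1 x - G2 x) \<bullet> b)" by (simp add: set_integrable_def)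
    qed
    fix \<phi> assume \<phi>: "test_function \<Omega> \<phi>"
    note w1 = weak_gradient_direction[OF wg(1) \<phi>, of b] and w2 = weak_gradient_direction[OF wg(2) \<phi>, of b]
    have "(LINT x:\<Omega>|lebesgue. (G1 x - G2 x) \<bullet> b * \<phi> x)
      = (LINT x|lebesgue. indicator \<Omega> x * ((G1 x \<bullet> b) * \<phi> x) - indicator \<Omega> x * ((G2 x \<bullet> b) * \<phi> x))"
      unfolding set_lebesgue_integral_def by (simp add: inner_diff_left algebra_simps)
    also have "\<dots> = 0" using w1 w2 by (subst Bochner_Integration.integral_diff) auto
    finally show "(LINT x:\<Omega>|lebesgue. (G1 x - G2 x) \<bullet> b * \<phi> x) \<le> 0 * (LINT x|lebesgue. \<phi> x)" by simp
  qed
  have "AE x in lebesgue. \<forall>b\<in>Basis. x \<in> \<Omega> \<longrightarrow> (G1 x - G2 x) \<bullet> b = 0"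
  proof (rule AE_finite_allI[OF finite_Basis])
    fix b :: 'a
    show "AE x in lebesgue. x \<in> \<Omega> \<longrightarrow> (G1 x - G2 x) \<bullet> b = 0"
      using component[OF wg, of b] component[OF wg(2,1), of b]
      by eventually_elim (auto simp: inner_diff_left)
  qed
  then show ?thesis
  proof eventually_elim
    case (elim x)
    show ?case
    proof
      assume x: "x \<in> \<Omega>"
      show "G1 x = G2 x"
      proof (rule euclidean_eqI)
        fix b :: 'a assume "b \<in> Basis"
        then have "(G1 x - G2 x) \<bullet> b = 0" using elim x by blast
        then show "G1 x \<bullet> b = G2 x \<bullet> b" by (simp only: inner_diff_left right_minus_eq)
      qed
    qed
  qed
qed

text \<open>For finite p, Minkowski's inequality is bypassed: the sum is at most
  \<open>card B\<close> times its largest term, whose P-th power is at most the sum of all P-th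
  powers. This loses a constant, but only finiteness is wanted.\<close>

lemma Lp_norm_finite_if_le_sum:
  assumes p: "p \<noteq> 0" and B: "finite B" and v: "v \<in> borel_measurable M"
    and u: "\<And>b. b \<in> B \<Longrightarrow> u b \<in> borel_measurable M" "\<And>b. b \<in> B \<Longrightarrow> Lp_norm p M (u b) < \<infinity>"
    and c: "\<And>b. b \<in> B \<Longrightarrow> 0 \<le> c b" and le: "AE x in M. \<bar>v x\<bar> \<le> (\<Sum>b\<in>B. c b * \<bar>u b x\<bar>)"
  shows "Lp_norm p M v < \<infinity>"
proof (cases "p = \<infinity>")
  case True
  define s where "s b = esssup M (\<lambda>x. ennreal \<bar>u b x\<bar>)" for b
  have s: "s b < \<infinity>" if "b \<in> B" for b using u(2)[OF that] True by (simp add: s_def Lp_norm_def)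
  have "AE x in M. \<forall>b\<in>B. ennreal \<bar>u b x\<bar> \<le> s b"
    by (rule AE_finite_allI[OF B]) (auto simp: s_def intro: esssup_AE)
  with le have "AE x in M. ennreal \<bar>v x\<bar> \<le> (\<Sum>b\<in>B. ennreal (c b) * s b)"
  proof eventually_elim
    case (elim x)
    have "ennreal \<bar>v x\<bar> \<le> ennreal (\<Sum>b\<in>B. c b * \<bar>u b x\<bar>)" using elim(1) by (rule ennreal_leI)
    also have "\<dots> = (\<Sum>b\<in>B. ennreal (c b) * ennreal \<bar>u b x\<bar>)"
      using c by (subst sum_ennreal[symmetric]) (auto simp: ennreal_mult' intro!: sum.cong)
    also have "\<dots> \<le> (\<Sum>b\<in>B. ennreal (c b) * s b)" using elim(2) by (intro sum_mono mult_left_mono) auto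
    finally show ?case .
  qed
  then have "esssup M (\<lambda>x. ennreal \<bar>v x\<bar>) \<le> (\<Sum>b\<in>B. ennreal (c b) * s b)"
    using v by (intro esssup_I) auto
  also have "\<dots> < \<infinity>" using s B by (auto simp: ennreal_mult_less_top)
  finally show ?thesis using True by (simp add: Lp_norm_def)
next
  case False
  define P where "P = enn2real p"
  have P: "P > 0" using p False unfolding P_def by (cases p) (auto simp: zero_less_iff_neq_zero)
  have fin: "(\<integral>\<^sup>+x. ennreal (\<bar>u b x\<bar> powr P) \<partial>M) < \<infinity>" if "b \<in> B" for b
    using u(2)[OF that] False by (auto simp: Lp_norm_def P_def epowr_def less_top split: if_splits)
  have "(\<integral>\<^sup>+x. ennreal (\<bar>v x\<bar> powr P) \<partial>M)
    \<le> (\<integral>\<^sup>+x. (\<Sum>b\<in>B. ennreal ((card B * c b) powr P) * ennreal (\<bar>u b x\<bar> powr P)) \<partial>M)"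
  proof (rule nn_integral_mono_AE)
    show "AE x in M. ennreal (\<bar>v x\<bar> powr P) \<le> (\<Sum>b\<in>B. ennreal ((card B * c b) powr P) * ennreal (\<bar>u b x\<bar> powr P))"
      using le
    proof eventually_elim
      case (elim x)
      show ?case
      proof (cases "B = {}")
        case True
        then show ?thesis using elim by simp
      next
        case nonempty: False
        define t where "t = Max ((\<lambda>b. c b * \<bar>u b x\<bar>) ` B)"
        have fB: "finite ((\<lambda>b. c b * \<bar>u b x\<bar>) ` B)" "(\<lambda>b. c b * \<bar>u b x\<bar>) ` B \<noteq> {}" using B nonempty by auto
        obtain b where b: "b \<in> B" "t = c b * \<bar>u b x\<bar>" using Max_in[OF fB] by (auto simp: t_def)
        have "(\<Sum>b\<in>B. c b * \<bar>u b x\<bar>) \<le> card B * t"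
          using sum_bounded_above[of B "\<lambda>b. c b * \<bar>u b x\<bar>" t] Max_ge[OF fB(1)] by (auto simp: t_def)
        then have "\<bar>v x\<bar> \<le> (card B * c b) * \<bar>u b x\<bar>" using elim b(2) by (simp add: mult.assoc)
        then have "\<bar>v x\<bar> powr P \<le> ((card B * c b) * \<bar>u b x\<bar>) powr P" using P by (intro powr_mono2) auto
        also have "\<dots> = (card B * c b) powr P * \<bar>u b x\<bar> powr P" by (rule powr_mult)
        finally have "ennreal (\<bar>v x\<bar> powr P) \<le> ennreal ((card B * c b) powr P) * ennreal (\<bar>u b x\<bar> powr P)"
          by (simp add: ennreal_mult'[symmetric] ennreal_leI)
        also have "\<dots> \<le> (\<Sum>b\<in>B. ennreal ((card B * c b) powr P) * ennreal (\<bar>u b x\<bar> powr P))"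
          using b(1) B by (intro member_le_sum) auto
        finally show ?thesis .
      qed
    qed
  qed
  also have "\<dots> = (\<Sum>b\<in>B. ennreal ((card B * c b) powr P) * (\<integral>\<^sup>+x. ennreal (\<bar>u b x\<bar> powr P) \<partial>M))"
    using u(1) by (subst nn_integral_sum) (auto intro!: sum.cong nn_integral_cmult)
  also have "\<dots> < \<infinity>" using fin B by (auto simp: ennreal_mult_less_top)
  finally show ?thesis using False by (simp add: Lp_norm_def epowr_def P_def)
qed

lemma AE_contradiction_on_positive_measure:
  assumes "AE x in M. P x" "A \<in> sets M" "emeasure M A > 0" "\<And>x. x \<in> A \<Longrightarrow> \<not> P x"
  shows False
proof -
  have "AE x in M. x \<notin> A" using assms(1) by eventually_elim (use assms(4) in auto)
  then have "emeasure M A = 0" using AE_iff_measurable[of A M "\<lambda>x. x \<notin> A"] assms(2) sets.sets_into_space by fastforce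
  then show False using assms(3) by simp
qed

text \<open>Partial sums of the indicators of disjoint sets stay between 0 and 1, so |f| dominates
  them and f may have either sign.\<close>

lemma charge_set_integral:
  assumes f: "integrable M (f :: 'a \<Rightarrow> real)" shows "charge M (\<lambda>E. LINT x:E|M. f x)"
  unfolding charge_def
proof (intro conjI allI impI)
  fix A :: "nat \<Rightarrow> 'a set"
  assume A: "range A \<subseteq> sets M \<and> disjoint_family A"
  then have Am[measurable]: "A i \<in> sets M" for i by auto
  have [measurable]: "f \<in> borel_measurable M" using f by auto
  have Ai: "integrable M (\<lambda>x. indicator (A i) x *\<^sub>R f x)" for i
    using integrable_mult_indicator[OF Am f] .
  have part: "(\<Sum>i<n. LINT x:A i|M. f x) = (LINT x|M. (\<Sum>i<n. indicator (A i) x) * f x)" for n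
    unfolding set_lebesgue_integral_def
    using Ai by (subst Bochner_Integration.integral_sum[symmetric]) (auto simp: sum_distrib_right)
  have ind: "(\<lambda>i. indicator (A i) x :: real) sums indicator (\<Union>i. A i) x" for x
    using A by (intro indicator_sums) (auto simp: disjoint_family_on_def)
  have bound: "\<bar>\<Sum>i<n. indicator (A i) x :: real\<bar> \<le> 1" for n x
  proof -
    have "(\<Sum>i<n. indicator (A i) x :: real) \<le> indicator (\<Union>i. A i) x"
      unfolding sums_unique[OF ind[of x]] by (rule sum_le_suminf) (use ind in \<open>auto simp: sums_iff\<close>)
    also have "\<dots> \<le> 1" by (simp add: indicator_def)
    finally show ?thesis by (simp add: sum_nonneg)
  qed
  have "(\<lambda>n. LINT x|M. (\<Sum>i<n. indicator (A i) x) * f x) \<longlonglongrightarrow> (LINT x|M. indicator (\<Union>i. A i) x * f x)"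
  proof (rule integral_dominated_convergence[where w="\<lambda>x. \<bar>f x\<bar>"])
    show "AE x in M. (\<lambda>n. (\<Sum>i<n. indicator (A i) x) * f x) \<longlonglongrightarrow> indicator (\<Union>i. A i) x * f x"
      using ind by (intro AE_I2 tendsto_mult_right) (simp add: sums_def)
    show "AE x in M. norm ((\<Sum>i<n. indicator (A i) x) * f x) \<le> \<bar>f x\<bar>" for n
      using mult_right_mono[OF bound] by (intro AE_I2) (simp add: abs_mult)
  qed (use f in auto)
  then show "(\<lambda>i. LINT x:A i|M. f x) sums (LINT x:(\<Union>i. A i)|M. f x)"
    unfolding sums_def part by (simp add: set_lebesgue_integral_def)
qed (simp add: set_lebesgue_integral_def)

context extremal_problem
begin

lemma F_LIMSEQ:
  assumes h: "h > 0" shows "(\<lambda>n. F h (1 / Suc n)) \<longlonglongrightarrow> X h"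
proof -
  have "(\<lambda>n. LINT u|lborel. (if 1 / Suc n < u then w h u else 0)) \<longlonglongrightarrow> (LINT u|lborel. w h u)"
  proof (rule integral_dominated_convergence[where w="w h"])
    show "AE u in lborel. (\<lambda>n. if 1 / Suc n < u then w h u else 0) \<longlonglongrightarrow> w h u"
    proof (intro AE_I2)
      fix u :: real
      show "(\<lambda>n. if 1 / Suc n < u then w h u else 0) \<longlonglongrightarrow> w h u"
      proof (cases "u > 0")
        case True
        then have ev: "\<forall>\<^sub>F n in sequentially. 1 / Suc n < u"
          using order_tendstoD(2)[OF LIMSEQ_inverse_real_of_nat, of u] by (simp add: inverse_eq_divide)
        show ?thesis by (rule tendsto_eventually, rule eventually_mono[OF ev]) (simp only: if_True)
      next
        case False
        then have w0: "w h u = 0" by (simp add: w_def)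
        show ?thesis unfolding w0 by simp
      qed
    qed
  qed (use w_integrable[OF h] in auto)
  then show ?thesis using integral_w[OF h] by (simp add: F_def)
qed

lemma f_extremal_indicator: "h > 0 \<Longrightarrow> indicator C y * f_extremal C K p h y = f_extremal C K p h y"
  by (simp add: f_extremal_eq indicator_def)

lemma emeasure_E_pos: "h > 0 \<Longrightarrow> emeasure lborel (E h) > 0"
  using m_pos by (simp add: emeasure_E)

text \<open>The supremum is approached at the vertex, which need not belong to C. On the section
  \<open>E (1/(n+1))\<close>, of positive measure, the function is at least F(1/(n+1)), and these
  values tend to \<open>X h\<close>.\<close>

lemma Linf_extremal:
  assumes h: "h > 0" shows "Lp_norm \<infinity> (lebesgue_on C) (f_extremal C K p h) = ennreal (X h)"
proof -
  let ?f = "f_extremal C K p h"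
  note [measurable] = f_extremal_measurable[OF h]
  have eq: "Lp_norm \<infinity> (lebesgue_on C) ?f = esssup lborel (\<lambda>y. ennreal \<bar>?f y\<bar>)"
  proof -
    have "Lp_norm \<infinity> (lebesgue_on C) ?f = Lp_norm \<infinity> lborel ?f"
    proof (rule Lp_norm_lebesgue_on[OF C_sets])
      show "(\<lambda>y. indicator C y * ?f y) \<in> borel_measurable lebesgue"
        unfolding f_extremal_indicator[OF h] by (rule measurable_completion) simp
    qed (simp_all add: f_extremal_indicator[OF h])
    then show ?thesis by (simp add: Lp_norm_def)
  qed
  show ?thesis unfolding eq
  proof (rule antisym)
    have "\<bar>?f y\<bar> \<le> X h" for y
      using f_extremal_bounds[OF h, of y] X_pos[OF h] by (cases "y \<in> E h") auto
    then show "esssup lborel (\<lambda>y. ennreal \<bar>?f y\<bar>) \<le> ennreal (X h)"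
      by (intro esssup_I AE_I2 ennreal_leI) auto
    have "ennreal (F h (1 / Suc n)) \<le> esssup lborel (\<lambda>y. ennreal \<bar>?f y\<bar>)" for n
    proof (rule ccontr)
      let ?s = "1 / real (Suc n)"
      assume less: "\<not> ennreal (F h ?s) \<le> esssup lborel (\<lambda>y. ennreal \<bar>?f y\<bar>)"
      have "AE y in lborel. ennreal \<bar>?f y\<bar> \<le> esssup lborel (\<lambda>y. ennreal \<bar>?f y\<bar>)" by (rule esssup_AE)
      then show False
      proof (rule AE_contradiction_on_positive_measure[where A="E ?s"])
        show "E ?s \<in> sets lborel" "0 < emeasure lborel (E ?s)" using emeasure_E_pos[of ?s] by auto
        fix y assume "y \<in> E ?s"
        then have "y \<in> C" "N y < ?s" using E_eq[of ?s] by auto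
        then have "F h ?s \<le> \<bar>?f y\<bar>" using F_antimono[OF h, of "N y" ?s] by (simp add: f_extremal_eq[OF h])
        then have "ennreal (F h ?s) \<le> ennreal \<bar>?f y\<bar>" by (rule ennreal_leI)
        then show "\<not> ennreal \<bar>?f y\<bar> \<le> esssup lborel (\<lambda>y. ennreal \<bar>?f y\<bar>)" using less order_trans by blast
      qed
    qed
    then show "ennreal (X h) \<le> esssup lborel (\<lambda>y. ennreal \<bar>?f y\<bar>)"
      by (intro LIMSEQ_le_const2[OF tendsto_ennrealI[OF F_LIMSEQ[OF h]]]) auto
  qed
qed

text \<open>Since (q - 1) p = q, the p-th power of the weight is the q-th power of the kernel, with
  integral \<open>I h\<close>. This is the equality case of Hoelder's inequality. For p infinite
  both sides are 1.\<close>

lemma Lp_norm_radial_weight: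
  assumes h: "h > 0"
  shows "Lp_norm p lborel (\<lambda>y. indicator C y * w h (N y)) = ennreal (I h powr r)"
proof -
  have nz: "AE y in lborel. y \<noteq> (0::'a)" by (rule AE_lborel_singleton)
  show ?thesis
  proof (cases rule: p_cases)
    case 1
    \<comment> \<open>For q = 1 the weight is the indicator of the open interval (0, h), so the
      origin has to be left out of \<open>E h\<close>.\<close>
    have w1: "indicator C y * w h (N y) = indicator (E h - {0}) y" for y
      using g_pos[of "N y" h] N_pos_iff[of y] unfolding w_def 1(2) E_eq[OF h]
      by (auto simp: indicator_def less_imp_neq[THEN not_sym])
    have "esssup lborel (\<lambda>y. ennreal \<bar>indicator (E h - {0}) y\<bar>) = 1"
    proof (rule antisym)
      show "esssup lborel (\<lambda>y. ennreal \<bar>indicator (E h - {0}) y\<bar>) \<le> 1"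
      proof (rule esssup_I)
        have "E h - {0} \<in> sets borel" using E_sets[OF h] by simp
        then show "(\<lambda>y. ennreal \<bar>indicator (E h - {0}) y\<bar>) \<in> borel_measurable lborel" by simp
      qed (auto simp: indicator_def)
      show "1 \<le> esssup lborel (\<lambda>y. ennreal \<bar>indicator (E h - {0}) y\<bar>)" (is "1 \<le> ?s")
      proof (rule ccontr)
        assume less: "\<not> 1 \<le> ?s"
        have "AE y in lborel. ennreal \<bar>indicator (E h - {0}) y\<bar> \<le> ?s" by (rule esssup_AE)
        with nz have "AE y in lborel. y \<noteq> 0 \<and> ennreal \<bar>indicator (E h - {0}) y\<bar> \<le> ?s" by eventually_elim simp
        then show False
        proof (rule AE_contradiction_on_positive_measure[where A="E h"])
          show "E h \<in> sets lborel" "0 < emeasure lborel (E h)" using emeasure_E_pos[OF h] E_sets[OF h] by auto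
          show "\<not> (y \<noteq> 0 \<and> ennreal \<bar>indicator (E h - {0}) y\<bar> \<le> ?s)" if "y \<in> E h" for y
            using that less by (auto simp: indicator_def)
        qed
      qed
    qed
    then have "Lp_norm p lborel (\<lambda>y. indicator C y * w h (N y)) = 1"
      unfolding Lp_norm_def w1 using 1(1) by simp
    moreover have "I h powr r = 1" unfolding 1(3) using I_pos[OF h] by simp
    ultimately show ?thesis by simp
  next
    case (2 P)
    have e: "(q - 1) * P = q" using 2(4,5) by (simp add: field_simps)
    have "(\<integral>\<^sup>+y. ennreal (\<bar>indicator C y * w h (N y)\<bar> powr P) \<partial>lborel)
      = (\<integral>\<^sup>+y. ennreal (g h (N y) powr q) * indicator (E h) y \<partial>lborel)"
    proof (rule nn_integral_cong_AE)
      show "AE y in lborel. ennreal (\<bar>indicator C y * w h (N y)\<bar> powr P) = ennreal (g h (N y) powr q) * indicator (E h) y"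
        using nz
      proof eventually_elim
        case (elim y)
        show ?case
        proof (cases "y \<in> C \<and> N y < h")
          case True
          then have "y \<in> E h" using E_eq[OF h] by blast
          then show ?thesis using True elim e by (simp add: w_def powr_powr)
        next
          case False
          then have "y \<notin> E h" using E_eq[OF h] by blast
          then show ?thesis using False by (auto simp: w_def)
        qed
      qed
    qed
    also have "\<dots> = ennreal (I h)" by (rule nn_integral_g_powr_q[OF h])
    finally have int: "(\<integral>\<^sup>+y. ennreal (\<bar>indicator C y * w h (N y)\<bar> powr P) \<partial>lborel) = ennreal (I h)" .
    show ?thesis
      unfolding Lp_norm_def if_not_P[OF 2(1)] 2(2) int 2(6) using I_pos[OF h] by (simp add: epowr_def)
  qed
qed

lemma Lp_norm_gradient_extremal:
  assumes h: "h > 0" and wg: "has_weak_gradient C (f_extremal C K p h) G"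
  shows "Lp_norm p (lebesgue_on C) (\<lambda>x. N' (G x)) = ennreal (I h powr r)"
proof -
  have "AE y in lborel. indicator C y * w h (N y) = indicator C y * N' (G y)"
    using weak_gradient_unique[OF open_C wg has_weak_gradient_extremal[OF h]] dual_G_ext[of h]
    unfolding AE_completion_iff by eventually_elim (auto simp: indicator_def)
  then have "Lp_norm p (lebesgue_on C) (\<lambda>x. N' (G x)) = Lp_norm p lborel (\<lambda>y. indicator C y * w h (N y))"
    by (intro Lp_norm_lebesgue_on[OF C_sets dual_gradient_measurable[OF wg] _ _ p_nonzero]) auto
  then show ?thesis by (simp only: Lp_norm_radial_weight[OF h])
qed

lemma f_extremal_sobolev:
  assumes h: "h > 0" shows "f_extremal C K p h \<in> sobolev_W1 p C"
  unfolding sobolev_W1_def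
proof (intro CollectI conjI exI[of _ "G_ext h"] ballI)
  show wg: "has_weak_gradient C (f_extremal C K p h) (G_ext h)" by (rule has_weak_gradient_extremal[OF h])
  then show "locally_integrable C (f_extremal C K p h)" by (simp add: has_weak_gradient_def)
  fix b :: 'a assume b: "b \<in> Basis"
  have Gm: "(\<lambda>x. G_ext h x \<bullet> b) \<in> borel_measurable borel" by measurable
  then have "(\<lambda>x. G_ext h x \<bullet> b) \<in> borel_measurable lebesgue" by (intro measurable_completion) simp
  then have m: "(\<lambda>x. G_ext h x \<bullet> b) \<in> borel_measurable (lebesgue_on C)" by (rule measurable_restrict_space1)
  have eq: "Lp_norm p (lebesgue_on C) (\<lambda>x. G_ext h x \<bullet> b) = Lp_norm p lborel (\<lambda>x. indicator C x * (G_ext h x \<bullet> b))"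
  proof (rule Lp_norm_lebesgue_on[OF C_sets _ _ _ p_nonzero])
    have "(\<lambda>x. indicator C x * (G_ext h x \<bullet> b)) \<in> borel_measurable lborel" by measurable
    then show "(\<lambda>x. indicator C x * (G_ext h x \<bullet> b)) \<in> borel_measurable lebesgue" by (rule measurable_completion)
    show "(\<lambda>x. indicator C x * (G_ext h x \<bullet> b)) \<in> borel_measurable borel" by measurable
  qed simp
  have "Lp_norm p lborel (\<lambda>x. indicator C x * (G_ext h x \<bullet> b)) < \<infinity>"
  \<comment> \<open>A one-element index set, since the single function w(N y) controls the
    component.\<close>
  proof (rule Lp_norm_finite_if_le_sum[where B="{()}" and u="\<lambda>_ y. indicator C y * w h (N y)" and c="\<lambda>_. N b"])
    show "AE x in lborel. \<bar>indicator C x * (G_ext h x \<bullet> b)\<bar> \<le> (\<Sum>_\<in>{()}. N b * \<bar>indicator C x * w h (N x)\<bar>)"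
      using DN_bound[of b] by (intro AE_I2) (auto simp: G_ext_def VN_inner_Basis[OF b] abs_mult indicator_def mult.commute intro!: mult_right_mono)
  qed (use p_nonzero Lp_norm_radial_weight[OF h] in auto)
  then show "(\<lambda>x. G_ext h x \<bullet> b) \<in> Lp_space p (lebesgue_on C)" using m eq by (simp add: Lp_space_def)
qed

lemma f_extremal_integrable_on: assumes h: "h > 0" shows "integrable (lebesgue_on C) (f_extremal C K p h)"
proof -
  have "integrable lebesgue (f_extremal C K p h)"
    using f_extremal_integrable[OF h] by (subst integrable_completion) (auto simp: f_extremal_measurable[OF h])
  then show ?thesis
    by (subst integrable_restrict_space) (auto simp: f_extremal_indicator[OF h])
qed

text \<open>Keeps the equality statements, which quantify over charges with this density, from being
  vacuous.\<close>

lemma ex_charge_extremal: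
  assumes h: "h > 0" shows "\<exists>\<nu>. \<nu> \<in> ac_charges C \<and> has_RN_deriv C \<nu> (f_extremal C K p h)"
proof -
  let ?M = "lebesgue_on C" and ?f = "f_extremal C K p h"
  let ?\<nu> = "\<lambda>E. LINT x:E|?M. ?f x"
  have "?\<nu> E = 0" if "E \<in> null_sets ?M" for E
  proof -
    have "AE x in ?M. x \<notin> E" using that by (rule AE_not_in)
    then have "AE x in ?M. indicator E x *\<^sub>R ?f x = 0" by eventually_elim simp
    then show ?thesis unfolding set_lebesgue_integral_def by (rule integral_eq_zero_AE)
  qed
  then have "?\<nu> \<in> ac_charges C \<and> has_RN_deriv C ?\<nu> ?f"
    using charge_set_integral[OF f_extremal_integrable_on[OF h]] f_extremal_integrable_on[OF h]
    by (simp add: ac_charges_def has_RN_deriv_def)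
  then show ?thesis by blast
qed

text \<open>The total mass of the extremal charge: the volume of \<open>E h\<close> times the mean
  found in \<open>nn_integral_Y\<close>.\<close>

definition "V_ext h = m * h ^ DIM('a) * ((1 / DIM('a) - r) * I h)"

lemma V_ext_pos: "h > 0 \<Longrightarrow> V_ext h > 0"
  using m_pos I_pos[of h] r_less by (simp add: V_ext_def)

text \<open>Integration over level sets: exchanging the integrals over y and u leaves the weight at
  u times the volume of \<open>E u\<close>.\<close>

lemma integral_f_extremal:
  assumes h: "h > 0" shows "(LINT y|lborel. f_extremal C K p h y) = V_ext h"
proof -
  have Fn: "ennreal (F h v) = (\<integral>\<^sup>+u. ennreal (if v < u then w h u else 0) \<partial>lborel)" for v
    unfolding F_def using w_part_integrable[OF h] by (intro nn_integral_eq_integral[symmetric]) auto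
  have "(\<integral>\<^sup>+y. ennreal (f_extremal C K p h y) \<partial>lborel)
    = (\<integral>\<^sup>+y. \<integral>\<^sup>+u. indicator C y * ennreal (if N y < u then w h u else 0) \<partial>lborel \<partial>lborel)"
    by (intro nn_integral_cong) (auto simp: f_extremal_eq[OF h] Fn nn_integral_cmult indicator_def)
  also have "\<dots> = (\<integral>\<^sup>+u. \<integral>\<^sup>+y. indicator C y * ennreal (if N y < u then w h u else 0) \<partial>lborel \<partial>lborel)"
    by (rule lborel_pair.Fubini') measurable
  also have "\<dots> = (\<integral>\<^sup>+u. ennreal (m * h ^ DIM('a)) * (ennreal (g h u powr (q - 1) * (u / h) ^ DIM('a)) * indicator {0<..<h} u) \<partial>lborel)"
  proof (rule nn_integral_cong)
    fix u :: real
    show "(\<integral>\<^sup>+y. indicator C y * ennreal (if N y < u then w h u else 0) \<partial>lborel)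
      = ennreal (m * h ^ DIM('a)) * (ennreal (g h u powr (q - 1) * (u / h) ^ DIM('a)) * indicator {0<..<h} u)"
    proof (cases "0 < u \<and> u < h")
      case True
      then have u: "u > 0" by simp
      have "(\<integral>\<^sup>+y. indicator C y * ennreal (if N y < u then w h u else 0) \<partial>lborel) = (\<integral>\<^sup>+y. ennreal (w h u) * indicator (E u) y \<partial>lborel)"
        unfolding E_eq[OF u] by (intro nn_integral_cong) (auto simp: indicator_def)
      also have "\<dots> = ennreal (w h u) * ennreal (m * u ^ DIM('a))"
        using E_sets[OF u] by (subst nn_integral_cmult_indicator) (auto simp: emeasure_E[OF u])
      also have "\<dots> = ennreal (w h u * (m * u ^ DIM('a)))" by (rule ennreal_mult'[symmetric]) simp
      also have "w h u * (m * u ^ DIM('a)) = m * h ^ DIM('a) * (g h u powr (q - 1) * (u / h) ^ DIM('a))"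
        using True h by (simp add: w_def power_divide)
      also have "ennreal \<dots> = ennreal (m * h ^ DIM('a)) * ennreal (g h u powr (q - 1) * (u / h) ^ DIM('a))"
        using m_pos h by (intro ennreal_mult') simp
      finally show ?thesis using True by simp
    next
      case False
      then have ind0: "indicator {0<..<h} u = (0::ennreal)" and w0: "w h u = 0" by (auto simp: w_def)
      show ?thesis unfolding ind0 w0 by simp
    qed
  qed
  also have "\<dots> = ennreal (m * h ^ DIM('a)) * ennreal ((1 / DIM('a) - r) * I h)"
    by (subst nn_integral_cmult) (auto simp: nn_integral_Y[OF h])
  also have "\<dots> = ennreal (V_ext h)" unfolding V_ext_def using m_pos h by (intro ennreal_mult'[symmetric]) simp
  finally show ?thesis
    using V_ext_pos[OF h] f_extremal_bounds(1)[OF h] f_extremal_measurable[OF h]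
    by (subst integral_eq_nn_integral) auto
qed

text \<open>The density is nonnegative, so no translated section of any size carries more than the
  total mass. Conversely, x + \<open>E h\<close> with x in C tending to 0 along a ray exhausts the
  mass, as \<open>E h\<close> is open and supports the density. Hence both norms equal
  \<open>V_ext h\<close>.\<close>

lemma charge_norms_extremal:
  assumes h: "h > 0" and \<nu>: "has_RN_deriv C \<nu> (f_extremal C K p h)"
  shows "charge_norm_h C K h \<nu> = ennreal (V_ext h)" "charge_norm C K \<nu> = ennreal (V_ext h)"
proof -
  let ?f = "f_extremal C K p h"
  note [measurable] = f_extremal_measurable[OF h]
  have val: "\<nu> ((+) x ` E s) = (LINT y|lborel. indicator (E s) y * ?f (x + y))" if "x \<in> C" "s > 0" for x s
    by (rule charge_translate[OF \<nu> f_extremal_measurable[OF h] _ that]) (simp add: f_extremal_indicator[OF h])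
  have upper: "\<bar>\<nu> ((+) x ` E s)\<bar> \<le> V_ext h" if "x \<in> C" "s > 0" for x s
  proof -
    have "0 \<le> \<nu> ((+) x ` E s)" unfolding val[OF that]
      using f_extremal_bounds(1)[OF h] by (intro Bochner_Integration.integral_nonneg) simp
    moreover have "\<nu> ((+) x ` E s) \<le> (LINT y|lborel. ?f (y + x))"
      unfolding val[OF that]
    proof (rule integral_mono')
      have "integrable (distr lborel borel ((+) x)) ?f" using f_extremal_integrable[OF h] by (simp add: lborel_distr_plus)
      then show "integrable lborel (\<lambda>y. ?f (y + x))"
        by (subst (asm) integrable_distr_eq) (auto simp: add.commute)
    qed (use f_extremal_bounds(1)[OF h] in \<open>auto simp: indicator_def add.commute\<close>)
    moreover have "(LINT y|lborel. ?f (y + x)) = V_ext h"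
      unfolding integral_f_extremal[OF h, symmetric] by (rule integral_lborel_translate) measurable
    ultimately show ?thesis by simp
  qed
  obtain e where e: "e \<in> C" using cone_C by (auto simp: positive_cone_def)
  let ?x = "\<lambda>n. (1 / real (Suc n)) *\<^sub>R e"
  have x: "?x n \<in> C" for n by (rule C_scaleR[OF e]) simp
  have E_borel[measurable]: "E h \<in> sets borel" by (rule E_sets[OF h])
  have "(\<lambda>n. LINT y|lborel. indicator (E h) (y - ?x n) * ?f y) \<longlonglongrightarrow> (LINT y|lborel. ?f y)"
  proof (rule integral_dominated_convergence[where w="?f"])
    show "AE y in lborel. (\<lambda>n. indicator (E h) (y - ?x n) * ?f y) \<longlonglongrightarrow> ?f y"
    proof (intro AE_I2)
      fix y
      show "(\<lambda>n. indicator (E h) (y - ?x n) * ?f y) \<longlonglongrightarrow> ?f y"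
      proof (cases "y \<in> E h")
        case True
        have "(\<lambda>n. y - ?x n) \<longlonglongrightarrow> y - 0 *\<^sub>R e"
          using LIMSEQ_inverse_real_of_nat by (intro tendsto_intros) (simp add: inverse_eq_divide)
        then have "(\<lambda>n. y - ?x n) \<longlonglongrightarrow> y" by simp
        from topological_tendstoD[OF this open_E[OF h] True]
        have "\<forall>\<^sub>F n in sequentially. indicator (E h) (y - ?x n) * ?f y = ?f y"
          by (rule eventually_mono) (simp only: indicator_simps(1) mult_1)
        then show ?thesis by (rule tendsto_eventually)
      next
        case False
        then have "?f y = 0" using f_extremal_bounds[OF h, of y] by simp
        then show ?thesis by simp
      qed
    qed
    show "AE y in lborel. norm (indicator (E h) (y - ?x n) * ?f y) \<le> ?f y" for n
      using f_extremal_bounds(1)[OF h] by (intro AE_I2) (auto simp: indicator_def)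
    show "integrable lborel ?f" by (rule f_extremal_integrable[OF h])
  qed measurable
  moreover have "(LINT y|lborel. indicator (E h) (y - ?x n) * ?f y) = \<nu> ((+) (?x n) ` E h)" for n
  proof -
    have "(LINT y|lborel. indicator (E h) (y + ?x n - ?x n) * ?f (y + ?x n)) = (LINT y|lborel. indicator (E h) (y - ?x n) * ?f y)"
      by (rule integral_lborel_translate) measurable
    then show ?thesis unfolding val[OF x h] by (simp add: add.commute)
  qed
  ultimately have lim: "(\<lambda>n. \<nu> ((+) (?x n) ` E h)) \<longlonglongrightarrow> V_ext h" by (simp add: integral_f_extremal[OF h])
  have le: "charge_norm_h C K s \<nu> \<le> ennreal (V_ext h)" if "s > 0" for s
    unfolding charge_norm_h_def using upper that by (intro SUP_least ennreal_leI) auto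
  have "ennreal (\<nu> ((+) (?x n) ` E h)) \<le> charge_norm_h C K h \<nu>" for n
  proof -
    have "ennreal (\<nu> ((+) (?x n) ` E h)) \<le> ennreal \<bar>\<nu> ((+) (?x n) ` E h)\<bar>" by (intro ennreal_leI) simp
    also have "\<dots> \<le> charge_norm_h C K h \<nu>" unfolding charge_norm_h_def using x by (intro SUP_upper)
    finally show ?thesis .
  qed
  then have ge: "ennreal (V_ext h) \<le> charge_norm_h C K h \<nu>"
    by (intro LIMSEQ_le_const2[OF tendsto_ennrealI[OF lim]]) auto
  show eq: "charge_norm_h C K h \<nu> = ennreal (V_ext h)" by (rule antisym[OF le[OF h] ge])
  show "charge_norm C K \<nu> = ennreal (V_ext h)"
  proof (rule antisym)
    show "charge_norm C K \<nu> \<le> ennreal (V_ext h)" unfolding charge_norm_def by (rule SUP_least) (use le in auto)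
    have "charge_norm_h C K h \<nu> \<le> charge_norm C K \<nu>" unfolding charge_norm_def by (rule SUP_upper) (use h in auto)
    then show "ennreal (V_ext h) \<le> charge_norm C K \<nu>" by (simp only: eq)
  qed
qed

end

subsection \<open>The multiplicative inequality\<close>

text \<open>The hypothesis \<open>opt\<close> is stationarity of a t^\<kappa> + b / t in t,
  multiplied by t; the conclusion is the value at such a point with t eliminated.\<close>

lemma powr_mean_eq:
  fixes a b t \<kappa> :: real
  assumes a: "a > 0" and b: "b > 0" and t: "t > 0" and \<kappa>: "\<kappa> > 0" and opt: "\<kappa> * (a * t powr \<kappa>) = b / t"
  shows "a * t powr \<kappa> + b / t = (\<kappa> * a) powr (1 / (1 + \<kappa>)) * (1 / \<kappa> + 1) * b powr (1 - 1 / (1 + \<kappa>))"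
proof -
  define c where "c = 1 / (1 + \<kappa>)"
  have c: "c * \<kappa> = 1 - c" using \<kappa> by (simp add: c_def field_simps)
  \<comment> \<open>Split with weights c and 1 - c and the first factor rewritten by
    \<open>opt\<close>, the powers of t cancel because c \<kappa> = 1 - c.\<close>
  have "b / t = (b / t) powr c * (b / t) powr (1 - c)" using b t by (simp flip: powr_add)
  also have "(b / t) powr c = (\<kappa> * a) powr c * t powr (c * \<kappa>)"
  proof -
    have "b / t = \<kappa> * a * t powr \<kappa>" using opt by (simp add: mult.assoc)
    then have "(b / t) powr c = (\<kappa> * a) powr c * (t powr \<kappa>) powr c" by (simp only: powr_mult)
    then show ?thesis by (simp add: powr_powr mult.commute)
  qed
  also have "(b / t) powr (1 - c) = b powr (1 - c) / t powr (1 - c)" by (rule powr_divide)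
  also have "(\<kappa> * a) powr c * t powr (c * \<kappa>) * (b powr (1 - c) / t powr (1 - c)) = (\<kappa> * a) powr c * b powr (1 - c)"
    unfolding c using t by simp
  finally have bt: "b / t = (\<kappa> * a) powr c * b powr (1 - c)" .
  have "a * t powr \<kappa> = (1 / \<kappa>) * (b / t)" unfolding opt[symmetric] using \<kappa> by simp
  then have "a * t powr \<kappa> + b / t = (1 / \<kappa> + 1) * (b / t)" by (simp only: distrib_right mult_1)
  then show ?thesis unfolding bt c_def by (simp only: mult_ac)
qed

text \<open>For positive a and b the bound is evaluated at the stationary point. If a or b vanishes
  there is none; the remaining term is made arbitrarily small by a large or small t, so s \<le>
  0.\<close>

lemma powr_mean_bound:
  fixes a b \<kappa> s :: real
  assumes a: "a \<ge> 0" and b: "b \<ge> 0" and \<kappa>: "\<kappa> > 0" and s: "\<And>t. t > 0 \<Longrightarrow> s \<le> a * t powr \<kappa> + b / t"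
  shows "s \<le> (\<kappa> * a) powr (1 / (1 + \<kappa>)) * (1 / \<kappa> + 1) * b powr (1 - 1 / (1 + \<kappa>))"
proof (cases "a = 0 \<or> b = 0")
  case True
  have "s \<le> e" if e: "e > 0" for e
  proof (cases "a = 0")
    case True
    have t: "b / e + 1 > 0" using b e by (simp add: add_nonneg_pos)
    have "s \<le> b / (b / e + 1)" using s[OF t] True by simp
    also have "\<dots> \<le> e" using t e by (simp add: pos_divide_le_eq distrib_left)
    finally show ?thesis .
  next
    case False
    then have a: "a > 0" and "b = 0" using True \<open>a = 0 \<or> b = 0\<close> a by auto
    have "s \<le> a * ((e / a) powr (1 / \<kappa>)) powr \<kappa>" using s[of "(e / a) powr (1 / \<kappa>)"] \<open>b = 0\<close> a e by simp
    also have "\<dots> = e" using a e \<kappa> by (simp add: powr_powr)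
    finally show ?thesis .
  qed
  then have "s \<le> 0" by (rule field_le_epsilon[of s 0, simplified])
  also have "0 \<le> (\<kappa> * a) powr (1 / (1 + \<kappa>)) * (1 / \<kappa> + 1) * b powr (1 - 1 / (1 + \<kappa>))" using \<kappa> by simp
  finally show ?thesis .
next
  case False
  then have ab: "a > 0" "b > 0" using a b by auto
  define t where "t = (b / (\<kappa> * a)) powr (1 / (1 + \<kappa>))"
  have t: "t > 0" using ab \<kappa> by (simp add: t_def)
  have "t powr (1 + \<kappa>) = b / (\<kappa> * a)" using ab \<kappa> by (simp add: t_def powr_powr)
  then have "t * t powr \<kappa> = b / (\<kappa> * a)" using t by (simp add: powr_add)
  then have "\<kappa> * (a * t powr \<kappa>) = b / t" using t ab \<kappa> by (simp add: field_simps)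
  from s[OF t] powr_mean_eq[OF ab t \<kappa> this] show ?thesis by simp
qed

context extremal_problem
begin

text \<open>With t = h^d the factor h^(1-d/p) becomes t^\<kappa> and h^(-d) becomes 1/t, which puts
  the additive inequality into the form of \<open>powr_mean_bound\<close>; moreover \<alpha> = 1 /
  (1 + \<kappa>).\<close>

definition "\<kappa> = 1 / DIM('a) - r"

lemma \<kappa>_pos: "\<kappa> > 0" using r_less by (simp add: \<kappa>_def)

lemma alpha_eq: "alpha DIM('a) p = 1 / (1 + \<kappa>)"
proof (cases rule: p_cases)
  case 1
  have "alpha DIM('a) p = real DIM('a) / (real DIM('a) + 1)"
    unfolding 1(1) using DIM_ge_1 by (intro alpha_infinity) simp
  then show ?thesis unfolding \<kappa>_def 1(3) using DIM_ge_1 by (simp add: field_simps)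
next
  case (2 P)
  have "alpha DIM('a) p = P * real DIM('a) / (P + (P - 1) * real DIM('a))"
    unfolding alpha_def extend_top_def if_not_P[OF 2(1)] 2(2) ..
  moreover have "P + (P - 1) * real DIM('a) > 0" using 2(3,4) DIM_ge_1 by (simp add: add_pos_nonneg)
  ultimately show ?thesis
    unfolding \<kappa>_def 2(6) using 2(3,4) DIM_ge_1 by (simp add: field_simps)
qed

text \<open>The factor (p - d) / (p d) of the definition is \<kappa>, so the constant is the one
  produced by \<open>powr_mean_bound\<close>.\<close>

lemma a_const_eq: "a_const DIM('a) p = (\<kappa> * A_const DIM('a) p) powr (1 / (1 + \<kappa>)) * (1 / \<kappa> + 1)"
proof (cases rule: p_cases)
  case 1
  have "a_const DIM('a) p = (A_const DIM('a) p / real DIM('a)) powr alpha DIM('a) p * (real DIM('a) + 1)"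
    unfolding 1(1) using DIM_ge_1 by (intro a_const_infinity) simp
  then show ?thesis unfolding alpha_eq unfolding \<kappa>_def 1(3) by simp
next
  case (2 P)
  have p: "ennreal P = p" using 2(1,2) by (metis ennreal_enn2real infinity_ennreal_def less_top)
  have "a_const DIM('a) p = ((P - DIM('a)) * A_const DIM('a) p / (P * DIM('a))) powr alpha DIM('a) p * (P * DIM('a) / (P - DIM('a)) + 1)"
    unfolding a_const_def extend_top_def if_not_P[OF 2(1)] 2(2) p ..
  also have "(P - DIM('a)) * A_const DIM('a) p / (P * DIM('a)) = (P - DIM('a)) / (P * DIM('a)) * A_const DIM('a) p" by simp
  also have "(P - DIM('a)) / (P * DIM('a)) = \<kappa>"
    unfolding \<kappa>_def 2(6) using 2(3,4) DIM_ge_1 by (simp add: field_simps)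
  also have "P * DIM('a) / (P - DIM('a)) = 1 / \<kappa>"
    unfolding \<kappa>_def 2(6) using 2(3,4) DIM_ge_1 by (simp add: field_simps)
  finally show ?thesis unfolding alpha_eq .
qed

lemma A_const_nonneg: "A_const DIM('a) p \<ge> 0"
  using DIM_ge_1 by (simp add: A_const_def)

lemma multiplicative_constant:
  assumes L: "L \<ge> 0" and V: "V \<ge> 0"
  shows "(\<kappa> * (A_const DIM('a) p * m powr (- r) * L)) powr (1 / (1 + \<kappa>)) * (1 / \<kappa> + 1) * (V / m) powr (1 - 1 / (1 + \<kappa>))
    = a_const DIM('a) p * m powr (- alpha DIM('a) p / DIM('a)) * V powr (1 - alpha DIM('a) p) * L powr alpha DIM('a) p"
proof -
  define c where "c = 1 / (1 + \<kappa>)"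
  have c: "1 - c = \<kappa> * c" using \<kappa>_pos by (simp add: c_def field_simps)
  have "(\<kappa> * (A_const DIM('a) p * m powr (- r) * L)) powr c = (\<kappa> * A_const DIM('a) p) powr c * m powr (- r * c) * L powr c"
    by (simp only: powr_mult powr_powr mult.assoc)
  moreover have "(V / m) powr (1 - c) = V powr (1 - c) * m powr (- (\<kappa> * c))"
    unfolding c using m_pos by (simp add: powr_divide powr_minus_divide)
  moreover have "m powr (- r * c) * m powr (- (\<kappa> * c)) = m powr (- c / DIM('a))"
  proof -
    have "- r * c + - (\<kappa> * c) = - c / DIM('a)" unfolding \<kappa>_def by (simp add: algebra_simps)
    then show ?thesis by (metis powr_add)
  qed
  ultimately show ?thesis
    unfolding a_const_eq alpha_eq c_def[symmetric] by (simp add: mult_ac)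
qed

lemma powr_h:
  assumes "h > 0"
  shows "h powr (1 - DIM('a) * r) = (h ^ DIM('a)) powr \<kappa>" "h powr (- real DIM('a)) = 1 / h ^ DIM('a)"
proof -
  have "DIM('a) * \<kappa> = 1 - DIM('a) * r" using DIM_ge_1 by (simp add: \<kappa>_def right_diff_distrib)
  then show "h powr (1 - DIM('a) * r) = (h ^ DIM('a)) powr \<kappa>"
    using assms by (simp add: powr_powr powr_realpow[symmetric])
  show "h powr (- real DIM('a)) = 1 / h ^ DIM('a)" using assms by (simp add: powr_minus_divide powr_realpow)
qed

text \<open>Membership in \<open>sobolev_W1\<close> concerns the components of some weak gradient,
  the claim the dual norm of a given one. Uniqueness identifies the gradients, and the dual norm is
  at most a combination of the components.\<close>

lemma gradient_norm_finite:
  assumes f: "f \<in> sobolev_W1 p C" and wg: "has_weak_gradient C f G"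
  shows "Lp_norm p (lebesgue_on C) (\<lambda>x. N' (G x)) < \<infinity>"
proof -
  obtain G1 where G1: "has_weak_gradient C f G1" "\<And>b. b \<in> Basis \<Longrightarrow> (\<lambda>x. G1 x \<bullet> b) \<in> Lp_space p (lebesgue_on C)"
    using f by (auto simp: sobolev_W1_def)
  have Cl: "C \<inter> space lebesgue \<in> sets lebesgue" using C_sets by simp
  have ae: "AE x in lebesgue_on C. G x = G1 x"
    unfolding AE_restrict_space_iff[OF Cl] by (rule weak_gradient_unique[OF open_C wg G1(1)])
  show ?thesis
  proof (rule Lp_norm_finite_if_le_sum[OF p_nonzero finite_Basis])
    show "(\<lambda>x. N' (G x)) \<in> borel_measurable (lebesgue_on C)"
      using dual_gradient_measurable[OF wg] by (subst borel_measurable_restrict_space_iff[OF Cl]) simp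
    show "(\<lambda>x. G1 x \<bullet> b) \<in> borel_measurable (lebesgue_on C)" "Lp_norm p (lebesgue_on C) (\<lambda>x. G1 x \<bullet> b) < \<infinity>"
      if "b \<in> Basis" for b using G1(2)[OF that] by (auto simp: Lp_space_def)
    show "0 \<le> N' b" for b by simp
    show "AE x in lebesgue_on C. \<bar>N' (G x)\<bar> \<le> (\<Sum>b\<in>Basis. N' b * \<bar>G1 x \<bullet> b\<bar>)"
      using ae
    proof eventually_elim
      case (elim x)
      have "N' z \<le> (\<Sum>b\<in>Basis. N' b * \<bar>z \<bullet> b\<bar>)" for z :: 'a
      proof (rule dual_le)
        fix y :: 'a assume y: "N y \<le> 1"
        have "y \<bullet> z = (\<Sum>b\<in>Basis. (y \<bullet> b) * (z \<bullet> b))" by (rule euclidean_inner)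
        also have "\<dots> \<le> (\<Sum>b\<in>Basis. N' b * \<bar>z \<bullet> b\<bar>)"
        proof (rule sum_mono)
          fix b :: 'a
          have "\<bar>y \<bullet> b\<bar> \<le> N' b * N y" by (rule abs_inner_le_dual_mult)
          also have "\<dots> \<le> N' b * 1" using y by (intro mult_left_mono) auto
          finally have "\<bar>y \<bullet> b\<bar> * \<bar>z \<bullet> b\<bar> \<le> N' b * \<bar>z \<bullet> b\<bar>" by (simp add: mult_right_mono)
          then show "(y \<bullet> b) * (z \<bullet> b) \<le> N' b * \<bar>z \<bullet> b\<bar>" by (metis abs_mult abs_ge_self order_trans)
        qed
        finally show "y \<bullet> z \<le> (\<Sum>b\<in>Basis. N' b * \<bar>z \<bullet> b\<bar>)" .
      qed
      then show ?case by (simp add: elim)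
    qed
  qed
qed

lemma charge_norm_h_le: "h > 0 \<Longrightarrow> charge_norm_h C K h \<nu> \<le> charge_norm C K \<nu>"
  unfolding charge_norm_def by (rule SUP_upper) simp

text \<open>The supremum norm of the charge replaces its norm at h, so that only the explicit powers
  of h vary and the minimisation over h can be carried out.\<close>

lemma multiplicative_inequality:
  assumes \<nu>: "charge_norm C K \<nu> < \<infinity>" "has_RN_deriv C \<nu> f"
    and f: "f \<in> sobolev_W1 p C" and wg: "has_weak_gradient C f G"
  shows "Lp_norm \<infinity> (lebesgue_on C) f
    \<le> ennreal (a_const DIM('a) p * m powr (- alpha DIM('a) p / DIM('a)))
      * epowr (charge_norm C K \<nu>) (1 - alpha DIM('a) p)
      * epowr (Lp_norm p (lebesgue_on C) (\<lambda>x. N' (G x))) (alpha DIM('a) p)"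
proof -
  define L where "L = enn2real (Lp_norm p (lebesgue_on C) (\<lambda>x. N' (G x)))"
  have L: "Lp_norm p (lebesgue_on C) (\<lambda>x. N' (G x)) = ennreal L" "L \<ge> 0"
    using gradient_norm_finite[OF f wg] by (auto simp: L_def)
  define V where "V = enn2real (charge_norm C K \<nu>)"
  have V: "charge_norm C K \<nu> = ennreal V" "V \<ge> 0" using \<nu>(1) by (auto simp: V_def)
  define S where "S = Lp_norm \<infinity> (lebesgue_on C) f"
  have bound: "S \<le> ennreal ((A_const DIM('a) p * m powr (- r) * L) * t powr \<kappa> + (V / m) / t)" if t: "t > 0" for t
  proof -
    define h where "h = t powr (1 / DIM('a))"
    have h: "h > 0" "h ^ DIM('a) = t" using t DIM_ge_1 by (auto simp: h_def powr_powr powr_realpow[symmetric])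
    have fin: "charge_norm_h C K h \<nu> < \<infinity>" using charge_norm_h_le[OF h(1), of \<nu>] \<nu>(1) by (rule le_less_trans)
    have "S \<le> ennreal (I h powr (1 - r)) * ennreal L + ennreal (m powr (-1) * h powr (- real DIM('a))) * charge_norm_h C K h \<nu>"
      unfolding S_def L(1)[symmetric] by (rule additive_inequality[OF h(1) fin \<nu>(2) wg])
    also have "\<dots> \<le> ennreal (I h powr (1 - r)) * ennreal L + ennreal (m powr (-1) * h powr (- real DIM('a))) * ennreal V"
      unfolding V(1)[symmetric] by (intro add_left_mono mult_left_mono charge_norm_h_le h(1)) simp
    also have "\<dots> = ennreal (I h powr (1 - r) * L + (m powr (-1) * h powr (- real DIM('a))) * V)"
      using L(2) V(2) by (intro ennreal_lincomb) simp_all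
    also have "I h powr (1 - r) * L + (m powr (-1) * h powr (- real DIM('a))) * V
      = (A_const DIM('a) p * m powr (- r) * L) * t powr \<kappa> + (V / m) / t"
      unfolding I_root[OF h(1)] powr_h[OF h(1)] h(2) using m_pos by (simp add: powr_minus_divide)
    finally show ?thesis .
  qed
  \<comment> \<open>A single value of t shows that S is finite; from here on the minimisation takes
    place in the reals.\<close>
  have Sfin: "S \<noteq> \<infinity>" using bound[of 1] by (auto simp: top_unique)
  define s where "s = enn2real S"
  have s: "S = ennreal s" "s \<ge> 0" using Sfin by (auto simp: s_def less_top)
  have "s \<le> (\<kappa> * (A_const DIM('a) p * m powr (- r) * L)) powr (1 / (1 + \<kappa>)) * (1 / \<kappa> + 1) * (V / m) powr (1 - 1 / (1 + \<kappa>))"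
  proof (rule powr_mean_bound[OF _ _ \<kappa>_pos])
    show "0 \<le> A_const DIM('a) p * m powr (- r) * L" using A_const_nonneg L(2) by simp
    show "0 \<le> V / m" using V(2) m_pos by simp
    fix t :: real assume t: "t > 0"
    have "0 \<le> (A_const DIM('a) p * m powr (- r) * L) * t powr \<kappa> + (V / m) / t"
      using A_const_nonneg L(2) V(2) m_pos t by simp
    then show "s \<le> (A_const DIM('a) p * m powr (- r) * L) * t powr \<kappa> + (V / m) / t"
      using bound[OF t] s by simp
  qed
  also have "\<dots> = a_const DIM('a) p * m powr (- alpha DIM('a) p / DIM('a)) * V powr (1 - alpha DIM('a) p) * L powr alpha DIM('a) p"
    by (rule multiplicative_constant[OF L(2) V(2)])
  finally have "S \<le> ennreal (a_const DIM('a) p * m powr (- alpha DIM('a) p / DIM('a)) * V powr (1 - alpha DIM('a) p) * L powr alpha DIM('a) p)"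
    unfolding s(1) by (rule ennreal_leI)
  then show ?thesis
    unfolding S_def[symmetric] V(1) L(1) using V(2) L(2) by (simp add: epowr_def ennreal_mult'')
qed

text \<open>The supremum splits into the gradient term I and the charge term \<kappa> I; both
  equality statements rest on this.\<close>

lemma X_decomposition: "X h = I h + \<kappa> * I h" "V_ext h = m * h ^ DIM('a) * (\<kappa> * I h)"
  by (simp_all add: X_def V_ext_def \<kappa>_def algebra_simps)

lemma additive_equality:
  assumes h: "h > 0" and \<nu>: "has_RN_deriv C \<nu> (f_extremal C K p h)" and wg: "has_weak_gradient C (f_extremal C K p h) G"
  shows "Lp_norm \<infinity> (lebesgue_on C) (f_extremal C K p h)
    = ennreal (I h powr (1 - r)) * Lp_norm p (lebesgue_on C) (\<lambda>x. N' (G x))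
      + ennreal (m powr (-1) * h powr (- real DIM('a))) * charge_norm_h C K h \<nu>"
proof -
  have i: "I h powr (1 - r) * I h powr r = I h" using I_pos[OF h] by (simp flip: powr_add)
  have v: "(m powr (-1) * h powr (- real DIM('a))) * V_ext h = \<kappa> * I h"
    unfolding X_decomposition(2) powr_h(2)[OF h] using m_pos h by (simp add: powr_minus_divide)
  have "ennreal (I h powr (1 - r)) * ennreal (I h powr r) + ennreal (m powr (-1) * h powr (- real DIM('a))) * ennreal (V_ext h)
    = ennreal (I h powr (1 - r) * I h powr r + (m powr (-1) * h powr (- real DIM('a))) * V_ext h)"
    using V_ext_pos[OF h] by (intro ennreal_lincomb) simp_all
  also have "\<dots> = ennreal (X h)" unfolding i v X_decomposition(1) ..
  finally show ?thesis
    unfolding Linf_extremal[OF h] Lp_norm_gradient_extremal[OF h wg] charge_norms_extremal(1)[OF h \<nu>] ..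
qed

text \<open>For every h the point t = h^d is stationary for the data of its own extremal function,
  since there b / t = \<kappa> I and a t^\<kappa> = I. So \<open>powr_mean_eq\<close> evaluates the
  sum without loss.\<close>

lemma multiplicative_equality:
  assumes h: "h > 0" and \<nu>: "has_RN_deriv C \<nu> (f_extremal C K p h)" and wg: "has_weak_gradient C (f_extremal C K p h) G"
  shows "Lp_norm \<infinity> (lebesgue_on C) (f_extremal C K p h)
    = ennreal (a_const DIM('a) p * m powr (- alpha DIM('a) p / DIM('a)))
      * epowr (charge_norm C K \<nu>) (1 - alpha DIM('a) p)
      * epowr (Lp_norm p (lebesgue_on C) (\<lambda>x. N' (G x))) (alpha DIM('a) p)"
proof -
  let ?V = "V_ext h" and ?L = "I h powr r"
  let ?a = "A_const DIM('a) p * m powr (- r) * ?L"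
  have t: "h ^ DIM('a) > 0" using h by simp
  have at: "?a * (h ^ DIM('a)) powr \<kappa> = I h"
  proof -
    have "?a * (h ^ DIM('a)) powr \<kappa> = I h powr (1 - r) * I h powr r"
      unfolding I_root[OF h] powr_h(1)[OF h] by (simp only: mult_ac)
    also have "\<dots> = I h" using I_pos[OF h] by (simp flip: powr_add)
    finally show ?thesis .
  qed
  have bt: "?V / m / h ^ DIM('a) = \<kappa> * I h" unfolding X_decomposition(2) using m_pos h by simp
  have apos: "?a > 0"
  proof -
    have "?a * (h ^ DIM('a)) powr \<kappa> > 0" unfolding at by (rule I_pos[OF h])
    then show ?thesis using t by (simp only: zero_less_mult_iff) (auto simp: not_less)
  qed
  have "X h = ?a * (h ^ DIM('a)) powr \<kappa> + ?V / m / h ^ DIM('a)" unfolding at bt X_decomposition(1) ..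
  also have "\<dots> = (\<kappa> * ?a) powr (1 / (1 + \<kappa>)) * (1 / \<kappa> + 1) * (?V / m) powr (1 - 1 / (1 + \<kappa>))"
    by (rule powr_mean_eq[OF apos _ t \<kappa>_pos]) (use V_ext_pos[OF h] m_pos at bt in simp_all)
  also have "\<dots> = a_const DIM('a) p * m powr (- alpha DIM('a) p / DIM('a)) * ?V powr (1 - alpha DIM('a) p) * ?L powr alpha DIM('a) p"
    by (rule multiplicative_constant) (use V_ext_pos[OF h] in simp_all)
  finally have X: "X h = \<dots>" .
  show ?thesis
    unfolding Linf_extremal[OF h] Lp_norm_gradient_extremal[OF h wg] charge_norms_extremal(2)[OF h \<nu>] X
    using V_ext_pos[OF h] by (simp add: epowr_def ennreal_mult'')
qed

end

text \<open>Densities and weak gradients enter as relations, so both inequalities are claimed for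
  every version. Existence of a charge with the extremal density, and of a weak gradient of that
  density, is asserted along with the equalities.\<close>

theorem theorem3:
  fixes C K :: "'a::euclidean_space set" and p :: ennreal
  assumes "open C" and "convex C" and "positive_cone C"
    and "bounded K" and "open K" and "convex K" and "\<And>x. x \<in> K \<Longrightarrow> - x \<in> K" and "0 \<in> interior K"
    and "of_nat DIM('a) < p"
  defines "d \<equiv> DIM('a)"
    and "M \<equiv> lebesgue_on C"
    and "m \<equiv> measure lebesgue (K \<inter> C)"
  shows
    "(\<forall>h>0.
        (\<forall>\<nu> f G. \<nu> \<in> bounded_charges_h C K h \<and> has_RN_deriv C \<nu> f \<and>
            f \<in> sobolev_W1 p C \<and> has_weak_gradient C f G \<longrightarrow>
          Lp_norm \<infinity> M f \<le>
            ennreal (A_const d p * m powr (- recip p) * h powr (1 - real d * recip p))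
              * Lp_norm p M (\<lambda>x. dual_norm K (G x))
            + ennreal (m powr (-1) * h powr (- real d)) * charge_norm_h C K h \<nu>) \<and>
        f_extremal C K p h \<in> sobolev_W1 p C \<and>
        (\<exists>\<nu>. \<nu> \<in> ac_charges C \<and> has_RN_deriv C \<nu> (f_extremal C K p h)) \<and>
        (\<forall>\<nu> f G. \<nu> \<in> ac_charges C \<and> has_RN_deriv C \<nu> f \<and>
            f = f_extremal C K p h \<and> has_weak_gradient C f G \<longrightarrow>
          \<nu> \<in> bounded_charges_h C K h \<and>
          Lp_norm \<infinity> M f =
            ennreal (A_const d p * m powr (- recip p) * h powr (1 - real d * recip p))
              * Lp_norm p M (\<lambda>x. dual_norm K (G x))
            + ennreal (m powr (-1) * h powr (- real d)) * charge_norm_h C K h \<nu>)) \<and>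
     (\<forall>\<nu> f G. \<nu> \<in> bounded_charges C K \<and> has_RN_deriv C \<nu> f \<and>
         f \<in> sobolev_W1 p C \<and> has_weak_gradient C f G \<longrightarrow>
       Lp_norm \<infinity> M f \<le>
         ennreal (a_const d p * m powr (- alpha d p / real d))
           * epowr (charge_norm C K \<nu>) (1 - alpha d p)
           * epowr (Lp_norm p M (\<lambda>x. dual_norm K (G x))) (alpha d p)) \<and>
     (\<forall>h>0. \<forall>\<nu> f G. \<nu> \<in> ac_charges C \<and> has_RN_deriv C \<nu> f \<and>
         f = f_extremal C K p h \<and> has_weak_gradient C f G \<longrightarrow>
       \<nu> \<in> bounded_charges C K \<and>
       Lp_norm \<infinity> M f =
         ennreal (a_const d p * m powr (- alpha d p / real d))
           * epowr (charge_norm C K \<nu>) (1 - alpha d p)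
           * epowr (Lp_norm p M (\<lambda>x. dual_norm K (G x))) (alpha d p))"
proof -
  interpret ext: extremal_problem K C p
    using assms(1-9) interior_subset[of K] by unfold_locales auto
  have m: "m = ext.m" by (simp only: m_def ext.m_def)
  \<comment> \<open>The locale works with \<open>I h\<close>; this identity translates its
    coefficient into the stated one.\<close>
  have coefficient: "A_const DIM('a) p * ext.m powr (- recip p) * h powr (1 - real DIM('a) * recip p)
      = ext.I h powr (1 - ext.r)" if "h > 0" for h
    unfolding ext.r_def[symmetric] by (rule ext.I_root[OF that, symmetric])
  show ?thesis
  proof (intro conjI allI impI)
    fix h :: real and \<nu> f G
    assume h: "h > 0" and "\<nu> \<in> bounded_charges_h C K h \<and> has_RN_deriv C \<nu> f \<and>
      f \<in> sobolev_W1 p C \<and> has_weak_gradient C f G"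
    then show "Lp_norm \<infinity> M f \<le>
        ennreal (A_const d p * m powr (- recip p) * h powr (1 - real d * recip p))
          * Lp_norm p M (\<lambda>x. dual_norm K (G x))
        + ennreal (m powr (-1) * h powr (- real d)) * charge_norm_h C K h \<nu>"
      unfolding m d_def M_def unfolding coefficient[OF h]
      by (intro ext.additive_inequality) (auto simp: bounded_charges_h_def)
  next
    fix h :: real assume h: "h > 0"
    show "f_extremal C K p h \<in> sobolev_W1 p C" by (rule ext.f_extremal_sobolev[OF h])
    show "\<exists>\<nu>. \<nu> \<in> ac_charges C \<and> has_RN_deriv C \<nu> (f_extremal C K p h)" by (rule ext.ex_charge_extremal[OF h])
  next
    fix h :: real and \<nu> f G
    assume h: "h > 0" and *: "\<nu> \<in> ac_charges C \<and> has_RN_deriv C \<nu> f \<and>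
      f = f_extremal C K p h \<and> has_weak_gradient C f G"
    then have f: "f = f_extremal C K p h" and \<nu>: "has_RN_deriv C \<nu> (f_extremal C K p h)"
      and wg: "has_weak_gradient C (f_extremal C K p h) G" by auto
    show "\<nu> \<in> bounded_charges_h C K h"
      using * ext.charge_norms_extremal(1)[OF h \<nu>] by (simp add: bounded_charges_h_def)
    show "Lp_norm \<infinity> M f =
        ennreal (A_const d p * m powr (- recip p) * h powr (1 - real d * recip p))
          * Lp_norm p M (\<lambda>x. dual_norm K (G x))
        + ennreal (m powr (-1) * h powr (- real d)) * charge_norm_h C K h \<nu>"
      unfolding f m d_def M_def unfolding coefficient[OF h] by (rule ext.additive_equality[OF h \<nu> wg])
    show "\<nu> \<in> bounded_charges C K"
      using * ext.charge_norms_extremal(2)[OF h \<nu>] by (simp add: bounded_charges_def)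
    show "Lp_norm \<infinity> M f =
        ennreal (a_const d p * m powr (- alpha d p / real d))
          * epowr (charge_norm C K \<nu>) (1 - alpha d p)
          * epowr (Lp_norm p M (\<lambda>x. dual_norm K (G x))) (alpha d p)"
      unfolding f m d_def M_def by (rule ext.multiplicative_equality[OF h \<nu> wg])
  next
    fix \<nu> f G
    assume "\<nu> \<in> bounded_charges C K \<and> has_RN_deriv C \<nu> f \<and>
      f \<in> sobolev_W1 p C \<and> has_weak_gradient C f G"
    then show "Lp_norm \<infinity> M f \<le>
        ennreal (a_const d p * m powr (- alpha d p / real d))
          * epowr (charge_norm C K \<nu>) (1 - alpha d p)
          * epowr (Lp_norm p M (\<lambda>x. dual_norm K (G x))) (alpha d p)"
      unfolding m d_def M_def
      by (intro ext.multiplicative_inequality) (auto simp: bounded_charges_def)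
  qed
qed

end
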